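(* Let $T$ be a near-triangulation with a simple closed boundary such that all internal vertices have degree at least $6$. Then the distances between boundary vertices determine $T$. That is: if $T_1$ and $T_2$ are two near-triangulations with simple closed boundary, in each of which all internal vertices have degree at least $6$, and $\varphi$ is a bijection from the set of boundary vertices of $T_1$ to the set of boundary vertices of $T_2$ such that $d_{T_1}(u,v)=d_{T_2}(\varphi(u),\varphi(v))$ for all boundary vertices $u,v$ of $T_1$, then $\varphi$ extends to a graph isomorphism from $T_1$ to $T_2$ which carries the boundary cycle of $T_1$ to that of $T_2$ and internal faces of $T_1$ to internal faces of $T_2$.
   Context: Graphs are finite and simple. A near-triangulation with a simple closed boundary is a plane graph whose outer face is bounded by a (simple) cycle, the boundary, and every other face (internal face) is a triangle. Vertices on the boundary cycle are boundary vertices; all other vertices are internal. $d_G$ denotes graph distance in $G$. The cyclic order of the boundary vertices is not part of the given information; only the set of boundary vertices and their pairwise distances in the graph are given. *)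

theory Defs
  imports "HOL-Analysis.Analysis" "HOL-Library.Extended_Nat"
begin

text \<open>
  Plane graphs are taken topologically: vertices are points of the plane, and an edge is the point
  set of an arc (endpoints included) that meets the vertex set exactly in its two endpoints. So
  \<open>e \<inter> verts G\<close> is the set of ends of an edge \<open>e\<close>.
\<close>

record pgraph =
  verts :: "complex set"
  edges :: "complex set set"

definition plane_graph :: "pgraph \<Rightarrow> bool" where
  "plane_graph G \<longleftrightarrow>
     finite (verts G) \<and>
     (\<forall>e\<in>edges G. \<exists>g. arc g \<and> path_image g = e \<and>
        e \<inter> verts G = {pathstart g, pathfinish g}) \<and>
     (\<forall>e\<in>edges G. \<forall>e'\<in>edges G. e \<noteq> e' \<longrightarrow>
        e \<inter> e' \<subseteq> verts G \<and> e \<inter> verts G \<noteq> e' \<inter> verts G)"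

definition adjacent :: "pgraph \<Rightarrow> complex \<Rightarrow> complex \<Rightarrow> bool" where
  "adjacent G u v \<longleftrightarrow> (\<exists>e\<in>edges G. e \<inter> verts G = {u, v})"

definition vdegree :: "pgraph \<Rightarrow> complex \<Rightarrow> nat" where
  "vdegree G v = card {u. adjacent G v u}"

text \<open>The length of a shortest walk, and \<open>\<infinity>\<close> if there is none.\<close>

definition gdist :: "pgraph \<Rightarrow> complex \<Rightarrow> complex \<Rightarrow> enat" where
  "gdist G u v = (INF n\<in>{n. (u, v) \<in> {(x, y). adjacent G x y} ^^ n}. enat n)"

definition support :: "pgraph \<Rightarrow> complex set" where
  "support G = verts G \<union> \<Union>(edges G)"

definition faces :: "pgraph \<Rightarrow> complex set set" where
  "faces G = components (- support G)"

text \<open>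
  The library's \<^const>\<open>outside\<close> of a set is the union of all unbounded components of its complement;
  for a plane graph there is exactly one (see \<open>outer_face_iff\<close> below).
\<close>

definition outer_face :: "pgraph \<Rightarrow> complex set" where
  "outer_face G = outside (support G)"

definition internal_faces :: "pgraph \<Rightarrow> complex set set" where
  "internal_faces G = faces G - {outer_face G}"

definition is_cycle :: "pgraph \<Rightarrow> complex list \<Rightarrow> bool" where
  "is_cycle G vs \<longleftrightarrow> 3 \<le> length vs \<and> distinct vs \<and>
     (\<forall>i<length vs. adjacent G (vs ! i) (vs ! (Suc i mod length vs)))"

definition cycle_edges :: "pgraph \<Rightarrow> complex list \<Rightarrow> complex set set" where
  "cycle_edges G vs =
     {e \<in> edges G. \<exists>i<length vs. e \<inter> verts G = {vs ! i, vs ! (Suc i mod length vs)}}"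

definition bounded_by_cycle :: "pgraph \<Rightarrow> complex set \<Rightarrow> complex list \<Rightarrow> bool" where
  "bounded_by_cycle G f vs \<longleftrightarrow> is_cycle G vs \<and> frontier f = \<Union>(cycle_edges G vs)"

definition near_triangulation :: "pgraph \<Rightarrow> bool" where
  "near_triangulation G \<longleftrightarrow>
     plane_graph G \<and>
     (\<exists>vs. bounded_by_cycle G (outer_face G) vs) \<and>
     (\<forall>f\<in>internal_faces G. \<exists>vs. length vs = 3 \<and> bounded_by_cycle G f vs)"

definition boundary_verts :: "pgraph \<Rightarrow> complex set" where
  "boundary_verts G = verts G \<inter> frontier (outer_face G)"

definition internal_verts :: "pgraph \<Rightarrow> complex set" where
  "internal_verts G = verts G - boundary_verts G"

text \<open>
  The edges on the boundary of a face, each given abstractly by its set of ends, so that a map on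
  vertices acts on them.
\<close>

definition face_boundary :: "pgraph \<Rightarrow> complex set \<Rightarrow> complex set set" where
  "face_boundary G f = {e \<inter> verts G |e. e \<in> edges G \<and> e \<subseteq> frontier f}"

definition graph_iso :: "pgraph \<Rightarrow> pgraph \<Rightarrow> (complex \<Rightarrow> complex) \<Rightarrow> bool" where
  "graph_iso G H \<psi> \<longleftrightarrow> bij_betw \<psi> (verts G) (verts H) \<and>
     (\<forall>u\<in>verts G. \<forall>v\<in>verts G. adjacent G u v \<longleftrightarrow> adjacent H (\<psi> u) (\<psi> v))"

lemma compact_support:
  assumes "plane_graph G"
  shows "compact (support G)"
proof -
  have fin: "finite (verts G)" using assms by (simp add: plane_graph_def)
  have "inj_on (\<lambda>e. e \<inter> verts G) (edges G)"
    using assms unfolding plane_graph_def inj_on_def by blast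
  moreover have "finite ((\<lambda>e. e \<inter> verts G) ` edges G)"
    by (rule finite_subset[of _ "Pow (verts G)"]) (use fin in auto)
  ultimately have "finite (edges G)" by (rule finite_imageD[rotated])
  moreover have "compact e" if "e \<in> edges G" for e
    using assms that unfolding plane_graph_def by (metis compact_arc_image arc_imp_path compact_path_image)
  ultimately have "compact (\<Union>(edges G))" by (intro compact_Union) auto
  then show ?thesis unfolding support_def using fin by (simp add: compact_Un finite_imp_compact)
qed

lemma outer_face_iff:
  assumes "plane_graph G"
  shows "f = outer_face G \<longleftrightarrow> f \<in> faces G \<and> \<not> bounded f"
proof -
  have bdd: "bounded (support G)"
    using compact_support[OF assms] compact_imp_bounded by blast
  have "connected (outer_face G)"
    unfolding outer_face_def by (rule connected_outside[OF bdd]) simp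
  moreover have "outer_face G \<noteq> {}"
    unfolding outer_face_def using outside_bounded_nonempty[OF bdd] .
  ultimately have in_faces: "outer_face G \<in> faces G"
    unfolding faces_def outer_face_def outside_in_components by blast
  have unb: "\<not> bounded (outer_face G)"
    unfolding outer_face_def using unbounded_outside[OF bdd] .
  have "f = outer_face G" if "f \<in> faces G" "\<not> bounded f"
    using cobounded_unique_unbounded_components[of "- support G" f "outer_face G"]
      bdd that in_faces unb by (simp add: faces_def)
  then show ?thesis using in_faces unb by blast
qed

end

theory Submission
  imports Defs "HOL-Complex_Analysis.Winding_Numbers"
begin

text \<open>
  A near-triangulation is replaced by the set of vertex triples of its internal faces. By the Jordan
  curve theorem this is a disc modulo 2: every cycle bounds a unique set of triangles. If all internal
  vertices have degree at least 6, the combinatorial Gauss-Bonnet formula makes such a disc behave like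
  a nonpositively curved space. If two adjacent vertices are equally far from \<open>x\<close>, some triangle on
  their edge has its third vertex closer to \<open>x\<close>; and any two neighbours of \<open>v\<close> that are closer to \<open>x\<close>
  than \<open>v\<close> form a triangle with \<open>v\<close>.

  The distances first determine the boundary cycle. Take a minimal segment \<open>v 0, \<dots>, v (k + 1)\<close> of it
  that is not a geodesic, inside an arc that no chord leaves. The two conditions show that the
  triangles at its inner vertices form a band, whose other side is a path \<open>w 0, \<dots>, w k\<close> with the same
  ends. Cutting the band off leaves a smaller disc with the same distances. The distance from \<open>w i\<close> to
  a remaining vertex is a function of the distances from \<open>v i\<close> and \<open>v (i + 1)\<close>, and \<open>w i\<close> and \<open>w j\<close> have
  distance \<open>\<bar>i - j\<bar>\<close>. So the boundary distances of the smaller disc are known, and the theorem follows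
  by induction.
\<close>

section \<open>Boundaries modulo 2\<close>

text \<open>The bound 6 enters only through counting. If every triangle is thought of as
  equilateral, \<open>6 - deg\<close> is the curvature of an inner vertex and \<open>3 - deg\<close>
  the turning at a boundary vertex, in units of 60 degrees; with no positive curvature inside, the
  total turning of a subdisc is at least 6. In a minimal bigon between two geodesics the sides turn
  by at most 0 at each vertex and the far tip by at most 2, so at least 4 is left for the near end.
  This forces both conditions.

  The induction must pass to subdiscs without any topology, hence homology modulo 2: a set of
  triangles of a disc whose boundary is one cycle is again a disc, and its inner vertices keep their
  degrees.

  The segment is constrained from two sides. The inner side of the band must avoid the old boundary,
  or the remainder would be pinched; so no chord may start at an inner vertex of the segment. And
  the choice must be visible in the boundary distances, so that the same segment serves in both
  near-triangulations; chords are visible because adjacency is distance 1.\<close>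

definition deg :: "'a set set \<Rightarrow> 'a \<Rightarrow> nat" where
  "deg Z v = card {e\<in>Z. v \<in> e}"

definition even_set :: "'a set set \<Rightarrow> bool" where
  "even_set Z \<longleftrightarrow> (\<forall>v. even (deg Z v))"

text \<open>The boundary operator on chains modulo 2. A chain is the set of triangles with
  coefficient 1, so addition of chains is \<open>sym_diff\<close>.\<close>

definition bd :: "'a set set \<Rightarrow> 'a set set" where
  "bd S = {e. card e = 2 \<and> odd (card {t\<in>S. e \<subseteq> t})}"

definition sides :: "'a set set \<Rightarrow> 'a set set" where
  "sides S = {e. card e = 2 \<and> (\<exists>t\<in>S. e \<subseteq> t)}"

text \<open>A simple cycle without a chosen cyclic order. Connectedness is expressed by minimality
  among nonempty even sets, which is the form in which a disc uses it: an even part of the boundary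
  is nothing or everything.\<close>

definition circuit :: "'a set set \<Rightarrow> bool" where
  "circuit C \<longleftrightarrow> finite C \<and> C \<noteq> {} \<and> (\<forall>e\<in>C. card e = 2) \<and> (\<forall>v\<in>\<Union>C. deg C v = 2) \<and>
     (\<forall>Z\<subseteq>C. even_set Z \<longrightarrow> Z = {} \<or> Z = C)"

lemma odd_card_sym_diff:
  assumes "finite A" "finite B"
  shows "odd (card (sym_diff A B)) \<longleftrightarrow> odd (card A) \<noteq> odd (card B)"
proof -
  have "card (sym_diff A B) = card (A - B) + card (B - A)"
    using assms by (intro card_Un_disjoint) auto
  moreover have "card A = card (A - B) + card (A \<inter> B)"
    using assms by (subst card_Un_disjoint[symmetric]) (auto intro: arg_cong[where f=card])
  moreover have "card B = card (B - A) + card (A \<inter> B)"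
    using assms by (subst card_Un_disjoint[symmetric]) (auto intro: arg_cong[where f=card])
  ultimately show ?thesis by presburger
qed

lemma odd_card_filter_sym_diff:
  assumes "finite A" "finite B"
  shows "odd (card {x\<in>sym_diff A B. P x}) \<longleftrightarrow> odd (card {x\<in>A. P x}) \<noteq> odd (card {x\<in>B. P x})"
proof -
  have "{x\<in>sym_diff A B. P x} = sym_diff {x\<in>A. P x} {x\<in>B. P x}" by auto
  then show ?thesis using odd_card_sym_diff[of "{x\<in>A. P x}" "{x\<in>B. P x}"] assms by simp
qed

lemma odd_deg_sym_diff:
  assumes "finite A" "finite B"
  shows "odd (deg (sym_diff A B) v) \<longleftrightarrow> odd (deg A v) \<noteq> odd (deg B v)"
  unfolding deg_def using odd_card_filter_sym_diff[OF assms, of "\<lambda>e. v \<in> e"] .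

lemma even_set_sym_diff:
  assumes "finite A" "finite B" "even_set A" "even_set B"
  shows "even_set (sym_diff A B)"
  using assms odd_deg_sym_diff[OF assms(1,2)] unfolding even_set_def by blast

lemma bd_sym_diff:
  assumes "finite A" "finite B"
  shows "bd (sym_diff A B) = sym_diff (bd A) (bd B)"
proof (rule set_eqI)
  fix e show "e \<in> bd (sym_diff A B) \<longleftrightarrow> e \<in> sym_diff (bd A) (bd B)"
    using odd_card_filter_sym_diff[OF assms, of "\<lambda>t. e \<subseteq> t"] by (auto simp: bd_def)
qed

lemma bd_empty [simp]: "bd {} = {}" by (simp add: bd_def)

lemma bd_subset_sides: "bd S \<subseteq> sides S"
proof
  fix e assume e: "e \<in> bd S"
  then have "{t\<in>S. e \<subseteq> t} \<noteq> {}" unfolding bd_def by force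
  then show "e \<in> sides S" using e by (auto simp: bd_def sides_def)
qed

lemma sides_mono: "S \<subseteq> T \<Longrightarrow> sides S \<subseteq> sides T" unfolding sides_def by blast

lemma card2D: "card e = 2 \<Longrightarrow> v \<in> e \<Longrightarrow> \<exists>u. u \<noteq> v \<and> e = {v, u}"
  by (auto simp: card_2_iff)

lemma card3D: "card t = 3 \<Longrightarrow> {a,b} \<subseteq> t \<Longrightarrow> a \<noteq> b \<Longrightarrow> \<exists>c. c \<noteq> a \<and> c \<noteq> b \<and> t = {a,b,c}"
  by (auto simp: card_3_iff)

lemma pairs_triangle:
  assumes "a \<noteq> b" "b \<noteq> c" "a \<noteq> c"
  shows "{e. card e = 2 \<and> e \<subseteq> {a,b,c}} = {{a,b},{b,c},{a,c}}"
  using assms by (auto simp: card_2_iff doubleton_eq_iff)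

lemma bd_single:
  assumes "a \<noteq> b" "b \<noteq> c" "a \<noteq> c"
  shows "bd {{a,b,c}} = {{a,b},{b,c},{a,c}}"
proof -
  have "{t\<in>{{a,b,c}}. e \<subseteq> t} = (if e \<subseteq> {a,b,c} then {{a,b,c}} else {})" for e by auto
  then have "bd {{a,b,c}} = {e. card e = 2 \<and> e \<subseteq> {a,b,c}}" by (auto simp: bd_def)
  also have "\<dots> = {{a,b},{b,c},{a,c}}"
    by (rule pairs_triangle[OF assms])
  finally show ?thesis .
qed

lemma even_set_bd_single:
  assumes "card t = 3" shows "even_set (bd {t})"
proof -
  obtain a b c where t: "t = {a,b,c}" "a \<noteq> b" "b \<noteq> c" "a \<noteq> c"
    using assms by (auto simp: card_3_iff)
  have "even (deg (bd {t}) v)" for v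
  proof -
    have *: "{e\<in>{{a,b},{b,c},{a,c}}. v \<in> e} = (if v = a then {{a,b},{a,c}} else if v = b then {{a,b},{b,c}}
       else if v = c then {{b,c},{a,c}} else {})"
      using t by auto
    show ?thesis unfolding deg_def t(1) bd_single[OF t(2-4)] * using t by (auto simp: doubleton_eq_iff)
  qed
  then show ?thesis by (simp add: even_set_def)
qed

lemma finite_sides:
  assumes "finite S" "\<forall>t\<in>S. card t = 3" shows "finite (sides S)"
proof -
  have "sides S \<subseteq> (\<Union>t\<in>S. Pow t)" unfolding sides_def by auto
  moreover have "finite (\<Union>t\<in>S. Pow t)" using assms by (auto intro: card_ge_0_finite)
  ultimately show ?thesis by (rule finite_subset)
qed

lemma finite_bd:
  assumes "finite S" "\<forall>t\<in>S. card t = 3" shows "finite (bd S)"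
  using finite_sides[OF assms] bd_subset_sides finite_subset by blast

text \<open>The rule that a boundary has no boundary: it holds for one triangle and is
  additive.\<close>

lemma even_set_bd:
  assumes "finite S" "\<forall>t\<in>S. card t = 3" shows "even_set (bd S)"
  using assms
proof (induction S)
  case empty show ?case by (simp add: even_set_def deg_def)
next
  case (insert t S)
  have "insert t S = sym_diff S {t}" using insert by auto
  then have "bd (insert t S) = sym_diff (bd S) (bd {t})" using bd_sym_diff[of S "{t}"] insert by simp
  moreover have "finite (bd S)" "finite (bd {t})" using insert finite_bd[of S] finite_bd[of "{t}"] by auto
  ultimately show ?case using insert even_set_bd_single[of t] even_set_sym_diff[of "bd S" "bd {t}"] by simp
qed

lemma sum_deg:
  assumes "finite V" "finite Z" "\<And>e. e \<in> Z \<Longrightarrow> e \<subseteq> V"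
  shows "(\<Sum>v\<in>V. deg Z v) = (\<Sum>e\<in>Z. card e)"
proof -
  have "(\<Sum>v\<in>V. card {e\<in>Z. v \<in> e}) = (\<Sum>e\<in>Z. card {v\<in>V. v \<in> e})"
    by (rule sum_multicount_gen[symmetric]) (use assms in auto)
  also have "\<dots> = (\<Sum>e\<in>Z. card e)"
  proof (rule sum.cong)
    fix e assume "e \<in> Z"
    then have "{v\<in>V. v \<in> e} = e" using assms(3) by auto
    then show "card {v\<in>V. v \<in> e} = card e" by simp
  qed simp
  finally show ?thesis by (simp add: deg_def)
qed

lemma sum_deg_pairs:
  assumes "finite V" "finite Z" "\<And>e. e \<in> Z \<Longrightarrow> e \<subseteq> V" "\<And>e. e \<in> Z \<Longrightarrow> card e = k"
  shows "(\<Sum>v\<in>V. deg Z v) = k * card Z"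
  using sum_deg[OF assms(1-3)] assms(4) by simp

lemma even_card_odd_deg:
  assumes "finite V" "finite Z" "\<And>e. e \<in> Z \<Longrightarrow> e \<subseteq> V" "\<And>e. e \<in> Z \<Longrightarrow> card e = 2"
  shows "even (card {v\<in>V. odd (deg Z v)})"
proof -
  have "even (\<Sum>v\<in>V. deg Z v)" using sum_deg_pairs[OF assms] by simp
  then show ?thesis using even_sum_iff[OF assms(1), of "deg Z"] by simp
qed

lemma card_circuit:
  assumes "circuit C" shows "card (\<Union>C) = card C" "finite (\<Union>C)"
proof -
  show fin: "finite (\<Union>C)" using assms unfolding circuit_def by (metis card.infinite finite_Union zero_neq_numeral)
  have "(\<Sum>v\<in>\<Union>C. deg C v) = 2 * card C"
    by (rule sum_deg_pairs) (use assms fin in \<open>auto simp: circuit_def\<close>)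
  moreover have "(\<Sum>v\<in>\<Union>C. deg C v) = (\<Sum>v\<in>\<Union>C. 2)"
    by (rule sum.cong) (use assms in \<open>auto simp: circuit_def\<close>)
  ultimately show "card (\<Union>C) = card C" by simp
qed

section \<open>Triangulated discs\<close>

text \<open>A triangulated disc is encoded by its set of triangles, which are sets of three vertices. The
  assumptions \<open>bd_inj0\<close> and \<open>fill\<close> say that the homology modulo 2 vanishes in dimensions 2 and 1.\<close>

locale disc =
  fixes F :: "'a set set"
  assumes fin: "finite F"
    and card3: "t \<in> F \<Longrightarrow> card t = 3"
    and le2: "card e = 2 \<Longrightarrow> card {t\<in>F. e \<subseteq> t} \<le> 2"
    and bd_inj0: "S \<subseteq> F \<Longrightarrow> bd S = {} \<Longrightarrow> S = {}"
    and fill: "Z \<subseteq> sides F \<Longrightarrow> even_set Z \<Longrightarrow> \<exists>S\<subseteq>F. bd S = Z"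
    and circ: "circuit (bd F)"
begin

lemma fin_sub: "S \<subseteq> F \<Longrightarrow> finite S" using fin finite_subset by blast

lemma finite_tri: "t \<in> F \<Longrightarrow> finite t" using card3[of t] card.infinite by fastforce

lemma finV: "finite (\<Union>F)" using fin finite_tri by auto

lemma finE: "finite (sides F)" using finite_sides[OF fin] card3 by blast

lemma F_ne: "F \<noteq> {}" using circ by (auto simp: circuit_def)

lemma bd_inj:
  assumes "S \<subseteq> F" "S' \<subseteq> F" "bd S = bd S'" shows "S = S'"
proof -
  have "bd (sym_diff S S') = {}" using bd_sym_diff[of S S'] assms fin_sub by auto
  then have "sym_diff S S' = {}" using bd_inj0[of "sym_diff S S'"] assms by blast
  then show ?thesis by blast
qed

lemma bd_even: "S \<subseteq> F \<Longrightarrow> even_set (bd S)"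
  using even_set_bd[of S] fin_sub card3 by blast

lemma sidesD: "e \<in> sides F \<Longrightarrow> e \<subseteq> \<Union>F \<and> card e = 2" unfolding sides_def by blast

lemma ncof:
  assumes "e \<in> sides F" shows "card {t\<in>F. e \<subseteq> t} = (if e \<in> bd F then 1 else 2)"
proof -
  have "card e = 2" using assms by (simp add: sides_def)
  then have "card {t\<in>F. e \<subseteq> t} \<le> 2" using le2 by simp
  moreover have "card {t\<in>F. e \<subseteq> t} \<noteq> 0" using assms fin by (auto simp: sides_def)
  moreover have "card {t\<in>F. e \<subseteq> t} = 0 \<or> card {t\<in>F. e \<subseteq> t} = 1 \<or> card {t\<in>F. e \<subseteq> t} = 2"
    using calculation by linarith
  ultimately show ?thesis using \<open>card e = 2\<close> by (auto simp: bd_def)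
qed

text \<open>A set \<open>Z\<close> of edges is determined by its vertices of odd degree (one fixed vertex \<open>x\<close> may be
  dropped, since their number is even) together with a filling of the difference between \<open>Z\<close> and a
  standard set \<open>rep\<close> with the same odd vertices. Comparing cardinalities of power sets gives the bound.\<close>

lemma euler: "card (sides F) + 1 \<le> card (\<Union>F) + card F"
proof -
  obtain x where x: "x \<in> \<Union>F" using F_ne card3 by (metis Union_iff all_not_in_conv card.empty zero_neq_numeral)
  define od where "od Z = {v\<in>\<Union>F. odd (deg Z v)}" for Z :: "'a set set"
  define rep where "rep W = (SOME Z. Z \<subseteq> sides F \<and> od Z - {x} = W)" for W
  define fl where "fl Z = (SOME S. S \<subseteq> F \<and> bd S = sym_diff Z (rep (od Z - {x})))" for Z
  have rep: "rep (od Z - {x}) \<subseteq> sides F \<and> od (rep (od Z - {x})) - {x} = od Z - {x}" if "Z \<subseteq> sides F" for Z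
    unfolding rep_def by (rule someI[of _ Z]) (use that in simp)
  have od_even: "even (card (od Z))" if "Z \<subseteq> sides F" for Z
    unfolding od_def
  proof (rule even_card_odd_deg[OF finV finite_subset[OF that finE]])
    fix e assume "e \<in> Z"
    then have "e \<in> sides F" using that by (rule subsetD[rotated])
    then show "e \<subseteq> \<Union>F" "card e = 2" using sidesD by simp_all
  qed
  have od_det: "od Z = od Z'" if "Z \<subseteq> sides F" "Z' \<subseteq> sides F" "od Z - {x} = od Z' - {x}" for Z Z'
  proof -
    have f: "finite (od Z)" "finite (od Z')" unfolding od_def using finV by (simp_all del: Union_iff)
    have "card (od Z) = card (od Z - {x}) + (if x \<in> od Z then 1 else 0)"
      using f card.remove[of "od Z" x] by simp
    moreover have "card (od Z') = card (od Z' - {x}) + (if x \<in> od Z' then 1 else 0)"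
      using f card.remove[of "od Z'" x] by simp
    ultimately have "x \<in> od Z \<longleftrightarrow> x \<in> od Z'" using od_even[OF that(1)] od_even[OF that(2)] that(3) by (smt (verit) even_plus_one_iff add_0_right)
    then show ?thesis using that(3) by blast
  qed
  have fl: "fl Z \<subseteq> F \<and> bd (fl Z) = sym_diff Z (rep (od Z - {x}))" if Z: "Z \<subseteq> sides F" for Z
  proof -
    let ?R = "rep (od Z - {x})"
    have R: "?R \<subseteq> sides F" "od ?R = od Z" using rep[OF Z] od_det[of ?R Z] Z by auto
    have f: "finite Z" "finite ?R" using finite_subset[OF Z finE] finite_subset[OF R(1) finE] .
    have "even (deg (sym_diff Z ?R) v)" for v
    proof (cases "v \<in> \<Union>F")
      case True
      then have "odd (deg Z v) \<longleftrightarrow> odd (deg ?R v)" using R(2) unfolding od_def by blast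
      then show ?thesis using odd_deg_sym_diff[OF f] by blast
    next
      case False
      then have "{e\<in>sym_diff Z ?R. v \<in> e} = {}" using sidesD Z R(1) by blast
      then show ?thesis unfolding deg_def by (metis card.empty even_zero)
    qed
    then have "even_set (sym_diff Z ?R)" unfolding even_set_def by (rule allI)
    moreover have "sym_diff Z ?R \<subseteq> sides F" using Z R(1) by blast
    ultimately have "\<exists>S. S \<subseteq> F \<and> bd S = sym_diff Z ?R" using fill by blast
    then show ?thesis unfolding fl_def by (rule someI_ex)
  qed
  have "inj_on (\<lambda>Z. (od Z - {x}, fl Z)) (Pow (sides F))"
  proof (rule inj_onI)
    fix Z Z' assume Z: "Z \<in> Pow (sides F)" "Z' \<in> Pow (sides F)" and eq: "(od Z - {x}, fl Z) = (od Z' - {x}, fl Z')"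
    have o: "od Z' - {x} = od Z - {x}" and f: "fl Z' = fl Z" using eq by simp_all
    have "bd (fl Z) = sym_diff Z (rep (od Z - {x}))" using fl Z(1) by blast
    moreover have "bd (fl Z') = sym_diff Z' (rep (od Z' - {x}))" using fl Z(2) by blast
    ultimately have "sym_diff Z (rep (od Z - {x})) = sym_diff Z' (rep (od Z - {x}))" by (simp only: o f)
    then show "Z = Z'" by blast
  qed
  moreover have "(\<lambda>Z. (od Z - {x}, fl Z)) ` Pow (sides F) \<subseteq> Pow (\<Union>F - {x}) \<times> Pow F"
  proof (rule image_subsetI)
    fix Z assume "Z \<in> Pow (sides F)"
    then have "fl Z \<subseteq> F" using fl by blast
    moreover have "od Z \<subseteq> \<Union>F" unfolding od_def by blast
    ultimately show "(od Z - {x}, fl Z) \<in> Pow (\<Union>F - {x}) \<times> Pow F" by blast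
  qed
  ultimately have "card (Pow (sides F)) \<le> card (Pow (\<Union>F - {x}) \<times> Pow F)"
    by (rule card_inj_on_le) (simp add: fin finV del: Union_iff finite_Union)
  moreover have "card (Pow (\<Union>F - {x}) \<times> Pow F) = 2 ^ (card (\<Union>F) - 1 + card F)"
    using x finV fin by (simp only: card_cartesian_product card_Pow power_add finite_Diff card_Diff_singleton)
  ultimately have "(2::nat) ^ card (sides F) \<le> 2 ^ (card (\<Union>F) - 1 + card F)"
    using card_Pow[OF finE] by simp
  then have "card (sides F) \<le> card (\<Union>F) - 1 + card F" by simp
  moreover have "card (\<Union>F) > 0" using x finV card_gt_0_iff by blast
  ultimately show ?thesis by linarith
qed

text \<open>Incidences of triangles and edges counted both ways: three at each triangle, and by
  \<open>ncof\<close> one at each boundary edge and two at every other edge.\<close>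

lemma count_edges: "3 * card F + card (bd F) = 2 * card (sides F)"
proof -
  have "(\<Sum>e\<in>sides F. card {t\<in>F. e \<subseteq> t}) = (\<Sum>t\<in>F. card {e\<in>sides F. e \<subseteq> t})"
    by (rule sum_multicount_gen[symmetric]) (use fin finE in auto)
  also have "\<dots> = (\<Sum>t\<in>F. 3)"
  proof (rule sum.cong)
    fix t assume t: "t \<in> F"
    obtain a b c where abc: "t = {a,b,c}" "a \<noteq> b" "b \<noteq> c" "a \<noteq> c"
      using card3[OF t] by (auto simp: card_3_iff)
    have "{e\<in>sides F. e \<subseteq> t} = {e. card e = 2 \<and> e \<subseteq> t}"
      using t unfolding sides_def by auto
    then have "{e\<in>sides F. e \<subseteq> t} = {{a,b},{b,c},{a,c}}"
      unfolding abc(1) pairs_triangle[OF abc(2-4)] .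
    then show "card {e\<in>sides F. e \<subseteq> t} = 3" using abc by (simp add: doubleton_eq_iff)
  qed simp
  finally have "(\<Sum>e\<in>sides F. card {t\<in>F. e \<subseteq> t}) = 3 * card F" by simp
  moreover have "(\<Sum>e\<in>sides F. card {t\<in>F. e \<subseteq> t}) = (\<Sum>e\<in>sides F. if e \<in> bd F then 1 else 2)"
    using ncof by simp
  moreover have "\<dots> = card (bd F) + 2 * card (sides F - bd F)"
    using finE bd_subset_sides[of F]
    by (simp add: sum.If_cases Int_absorb1 Diff_eq)
  moreover have "card (sides F) = card (bd F) + card (sides F - bd F)"
    using finE bd_subset_sides[of F] by (simp add: card_Diff_subset card_mono finite_subset)
  ultimately show ?thesis by linarith
qed

lemma gauss_bonnet:
  assumes "\<And>v. v \<in> \<Union>F - \<Union>(bd F) \<Longrightarrow> 6 \<le> deg F v"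
  shows "6 \<le> (\<Sum>v\<in>\<Union>(bd F). 3 - int (deg F v))"
proof -
  let ?B = "\<Union>(bd F)"
  have BV: "?B \<subseteq> \<Union>F" using bd_subset_sides sidesD by blast
  have "(\<Sum>v\<in>\<Union>F. deg F v) = 3 * card F"
    by (rule sum_deg_pairs) (use finV fin card3 in auto)
  then have "int (\<Sum>v\<in>\<Union>F. deg F v) = int (3 * card F)" by (rule arg_cong)
  then have s: "(\<Sum>v\<in>\<Union>F. int (deg F v)) = 3 * int (card F)" by simp
  have "(\<Sum>v\<in>\<Union>F. int (deg F v)) = (\<Sum>v\<in>?B. int (deg F v)) + (\<Sum>v\<in>\<Union>F - ?B. int (deg F v))"
    using sum.subset_diff[OF BV finV, of "\<lambda>v. int (deg F v)"] by linarith
  moreover have "(\<Sum>v\<in>\<Union>F - ?B. int (deg F v)) \<ge> (\<Sum>v\<in>\<Union>F - ?B. 6)"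
  proof (rule sum_mono)
    fix v assume "v \<in> \<Union>F - ?B"
    then have "6 \<le> deg F v" by (rule assms)
    then show "6 \<le> int (deg F v)" by linarith
  qed
  moreover have "card (\<Union>F - ?B) + card ?B = card (\<Union>F)"
    using card_Diff_subset[OF finite_subset[OF BV finV] BV] card_mono[OF finV BV] by linarith
  moreover have "card ?B = card (bd F)" using card_circuit[OF circ] by simp
  moreover have "(\<Sum>v\<in>?B. 3 - int (deg F v)) = 3 * int (card ?B) - (\<Sum>v\<in>?B. int (deg F v))"
    by (simp add: sum_subtractf del: Union_iff)
  moreover have "(\<Sum>v\<in>\<Union>F - ?B. 6) = 6 * int (card (\<Union>F - ?B))" by (simp del: Union_iff)
  ultimately show ?thesis using s euler count_edges by linarith
qed

end

section \<open>Paths, cycles and subdiscs\<close>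

fun path_edges :: "'a list \<Rightarrow> 'a set set" where
  "path_edges (a # b # xs) = insert {a,b} (path_edges (b # xs))"
| "path_edges xs = {}"

definition cyc_edges :: "'a list \<Rightarrow> 'a set set" where
  "cyc_edges vs = (if vs = [] then {} else insert {last vs, hd vs} (path_edges vs))"

lemma path_edges_append:
  "xs \<noteq> [] \<Longrightarrow> ys \<noteq> [] \<Longrightarrow> path_edges (xs @ ys) = insert {last xs, hd ys} (path_edges xs \<union> path_edges ys)"
proof (induction xs rule: path_edges.induct)
  case (1 a b xs) then show ?case by auto
next
  case "2_1" then show ?case by simp
next
  case ("2_2" v) then show ?case by (cases ys) auto
qed

lemma path_edges_sub: "e \<in> path_edges xs \<Longrightarrow> e \<subseteq> set xs"
  by (induction xs rule: path_edges.induct) auto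

lemma path_edges_card: "distinct xs \<Longrightarrow> e \<in> path_edges xs \<Longrightarrow> card e = 2"
  by (induction xs rule: path_edges.induct) auto

lemma finite_pe: "finite (path_edges xs)"
  by (induction xs rule: path_edges.induct) auto

lemma path_edges_rev: "path_edges (rev xs) = path_edges xs"
proof (induction xs rule: path_edges.induct)
  case (1 a b xs)
  have "path_edges (rev (a # b # xs)) = insert {last (rev (b # xs)), a} (path_edges (rev (b # xs)))"
    using path_edges_append[of "rev (b # xs)" "[a]"] by simp
  then show ?case using 1 by (auto simp: insert_commute)
qed auto

lemma path_edges_split: "e \<in> path_edges vs \<Longrightarrow> \<exists>xs ys. vs = xs @ ys \<and> xs \<noteq> [] \<and> ys \<noteq> [] \<and> e = {last xs, hd ys}"
proof (induction vs rule: path_edges.induct)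
  case (1 a b xs)
  show ?case
  proof (cases "e = {a,b}")
    case True
    then show ?thesis by (intro exI[of _ "[a]"] exI[of _ "b # xs"]) auto
  next
    case False
    then obtain us ys where "b # xs = us @ ys" "us \<noteq> []" "ys \<noteq> []" "e = {last us, hd ys}" using 1 by auto
    then show ?thesis by (intro exI[of _ "a # us"] exI[of _ ys]) auto
  qed
qed auto

lemma path_edges_nth: "path_edges vs = {{vs ! i, vs ! Suc i} |i. Suc i < length vs}"
proof (induction vs rule: path_edges.induct)
  case (1 a b xs)
  have "{i. Suc i < length (a # b # xs)} = insert 0 (Suc ` {i. Suc i < length (b # xs)})"
    by (auto simp: image_iff gr0_conv_Suc less_Suc_eq_0_disj)
  then show ?case using 1 by (simp add: setcompr_eq_image image_image)
qed auto

lemma cyc_edges_append_commute: "cyc_edges (xs @ ys) = cyc_edges (ys @ xs)"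
proof (cases "xs = [] \<or> ys = []")
  case False
  then show ?thesis by (auto simp: cyc_edges_def path_edges_append insert_commute)
qed auto

lemma cyc_edges_rotate: "cyc_edges (rotate n vs) = cyc_edges vs"
  by (metis append_take_drop_id cyc_edges_append_commute rotate_drop_take)

lemma cyc_edges_rev: "cyc_edges (rev vs) = cyc_edges vs"
  by (auto simp: cyc_edges_def path_edges_rev hd_rev last_rev insert_commute)

lemma cyc_edges_sub: "e \<in> cyc_edges vs \<Longrightarrow> e \<subseteq> set vs"
  using path_edges_sub by (fastforce simp: cyc_edges_def split: if_splits)

lemma finite_cyc: "finite (cyc_edges vs)" by (simp add: cyc_edges_def finite_pe)

lemma cyc_edges_nth:
  assumes "vs \<noteq> []" shows "cyc_edges vs = {{vs ! i, vs ! (Suc i mod length vs)} |i. i < length vs}"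
proof -
  let ?n = "length vs" and ?f = "\<lambda>i. {vs ! i, vs ! (Suc i mod length vs)}"
  have "{i. i < ?n} = insert (?n - 1) {i. Suc i < ?n}" using assms by (cases vs) auto
  then have "?f ` {i. i < ?n} = insert (?f (?n - 1)) (?f ` {i. Suc i < ?n})" by (simp only: image_insert)
  moreover have "?f (?n - 1) = {last vs, hd vs}" using assms by (simp add: last_conv_nth hd_conv_nth)
  moreover have "?f ` {i. Suc i < ?n} = path_edges vs" unfolding path_edges_nth setcompr_eq_image by (rule image_cong) auto
  ultimately show ?thesis using assms by (simp add: cyc_edges_def setcompr_eq_image)
qed

lemma cyc_edges_map: "cyc_edges (map f vs) = image f ` cyc_edges vs"
proof (cases "vs = []")
  case False
  have "path_edges (map f vs) = image f ` path_edges vs" by (induction vs rule: path_edges.induct) auto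
  then show ?thesis using False by (simp add: cyc_edges_def hd_map last_map)
qed (simp add: cyc_edges_def)

lemma cyc_edges_Cons: "xs \<noteq> [] \<Longrightarrow> cyc_edges (a # xs) = insert {a, hd xs} (insert {last xs, a} (path_edges xs))"
  using path_edges_append[of "[a]" xs] by (auto simp: cyc_edges_def)

lemma cyc_edges_rotate_to:
  assumes "v \<in> set vs" shows "\<exists>n xs. rotate n vs = v # xs"
proof -
  obtain us ys where "vs = us @ v # ys" using assms split_list by metis
  then have "rotate (length us) vs = v # (ys @ us)" by (simp add: rotate_append)
  then show ?thesis by blast
qed

lemma cyc_edges_at:
  assumes "distinct vs" "3 \<le> length vs" "v \<in> set vs"
  shows "\<exists>a b. a \<noteq> b \<and> a \<noteq> v \<and> b \<noteq> v \<and> a \<in> set vs \<and> b \<in> set vs \<and> {e\<in>cyc_edges vs. v \<in> e} = {{a,v},{v,b}}"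
proof -
  obtain n xs where r: "rotate n vs = v # xs" using cyc_edges_rotate_to[OF assms(3)] by blast
  have d: "distinct (v # xs)" "length xs \<ge> 2" and s: "set (v # xs) = set vs"
    using assms(1,2) r by (metis distinct_rotate, metis Suc_le_mono length_Cons length_rotate numeral_2_eq_2 numeral_3_eq_3, metis set_rotate)
  have ne: "xs \<noteq> []" using d(2) by auto
  have hl: "hd xs \<noteq> last xs" using d by (cases xs) auto
  have "cyc_edges vs = insert {v, hd xs} (insert {last xs, v} (path_edges xs))"
    using cyc_edges_Cons[OF ne, of v] r cyc_edges_rotate[of n vs] by simp
  moreover have "\<And>e. e \<in> path_edges xs \<Longrightarrow> v \<notin> e" using path_edges_sub d(1) by fastforce
  ultimately have "{e\<in>cyc_edges vs. v \<in> e} = {{last xs,v},{v,hd xs}}" by auto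
  moreover have "last xs \<in> set xs" "hd xs \<in> set xs" using ne by simp_all
  moreover have "last xs \<noteq> v" "hd xs \<noteq> v" "last xs \<in> set vs" "hd xs \<in> set vs"
    using calculation d(1) s by auto
  ultimately show ?thesis using hl by metis
qed

text \<open>Rotates the cycle until the chosen edge is the closing one. The other edges then form a
  path, to which arguments by peeling off an end apply.\<close>

lemma cyc_edges_opening:
  assumes "e \<in> cyc_edges vs" "distinct vs"
  obtains ws where "distinct ws" "length ws = length vs" "set ws = set vs" "cyc_edges ws = cyc_edges vs"
    "e = {last ws, hd ws}" "ws \<noteq> []"
proof (cases "e = {last vs, hd vs}")
  case True
  then show ?thesis using that[of vs] assms by (auto simp: cyc_edges_def split: if_splits)
next
  case False
  then have "e \<in> path_edges vs" using assms(1) by (auto simp: cyc_edges_def split: if_splits)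
  then obtain as bs where "vs = as @ bs" "as \<noteq> []" "bs \<noteq> []" "e = {last as, hd bs}" using path_edges_split by blast
  then show ?thesis using that[of "bs @ as"] cyc_edges_append_commute[of as bs] assms by auto
qed

lemma cyc_edges_closing:
  assumes "{a,b} \<in> cyc_edges vs" "distinct vs" "a \<noteq> b"
  obtains ws where "distinct ws" "length ws = length vs" "cyc_edges ws = cyc_edges vs" "last ws = a" "hd ws = b" "ws \<noteq> []"
proof -
  obtain us where us: "distinct us" "length us = length vs" "cyc_edges us = cyc_edges vs" "{a,b} = {last us, hd us}" "us \<noteq> []"
    using cyc_edges_opening[OF assms(1,2)] by metis
  show ?thesis
  proof (cases "last us = a")
    case True
    then have "hd us = b" using us(4) assms(3) by (auto simp: doubleton_eq_iff)
    then show ?thesis using that[of us] us True by simp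
  next
    case False
    then have "last us = b" "hd us = a" using us(4) by (auto simp: doubleton_eq_iff)
    then show ?thesis using that[of "rev us"] us by (simp add: cyc_edges_rev hd_rev last_rev)
  qed
qed

text \<open>The first vertex of a path meets only one of its edges, so an even set cannot contain
  that edge; then the path is shortened.\<close>

lemma path_edges_even_empty: "distinct xs \<Longrightarrow> Z \<subseteq> path_edges xs \<Longrightarrow> even_set Z \<Longrightarrow> Z = {}"
proof (induction xs rule: path_edges.induct)
  case (1 a b xs)
  have "\<And>e. e \<in> path_edges (b # xs) \<Longrightarrow> a \<notin> e" using path_edges_sub 1(2) by fastforce
  then have "{e\<in>Z. a \<in> e} = (if {a,b} \<in> Z then {{a,b}} else {})" using 1(3) by auto
  moreover have "even (card {e\<in>Z. a \<in> e})" using 1(4) by (simp add: even_set_def deg_def)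
  ultimately have "{a,b} \<notin> Z" by (auto split: if_splits)
  then have "Z \<subseteq> path_edges (b # xs)" using 1(3) by auto
  then show ?case using 1 by simp
qed auto

lemma circuit_cyc:
  assumes "distinct vs" "3 \<le> length vs"
  shows "circuit (cyc_edges vs)" "\<Union>(cyc_edges vs) = set vs"
proof -
  have ne: "vs \<noteq> []" using assms(2) by auto
  have hl: "hd vs \<noteq> last vs" using assms by (cases vs) auto
  show U: "\<Union>(cyc_edges vs) = set vs"
  proof
    show "\<Union>(cyc_edges vs) \<subseteq> set vs" using cyc_edges_sub by fast
    show "set vs \<subseteq> \<Union>(cyc_edges vs)"
    proof
      fix v assume "v \<in> set vs"
      from cyc_edges_at[OF assms this] show "v \<in> \<Union>(cyc_edges vs)" by blast
    qed
  qed
  have c2: "card e = 2" if "e \<in> cyc_edges vs" for e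
    using that hl ne path_edges_card[OF assms(1)] by (auto simp: cyc_edges_def card_2_iff)
  have d2: "deg (cyc_edges vs) v = 2" if "v \<in> set vs" for v
    using cyc_edges_at[OF assms that] by (auto simp: deg_def card_2_iff doubleton_eq_iff)
  have "Z = {} \<or> Z = cyc_edges vs" if Z: "Z \<subseteq> cyc_edges vs" "even_set Z" for Z
  proof (rule disjCI)
    assume "Z \<noteq> cyc_edges vs"
    \<comment> \<open>Opening the cycle at an edge missing from \<open>Z\<close> places
      \<open>Z\<close> inside a path.\<close>
    then obtain e where e: "e \<in> cyc_edges vs" "e \<notin> Z" using Z by blast
    obtain ws where ws: "distinct ws" "cyc_edges ws = cyc_edges vs" "e = {last ws, hd ws}" "ws \<noteq> []"
      using cyc_edges_opening[OF e(1) assms(1)] by metis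
    then have "cyc_edges ws = insert e (path_edges ws)" by (simp only: cyc_edges_def if_False)
    then have "Z \<subseteq> insert e (path_edges ws)" using Z(1) ws(2) by simp
    then have "Z \<subseteq> path_edges ws" using e(2) by auto
    then show "Z = {}" using path_edges_even_empty ws(1) Z(2) by blast
  qed
  then have m: "\<forall>Z\<subseteq>cyc_edges vs. even_set Z \<longrightarrow> Z = {} \<or> Z = cyc_edges vs" by (intro allI impI)
  have n: "cyc_edges vs \<noteq> {}" using ne by (simp add: cyc_edges_def)
  show "circuit (cyc_edges vs)"
    unfolding circuit_def U by (intro conjI m n finite_cyc ballI c2 d2)
qed

lemma circuit_even:
  assumes "circuit C" shows "even_set C"
  unfolding even_set_def
proof
  fix v show "even (deg C v)"
  proof (cases "v \<in> \<Union>C")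
    case True
    then have "deg C v = 2" using assms unfolding circuit_def by blast
    then show ?thesis by simp
  next
    case False
    then have "{e\<in>C. v \<in> e} = {}" by blast
    then show ?thesis unfolding deg_def by (simp only: card.empty) simp
  qed
qed

text \<open>Adding the triangle \<open>{a,b,c}\<close> modulo 2 replaces the detour over
  \<open>b\<close> by the edge \<open>{a,c}\<close>. A fourth vertex is required, for otherwise
  \<open>{a,c}\<close> would already be an edge of the cycle.\<close>

lemma cyc_edges_shortcut:
  assumes "distinct (a # b # c # ys)" "ys \<noteq> []"
  shows "cyc_edges (a # c # ys) = sym_diff (cyc_edges (a # b # c # ys)) {{a,b},{b,c},{a,c}}"
proof -
  let ?K = "insert {last ys, a} (path_edges (c # ys))"
  have 1: "cyc_edges (a # b # c # ys) = insert {a,b} (insert {b,c} ?K)" "cyc_edges (a # c # ys) = insert {a,c} ?K"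
    using assms(2) by (auto simp: cyc_edges_def)
  have l: "last ys \<in> set ys" using assms(2) by simp
  have "e \<notin> ?K" if "b \<in> e" for e
  proof
    assume "e \<in> ?K"
    then have "e = {last ys, a} \<or> e \<subseteq> set (c # ys)" using path_edges_sub by blast
    then show False using that l assms(1) by auto
  qed
  moreover have "{a,c} \<notin> ?K"
  proof
    assume "{a,c} \<in> ?K"
    then have "{a,c} = {last ys, a} \<or> {a,c} \<subseteq> set (c # ys)" using path_edges_sub by blast
    then show False using l assms(1) by (auto simp: doubleton_eq_iff)
  qed
  moreover have "{a,b} \<noteq> {b,c}" "{a,b} \<noteq> {a,c}" "{b,c} \<noteq> {a,c}" using assms by (auto simp: doubleton_eq_iff)
  moreover have "insert z K = sym_diff (insert x (insert y K)) {x,y,z}"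
    if "x \<notin> K" "y \<notin> K" "z \<notin> K" "x \<noteq> y" "x \<noteq> z" "y \<noteq> z" for x y z :: "'a set" and K
    using that by auto
  ultimately show ?thesis unfolding 1 by simp
qed

lemma cyc_edges_shortcut':
  assumes "distinct (xs @ a # b # c # ys)" "xs @ ys \<noteq> []"
  shows "cyc_edges (xs @ a # c # ys) = sym_diff (cyc_edges (xs @ a # b # c # ys)) (bd {{a,b,c}})"
proof -
  have "cyc_edges (xs @ a # c # ys) = cyc_edges (a # c # (ys @ xs))" "cyc_edges (xs @ a # b # c # ys) = cyc_edges (a # b # c # (ys @ xs))"
    using cyc_edges_append_commute[of xs "a # c # ys"] cyc_edges_append_commute[of xs "a # b # c # ys"] by auto
  moreover have "cyc_edges (a # c # (ys @ xs)) = sym_diff (cyc_edges (a # b # c # (ys @ xs))) {{a,b},{b,c},{a,c}}"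
    by (rule cyc_edges_shortcut) (use assms in auto)
  moreover have "bd {{a,b,c}} = {{a,b},{b,c},{a,c}}" using assms by (intro bd_single) auto
  ultimately show ?thesis by simp
qed

text \<open>The edges of a walk are taken modulo 2: repeated edges cancel, and only the two ends
  keep odd degree. If \<open>u = w\<close>, the inequality between the two equations says that no
  vertex is odd.\<close>

lemma rtrancl_parity:
  assumes "(u, w) \<in> {(x, y). {x,y} \<in> E \<and> x \<noteq> v \<and> y \<noteq> v}\<^sup>*" "\<And>e. e \<in> E \<Longrightarrow> card e = 2"
  shows "\<exists>P\<subseteq>E. finite P \<and> (\<forall>e\<in>P. v \<notin> e) \<and> (\<forall>x. odd (deg P x) \<longleftrightarrow> (x = u) \<noteq> (x = w))"
  using assms(1)
proof (induction rule: rtrancl_induct)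
  case base show ?case by (rule exI[of _ "{}"]) (simp add: deg_def)
next
  case (step y z)
  obtain P where P: "P \<subseteq> E" "finite P" "\<forall>e\<in>P. v \<notin> e" "\<forall>x. odd (deg P x) \<longleftrightarrow> (x = u) \<noteq> (x = y)"
    using step(3) by blast
  have yz: "{y,z} \<in> E" "y \<noteq> v" "z \<noteq> v" using step(2) by auto
  have "y \<noteq> z" using assms(2)[OF yz(1)] by auto
  have "deg {{y,z}} x = (if x = y \<or> x = z then 1 else 0)" for x
  proof -
    have "{e\<in>{{y,z}}. x \<in> e} = (if x = y \<or> x = z then {{y,z}} else {})" by auto
    then show ?thesis by (simp add: deg_def)
  qed
  then have "odd (deg (sym_diff P {{y,z}}) x) \<longleftrightarrow> (x = u) \<noteq> (x = z)" for x
    using odd_deg_sym_diff[OF P(2), of "{{y,z}}" x] P(4) \<open>y \<noteq> z\<close> by auto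
  moreover have "sym_diff P {{y,z}} \<subseteq> E" "finite (sym_diff P {{y,z}})" "\<forall>e\<in>sym_diff P {{y,z}}. v \<notin> e"
    using P yz by auto
  ultimately show ?case by (intro exI[of _ "sym_diff P {{y,z}}"]) blast
qed

section \<open>Connectedness, vertex links and subdiscs\<close>

context disc begin

lemma sidesI: "t \<in> F \<Longrightarrow> a \<in> t \<Longrightarrow> b \<in> t \<Longrightarrow> a \<noteq> b \<Longrightarrow> {a,b} \<in> sides F"
  by (auto simp: sides_def)

lemma boundary_vertices:
  assumes "bd F = cyc_edges vs" "distinct vs" "3 \<le> length vs" shows "set vs \<subseteq> \<Union>F"
proof -
  have "set vs = \<Union>(bd F)" unfolding assms(1) using circuit_cyc(2)[OF assms(2,3)] ..
  then show ?thesis using bd_subset_sides[of F] sidesD by blast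
qed

text \<open>Connectedness of the disc, also after deletion of \<open>v\<close>. Every edge of a
  triangle that meets \<open>A\<close> has an end in \<open>A\<close>, so all triangles on this edge
  meet \<open>A\<close>. The boundary of the set of these triangles is therefore an even part of the
  circuit \<open>bd F\<close>, and \<open>bd_inj\<close> leaves only \<open>F\<close>
  itself.\<close>

lemma closed_all:
  assumes A: "A \<noteq> {}" "A \<subseteq> \<Union>F" and cl: "\<And>t. t \<in> F \<Longrightarrow> t \<inter> A \<noteq> {} \<Longrightarrow> t \<subseteq> insert v A"
  shows "\<Union>F \<subseteq> insert v A"
proof -
  define FA where "FA = {t\<in>F. t \<inter> A \<noteq> {}}"
  have sub: "FA \<subseteq> F" by (auto simp: FA_def)
  have "bd FA \<subseteq> bd F"
  proof
    fix e assume e: "e \<in> bd FA"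
    then have c: "card e = 2" and o: "odd (card {t\<in>FA. e \<subseteq> t})" by (auto simp: bd_def)
    obtain t0 where t0: "t0 \<in> FA" "e \<subseteq> t0" using e bd_subset_sides[of FA] unfolding sides_def by blast
    then have "e \<subseteq> insert v A" using cl[of t0] by (auto simp: FA_def)
    then have "e \<inter> A \<noteq> {}" using c by (auto simp: card_2_iff)
    then have "{t\<in>F. e \<subseteq> t} = {t\<in>FA. e \<subseteq> t}" by (auto simp: FA_def)
    then show "e \<in> bd F" using c o by (simp add: bd_def)
  qed
  then have "bd FA = {} \<or> bd FA = bd F" using circ bd_even[OF sub] by (auto simp: circuit_def)
  moreover have "FA \<noteq> {}" using A by (auto simp: FA_def)
  ultimately have "FA = F" using bd_inj0[OF sub] bd_inj[OF sub subset_refl] by blast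
  then show ?thesis using cl unfolding FA_def by blast
qed

text \<open>If the link of \<open>v\<close> split into two parts, a path avoiding \<open>v\<close> from one part to the other would close
  up through \<open>v\<close> to a cycle whose filling meets one part of the link in a graph with exactly one
  vertex of odd degree.\<close>

lemma link_connected:
  assumes X: "X \<subseteq> {t\<in>F. v \<in> t}" "X \<noteq> {}" "X \<noteq> {t\<in>F. v \<in> t}"
  shows "\<exists>e t t'. card e = 2 \<and> v \<in> e \<and> t \<in> X \<and> t' \<in> F - X \<and> e \<subseteq> t \<and> e \<subseteq> t'"
proof (rule ccontr)
  assume no: "\<not> ?thesis"
  obtain t1 t2 where t1: "t1 \<in> X" "v \<in> t1" "t1 \<in> F" and t2: "t2 \<in> F" "v \<in> t2" "t2 \<notin> X" using X by blast
  obtain u1 where u1: "u1 \<in> t1" "u1 \<noteq> v" using card3[OF t1(3)] t1(2) by (auto simp: card_3_iff)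
  obtain u2 where u2: "u2 \<in> t2" "u2 \<noteq> v" using card3[OF t2(1)] t2(2) by (auto simp: card_3_iff)
  define R where "R = {(x, y). {x,y} \<in> sides F \<and> x \<noteq> v \<and> y \<noteq> v}"
  define A where "A = {w. (u1, w) \<in> R\<^sup>*}"
  have R1: "(w, y) \<in> R" if "t \<in> F" "w \<in> t" "y \<in> t" "w \<noteq> y" "w \<noteq> v" "y \<noteq> v" for t w y
    using that sidesI[of t w y] by (simp add: R_def)
  have vA: "x \<noteq> v \<and> x \<in> \<Union>F" if "x \<in> A" for x
  proof -
    have "(u1, x) \<in> R\<^sup>*" using that by (simp add: A_def)
    then show ?thesis
    proof (induction rule: rtrancl_induct)
      case base then show ?case using u1 t1 by auto
    next
      case (step y z) then show ?case using sidesD unfolding R_def by blast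
    qed
  qed
  have "\<Union>F \<subseteq> insert v A"
  proof (rule closed_all)
    show "A \<noteq> {}" by (auto simp: A_def)
    show "A \<subseteq> \<Union>F" using vA by blast
    fix t assume t: "t \<in> F" "t \<inter> A \<noteq> {}"
    then obtain w where w: "w \<in> t" "w \<in> A" by blast
    show "t \<subseteq> insert v A"
    proof
      fix y assume y: "y \<in> t"
      show "y \<in> insert v A"
      proof (cases "y = v \<or> y = w")
        case False
        then have "(w, y) \<in> R" using R1[OF t(1) w(1) y] vA[OF w(2)] by auto
        then show ?thesis using w(2) unfolding A_def by (auto intro: rtrancl_into_rtrancl)
      qed (use w in auto)
    qed
  qed
  then have "u2 \<in> A" using u2 t2 by blast
  then have "(u1, u2) \<in> {(x, y). {x,y} \<in> sides F \<and> x \<noteq> v \<and> y \<noteq> v}\<^sup>*" by (simp add: A_def R_def)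
  from rtrancl_parity[OF this] sidesD obtain P where P: "P \<subseteq> sides F" "finite P" "\<forall>e\<in>P. v \<notin> e"
    "\<forall>x. odd (deg P x) \<longleftrightarrow> (x = u1) \<noteq> (x = u2)" by metis
  let ?e1 = "{v,u1}" and ?e2 = "{v,u2}"
  have ne: "u1 \<noteq> u2"
  proof
    assume "u1 = u2"
    then have "card ?e1 = 2 \<and> v \<in> ?e1 \<and> t1 \<in> X \<and> t2 \<in> F - X \<and> ?e1 \<subseteq> t1 \<and> ?e1 \<subseteq> t2"
      using u1 u2 t1 t2 by auto
    then show False using no by blast
  qed
  have E: "?e1 \<in> sides F" "?e2 \<in> sides F" using sidesI t1 t2 u1 u2 by auto
  define Z where "Z = sym_diff P {?e1, ?e2}"
  have dd: "odd (deg {?e1, ?e2} x) \<longleftrightarrow> (x = u1) \<noteq> (x = u2)" for x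
  proof -
    have "{e\<in>{?e1,?e2}. x \<in> e} = (if x = v then {?e1,?e2} else if x = u1 then {?e1} else if x = u2 then {?e2} else {})"
      using ne u1 u2 by auto
    then show ?thesis using ne u1 u2 by (auto simp: deg_def doubleton_eq_iff)
  qed
  have "even_set Z" unfolding even_set_def
  proof
    fix x show "even (deg Z x)"
      using odd_deg_sym_diff[OF P(2), of "{?e1,?e2}" x] dd[of x] P(4) unfolding Z_def by blast
  qed
  moreover have "Z \<subseteq> sides F" using P(1) E unfolding Z_def by blast
  ultimately obtain S where S: "S \<subseteq> F" "bd S = Z" using fill by blast
  have Zv: "{e\<in>Z. v \<in> e} = {?e1,?e2}" using P(3) by (auto simp: Z_def)
  \<comment> \<open>The members of \<open>N\<close> are the vertices of the part \<open>X\<close> of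
    the link, and the triangles of \<open>S\<close> in \<open>X\<close> are edges between them.
    Hence a triangle in \<open>X\<close> contains two members of \<open>N\<close>, any other
    triangle none, and the double count below is even.\<close>
  define N where "N = {e\<in>sides F. v \<in> e \<and> (\<exists>t\<in>X. e \<subseteq> t)}"
  have finN: "finite N" using finE by (simp add: N_def)
  have finS: "finite S" using fin_sub[OF S(1)] .
  have "(\<Sum>e\<in>N. card {t\<in>S. e \<subseteq> t}) = (\<Sum>t\<in>S. card {e\<in>N. e \<subseteq> t})"
    by (rule sum_multicount_gen[symmetric]) (use finN finS in auto)
  moreover have "even (\<Sum>t\<in>S. card {e\<in>N. e \<subseteq> t})"
  proof (rule dvd_sum)
    fix t assume t: "t \<in> S"
    show "even (card {e\<in>N. e \<subseteq> t})"
    proof (cases "t \<in> X")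
      case True
      then have "v \<in> t" "t \<in> F" using X(1) by auto
      then obtain a b where ab: "t = {v,a,b}" "v \<noteq> a" "v \<noteq> b" "a \<noteq> b" using card3[of t] by (auto simp: card_3_iff)
      have "{e\<in>N. e \<subseteq> t} = {{v,a},{v,b}}"
      proof (intro equalityI subsetI)
        fix e assume "e \<in> {e\<in>N. e \<subseteq> t}"
        then have "card e = 2" "v \<in> e" "e \<subseteq> {v,a,b}" using sidesD ab(1) unfolding N_def by blast+
        then show "e \<in> {{v,a},{v,b}}" using card2D[of e v] by auto
      next
        fix e assume "e \<in> {{v,a},{v,b}}"
        moreover have "{v,a} \<in> sides F" "{v,b} \<in> sides F" using sidesI[OF \<open>t \<in> F\<close>] ab by auto
        moreover have "{v,a} \<subseteq> t" "{v,b} \<subseteq> t" using ab(1) by auto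
        ultimately have "e \<in> sides F" "v \<in> e" "e \<subseteq> t" by auto
        then show "e \<in> {e\<in>N. e \<subseteq> t}" using True unfolding N_def by blast
      qed
      then show ?thesis using ab by (auto simp: doubleton_eq_iff)
    next
      case False
      then have "{e\<in>N. e \<subseteq> t} = {}" using no t S(1) sidesD unfolding N_def by blast
      then show ?thesis by (simp only: card.empty) simp
    qed
  qed
  ultimately have "even (card {e\<in>N. odd (card {t\<in>S. e \<subseteq> t})})"
    using even_sum_iff[OF finN, of "\<lambda>e. card {t\<in>S. e \<subseteq> t}"] by simp
  moreover have "{e\<in>N. odd (card {t\<in>S. e \<subseteq> t})} = {?e1}"
  proof (rule set_eqI)
    fix e
    have "e \<in> N \<and> odd (card {t\<in>S. e \<subseteq> t}) \<longleftrightarrow> e \<in> N \<and> e \<in> Z"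
      using S(2) sidesD unfolding N_def bd_def by blast
    moreover have "e \<in> N \<and> e \<in> Z \<longleftrightarrow> e = ?e1"
    proof
      assume e: "e \<in> N \<and> e \<in> Z"
      then have "v \<in> e" by (simp add: N_def)
      then have "e = ?e1 \<or> e = ?e2" using Zv e by blast
      moreover have "e \<noteq> ?e2"
      proof
        assume "e = ?e2"
        then have "card ?e2 = 2 \<and> v \<in> ?e2 \<and> (\<exists>t\<in>X. ?e2 \<subseteq> t) \<and> t2 \<in> F - X \<and> ?e2 \<subseteq> t2"
          using e sidesD u2 t2 unfolding N_def by blast
        then show False using no by blast
      qed
      ultimately show "e = ?e1" by blast
    next
      assume "e = ?e1" then show "e \<in> N \<and> e \<in> Z" using Zv E u1 t1 by (auto simp: N_def)
    qed
    ultimately show "e \<in> {e\<in>N. odd (card {t\<in>S. e \<subseteq> t})} \<longleftrightarrow> e \<in> {?e1}" by simp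
  qed
  ultimately show False by simp
qed

text \<open>A filling \<open>R\<close> of a cycle in \<open>S\<close> stays in \<open>S\<close>: the boundary of \<open>R - S\<close> is an even subset of the
  circuit \<open>bd S\<close>, hence trivial or all of it, and the latter is excluded by injectivity of \<open>bd\<close>.\<close>

lemma subdisc:
  assumes S: "S \<subseteq> F" "circuit (bd S)" shows "disc S"
proof
  show "finite S" using fin_sub S by blast
  show "card t = 3" if "t \<in> S" for t using that S card3 by blast
  show "card {t\<in>S. e \<subseteq> t} \<le> 2" if "card e = 2" for e
  proof -
    have "card {t\<in>S. e \<subseteq> t} \<le> card {t\<in>F. e \<subseteq> t}" using fin S by (intro card_mono) auto
    then show ?thesis using le2[OF that] by linarith
  qed
  show "R = {}" if "R \<subseteq> S" "bd R = {}" for R using that S bd_inj0 by blast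
  show "circuit (bd S)" by fact
  show "\<exists>R\<subseteq>S. bd R = Z" if Z: "Z \<subseteq> sides S" "even_set Z" for Z
  proof -
    obtain R where R: "R \<subseteq> F" "bd R = Z" using fill[of Z] Z sides_mono[OF S(1)] by blast
    have "bd (R - S) \<subseteq> bd S"
    proof
      fix e assume e: "e \<in> bd (R - S)"
      then have c: "card e = 2" and o: "odd (card {t\<in>R-S. e \<subseteq> t})" by (auto simp: bd_def)
      obtain t0 where t0: "t0 \<in> R - S" "e \<subseteq> t0" using e bd_subset_sides[of "R - S"] unfolding sides_def by blast
      \<comment> \<open>Either \<open>e\<close> is in \<open>Z\<close> and thus a side of
        \<open>S\<close>, or the triangles of \<open>R\<close> on \<open>e\<close> are even in
        number and one of them must lie in \<open>S\<close>. Since \<open>t0\<close> outside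
        \<open>S\<close> also contains \<open>e\<close>, \<open>le2\<close> then leaves exactly one
        triangle of \<open>S\<close> on \<open>e\<close>.\<close>
      have "{t\<in>S. e \<subseteq> t} \<noteq> {}"
      proof (cases "e \<in> bd R")
        case True then show ?thesis using R(2) Z(1) by (auto simp: sides_def)
      next
        case False
        then have "even (card {t\<in>R. e \<subseteq> t})" using c by (auto simp: bd_def)
        moreover have "{t\<in>R. e \<subseteq> t} = {t\<in>R-S. e \<subseteq> t} \<union> {t\<in>R\<inter>S. e \<subseteq> t}" by blast
        ultimately have "{t\<in>R. e \<subseteq> t} \<noteq> {t\<in>R-S. e \<subseteq> t}" using o by metis
        then show ?thesis by blast
      qed
      moreover have fS: "finite {t\<in>S. e \<subseteq> t}" using fin_sub[OF S(1)] by simp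
      moreover have "card (insert t0 {t\<in>S. e \<subseteq> t}) \<le> 2"
      proof -
        have "card (insert t0 {t\<in>S. e \<subseteq> t}) \<le> card {t\<in>F. e \<subseteq> t}"
          using fin t0 S R(1) by (intro card_mono) auto
        then show ?thesis using le2[OF c] by linarith
      qed
      ultimately have "card {t\<in>S. e \<subseteq> t} = 1" using t0 by (simp add: Suc_le_eq card_gt_0_iff le_antisym)
      then show "e \<in> bd S" using c by (simp add: bd_def)
    qed
    moreover have "even_set (bd (R - S))" using bd_even[of "R - S"] R(1) by blast
    ultimately have "bd (R - S) = {} \<or> bd (R - S) = bd S" using S(2) by (auto simp: circuit_def)
    moreover have "bd (R - S) \<noteq> bd S"
    proof
      assume "bd (R - S) = bd S"
      then have "R - S = S" using bd_inj[of "R - S" S] R(1) S(1) by blast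
      then have "S = {}" by blast
      then show False using S(2) by (simp add: circuit_def)
    qed
    ultimately have "R - S = {}" using bd_inj0[of "R - S"] R(1) by blast
    then show ?thesis using R(2) by blast
  qed
qed

text \<open>If \<open>S\<close> contained only part of the star of \<open>v\<close>, then by
  \<open>link_connected\<close> some edge at \<open>v\<close> would separate a triangle of
  \<open>S\<close> from one outside. Such an edge is in \<open>bd S\<close> but has two triangles in
  \<open>F\<close>.\<close>

lemma star_subset:
  assumes S: "S \<subseteq> F" "t0 \<in> S" "v \<in> t0" and b: "\<And>e. e \<in> bd S \<Longrightarrow> v \<in> e \<Longrightarrow> e \<in> bd F"
  shows "{t\<in>F. v \<in> t} \<subseteq> S"
proof (rule ccontr)
  assume "\<not> ?thesis"
  then obtain e t t' where e: "card e = 2" "v \<in> e" "t \<in> {t\<in>S. v \<in> t}" "t' \<in> F - {t\<in>S. v \<in> t}" "e \<subseteq> t" "e \<subseteq> t'"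
    using link_connected[of "{t\<in>S. v \<in> t}" v] S by blast
  have t': "t' \<notin> S" "t' \<in> F" using e by auto
  have "card {t\<in>F. e \<subseteq> t} \<le> 2" using le2 e(1) by blast
  moreover have "{t,t'} \<subseteq> {t\<in>F. e \<subseteq> t}" "t \<noteq> t'" using e S t' by auto
  ultimately have eq: "{t\<in>F. e \<subseteq> t} = {t,t'}"
    using card_seteq[of "{t\<in>F. e \<subseteq> t}" "{t,t'}"] fin by simp
  then have "card {t\<in>F. e \<subseteq> t} = 2" using \<open>t \<noteq> t'\<close> by simp
  then have "e \<notin> bd F" by (simp add: bd_def)
  moreover have "{u\<in>S. e \<subseteq> u} = {t}" using eq e t' S by auto
  then have "e \<in> bd S" using e(1) by (simp add: bd_def)
  ultimately show False using b e(2) by blast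
qed

text \<open>A vertex that is inner in a subdisc keeps its whole star there and is inner in
  \<open>F\<close>. This is how degree bounds pass to subdiscs.\<close>

lemma star_subset':
  assumes S: "S \<subseteq> F" "t0 \<in> S" "v \<in> t0" "v \<notin> \<Union>(bd S)"
  shows "{t\<in>F. v \<in> t} \<subseteq> S" "v \<notin> \<Union>(bd F)"
proof -
  show st: "{t\<in>F. v \<in> t} \<subseteq> S" using star_subset[OF S(1-3)] S(4) by blast
  show "v \<notin> \<Union>(bd F)"
  proof
    assume "v \<in> \<Union>(bd F)"
    then obtain e where e: "e \<in> bd F" "v \<in> e" by blast
    then have "{t\<in>F. e \<subseteq> t} = {t\<in>S. e \<subseteq> t}" using st S(1) by blast
    then have "e \<in> bd S" using e by (simp add: bd_def)
    then show False using S(4) e by blast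
  qed
qed

lemma sub_gauss_bonnet:
  assumes deg6: "\<And>v. v \<in> \<Union>F - \<Union>(bd F) \<Longrightarrow> 6 \<le> deg F v" and S: "S \<subseteq> F" "circuit (bd S)"
  shows "6 \<le> (\<Sum>v\<in>\<Union>(bd S). 3 - int (deg S v))"
proof -
  interpret S: disc S by (rule subdisc[OF S])
  show ?thesis
  proof (rule S.gauss_bonnet)
    fix v assume v: "v \<in> \<Union>S - \<Union>(bd S)"
    then obtain t0 where t0: "t0 \<in> S" "v \<in> t0" by blast
    note st = star_subset'[OF S(1) t0]
    have "{t\<in>F. v \<in> t} = {t\<in>S. v \<in> t}" using st(1) v S(1) by blast
    then have "deg S v = deg F v" by (simp add: deg_def)
    moreover have "v \<in> \<Union>F - \<Union>(bd F)" using st(2) v S(1) t0 by blast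
    ultimately show "6 \<le> deg S v" using deg6 by simp
  qed
qed

end

section \<open>Distances and geodesics\<close>

text \<open>If no walk exists the value is unspecified; by \<open>tdist_relpow\<close> this does not
  happen between vertices of a disc.\<close>

definition tdist :: "'a set set \<Rightarrow> 'a \<Rightarrow> 'a \<Rightarrow> nat" where
  "tdist F u v = (LEAST n. (u, v) \<in> {(x, y). {x,y} \<in> sides F} ^^ n)"

lemma tdist_le_relpow: "(u, v) \<in> {(x, y). {x,y} \<in> sides F} ^^ n \<Longrightarrow> tdist F u v \<le> n"
  unfolding tdist_def by (rule Least_le)

lemma tdist_self [simp]: "tdist F u u = 0" using tdist_le_relpow[of u u 0 F] by simp

lemma tdist_le_1: "{u,v} \<in> sides F \<Longrightarrow> tdist F u v \<le> 1"
  using tdist_le_relpow[of u v 1 F] by auto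

context disc begin

text \<open>The set reachable from \<open>u\<close> contains every triangle that it meets, so
  \<open>closed_all\<close> applies with \<open>v\<close> as the possible exception; a triangle at
  \<open>v\<close> has another, reachable vertex and removes the exception.\<close>

lemma tdist_relpow:
  assumes "u \<in> \<Union>F" "v \<in> \<Union>F" shows "(u, v) \<in> {(x, y). {x,y} \<in> sides F} ^^ tdist F u v"
proof -
  define R where "R = {(x, y). {x,y} \<in> sides F}"
  define A where "A = {w. (u, w) \<in> R\<^sup>*}"
  have "A \<subseteq> \<Union>F"
  proof
    fix x assume "x \<in> A"
    then have "(u, x) \<in> R\<^sup>*" by (simp add: A_def)
    then show "x \<in> \<Union>F"
    proof (cases rule: rtranclE)
      case base then show ?thesis using assms(1) by simp
    next
      case (step y) then show ?thesis using sidesD unfolding R_def by blast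
    qed
  qed
  moreover have cl: "t \<subseteq> A" if tF: "t \<in> F" "t \<inter> A \<noteq> {}" for t
  proof
    fix y assume y: "y \<in> t"
    obtain w where w: "w \<in> t" "w \<in> A" using tF by blast
    show "y \<in> A"
    proof (cases "y = w")
      case False
      then have "(w, y) \<in> R" using sidesI[OF tF(1) w(1) y] by (simp add: R_def)
      then show ?thesis using w(2) unfolding A_def by (auto intro: rtrancl_into_rtrancl)
    qed (use w in simp)
  qed
  moreover have uA: "u \<in> A" by (simp add: A_def)
  ultimately have sub: "\<Union>F \<subseteq> insert v A" using closed_all[of A v] by blast
  have "v \<in> A"
  proof -
    obtain t where t: "t \<in> F" "v \<in> t" using assms(2) by blast
    then obtain w where "w \<in> t" "w \<noteq> v" using card3[OF t(1)] by (auto simp: card_3_iff)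
    then have "t \<inter> A \<noteq> {}" using sub t(1) by blast
    then show ?thesis using cl t by blast
  qed
  then obtain n where "(u, v) \<in> R ^^ n" by (auto simp: A_def rtrancl_power)
  then show ?thesis unfolding tdist_def R_def by (rule LeastI)
qed

lemma tdist_triangle:
  assumes "u \<in> \<Union>F" "v \<in> \<Union>F" "w \<in> \<Union>F" shows "tdist F u w \<le> tdist F u v + tdist F v w"
  using tdist_relpow[OF assms(1,2)] tdist_relpow[OF assms(2,3)]
  by (intro tdist_le_relpow) (auto simp: relpow_add)

lemma sides_vert: "{u,w} \<in> sides F \<Longrightarrow> u \<in> \<Union>F" "{u,w} \<in> sides F \<Longrightarrow> w \<in> \<Union>F"
  "{u,w} \<in> sides F \<Longrightarrow> u \<noteq> w"
  using sidesD[of "{u,w}"] by auto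

lemma tdist_step:
  assumes "{u,w} \<in> sides F" "x \<in> \<Union>F" shows "tdist F u x \<le> Suc (tdist F w x)"
  using tdist_triangle[of u w x] sides_vert[OF assms(1)] assms(2) tdist_le_1[OF assms(1)] by linarith

lemma tdist_sym_le:
  assumes "u \<in> \<Union>F" "v \<in> \<Union>F" shows "tdist F v u \<le> tdist F u v"
proof -
  let ?R = "{(x, y). {x,y} \<in> sides F}"
  have "?R\<inverse> = ?R" by (auto simp: insert_commute)
  then have "(?R ^^ n)\<inverse> = ?R ^^ n" for n
    by (induction n) (auto simp: converse_relcomp relpow_commute)
  then show ?thesis using tdist_relpow[OF assms] by (intro tdist_le_relpow) blast
qed

lemma tdist_sym: "u \<in> \<Union>F \<Longrightarrow> v \<in> \<Union>F \<Longrightarrow> tdist F v u = tdist F u v"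
  using tdist_sym_le by (metis le_antisym)

lemma tdist_0: "u \<in> \<Union>F \<Longrightarrow> v \<in> \<Union>F \<Longrightarrow> tdist F u v = 0 \<Longrightarrow> u = v"
  using tdist_relpow[of u v] by auto

lemma tdist_1:
  assumes "u \<in> \<Union>F" "v \<in> \<Union>F" shows "tdist F u v = 1 \<longleftrightarrow> {u,v} \<in> sides F"
proof
  show "{u,v} \<in> sides F" if "tdist F u v = 1" using tdist_relpow[OF assms] that by simp
  show "tdist F u v = 1" if "{u,v} \<in> sides F"
    using tdist_le_1[OF that] tdist_0[OF assms] sides_vert(3)[OF that] by linarith
qed

lemma tdist_sides: "{u,v} \<in> sides F \<Longrightarrow> tdist F u v = 1"
  using tdist_1 sides_vert by metis

lemma tdist_descend:
  assumes "u \<in> \<Union>F" "x \<in> \<Union>F" "tdist F u x = Suc r"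
  shows "\<exists>w. {u,w} \<in> sides F \<and> tdist F w x = r"
proof -
  have "(u, x) \<in> {(x, y). {x,y} \<in> sides F} ^^ Suc r" using tdist_relpow[OF assms(1,2)] assms(3) by simp
  then obtain w where w: "{u,w} \<in> sides F" "(w, x) \<in> {(x, y). {x,y} \<in> sides F} ^^ r"
    by (elim relpow_Suc_E2) auto
  then have "tdist F w x = r" using tdist_le_relpow[OF w(2)] tdist_step[OF w(1) assms(2)] assms(3) by linarith
  then show ?thesis using w(1) by blast
qed

lemma geodesic:
  assumes "u \<in> \<Union>F" "x \<in> \<Union>F" "tdist F u x = r"
  shows "\<exists>p. p 0 = u \<and> p r = x \<and> (\<forall>i<r. {p i, p (Suc i)} \<in> sides F) \<and> (\<forall>i\<le>r. tdist F (p i) x = r - i)"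
  using assms
proof (induction r arbitrary: u)
  case 0
  then have "u = x" using tdist_0 by blast
  then show ?case by (intro exI[of _ "\<lambda>_. u"]) simp
next
  case (Suc r)
  obtain w where w: "{u,w} \<in> sides F" "tdist F w x = r" using tdist_descend[OF Suc.prems] by blast
  obtain p where p: "p 0 = w" "p r = x" "\<forall>i<r. {p i, p (Suc i)} \<in> sides F" "\<forall>i\<le>r. tdist F (p i) x = r - i"
    using Suc.IH[OF sides_vert(2)[OF w(1)] Suc.prems(2) w(2)] by blast
  show ?case
  proof (intro exI[of _ "case_nat u p"] conjI allI impI)
    show "{case_nat u p i, case_nat u p (Suc i)} \<in> sides F" if "i < Suc r" for i
      using that p(1,3) w(1) by (cases i) auto
    show "tdist F (case_nat u p i) x = Suc r - i" if "i \<le> Suc r" for i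
      using that p(4) Suc.prems(3) by (cases i) auto
  qed (use p in auto)
qed

lemma tdist_walk:
  assumes "\<And>i. i < m \<Longrightarrow> {w i, w (Suc i)} \<in> sides F" "w 0 \<in> \<Union>F"
  shows "tdist F (w 0) (w m) \<le> m"
proof -
  have "(w 0, w m) \<in> {(x, y). {x,y} \<in> sides F} ^^ m"
    using assms(1) by (induction m) auto
  then show ?thesis by (rule tdist_le_relpow)
qed

text \<open>Pushing a geodesic \<open>a, b, c\<close> on the boundary of \<open>S\<close> across the two triangles of \<open>S\<close> at \<open>b\<close>.\<close>

lemma flip:
  assumes x: "x \<in> \<Union>F" and S: "S \<subseteq> F" "bd S = insert {a,b} (insert {b,c} R)" "b \<notin> \<Union>R"
    and lev: "tdist F a x = Suc (Suc l)" "tdist F b x = Suc l" "tdist F c x = l" and d: "deg S b \<le> 2"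
  obtains z S' where "S' \<subset> S" "z \<noteq> b" "tdist F z x = Suc l" "{a,z} \<in> sides F" "{z,c} \<in> sides F"
    "z \<notin> \<Union>R \<longrightarrow> bd S' = insert {a,z} (insert {z,c} R)"
proof -
  have ne: "a \<noteq> b" "b \<noteq> c" "a \<noteq> c" using lev by auto
  have "{a,b} \<in> sides S" "{b,c} \<in> sides S" using S(2) bd_subset_sides[of S] by auto
  then obtain t1 t2 where t1: "t1 \<in> S" "{a,b} \<subseteq> t1" and t2: "t2 \<in> S" "{b,c} \<subseteq> t2"
    unfolding sides_def by blast
  have tF: "t1 \<in> F" "t2 \<in> F" using t1 t2 S(1) by auto
  have finS: "finite S" using fin_sub S(1) by blast
  \<comment> \<open>A common triangle would make \<open>a\<close> and \<open>c\<close> adjacent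
    although their levels differ by two.\<close>
  have t12: "t1 \<noteq> t2"
  proof
    assume "t1 = t2"
    then have "{a,c} \<in> sides F" using sidesI[OF tF(1)] t1 t2 ne by auto
    then show False using tdist_step[OF _ x] lev by fastforce
  qed
  have "{t1,t2} \<subseteq> {t\<in>S. b \<in> t}" using t1 t2 by auto
  then have star: "{t\<in>S. b \<in> t} = {t1,t2}"
    using card_seteq[of "{t\<in>S. b \<in> t}" "{t1,t2}"] d finS t12 by (simp add: deg_def)
  obtain z where z: "z \<noteq> a" "z \<noteq> b" "t1 = {a,b,z}" using card3D[OF card3[OF tF(1)] t1(2) ne(1)] by blast
  have zc: "z \<noteq> c"
  proof
    assume "z = c"
    then have "{a,c} \<in> sides F" using sidesI[OF tF(1)] z ne by auto
    then show False using tdist_step[OF _ x] lev by fastforce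
  qed
  \<comment> \<open>Since \<open>{b,z}\<close> is not on the boundary of \<open>S\<close>, a second
    triangle of \<open>S\<close> at \<open>b\<close> contains it, and this can only be
    \<open>t2\<close>.\<close>
  have "{b,z} \<notin> bd S"
  proof
    assume "{b,z} \<in> bd S"
    then consider "{b,z} = {a,b}" | "{b,z} = {b,c}" | "{b,z} \<in> R" unfolding S(2) by blast
    then show False
    proof cases
      case 3 then show False using S(3) by blast
    qed (use z zc ne in \<open>auto simp: doubleton_eq_iff\<close>)
  qed
  then have ev: "even (card {t\<in>S. {b,z} \<subseteq> t})" using z by (auto simp: bd_def)
  have "z \<in> t2"
  proof (rule ccontr)
    assume "z \<notin> t2"
    then have "{t\<in>S. {b,z} \<subseteq> t} = {t1}" using star z by blast
    then show False using ev by simp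
  qed
  then have t2z: "t2 = {b,c,z}" using card3D[OF card3[OF tF(2)] t2(2) ne(2)] z zc by auto
  have az: "{a,z} \<in> sides F" "{z,c} \<in> sides F" using sidesI[OF tF(1)] sidesI[OF tF(2)] z t2z zc by auto
  have lz: "tdist F z x = Suc l" using tdist_step[OF az(1) x] tdist_step[OF az(2) x] lev by linarith
  \<comment> \<open>If \<open>z\<close> were on the rest of the boundary, the new edges could cancel
    against old ones. The use of this lemma in \<open>bigon\<close> excludes this by the choice of
    the bigon.\<close>
  have "bd (S - {t1,t2}) = insert {a,z} (insert {z,c} R)" if "z \<notin> \<Union>R"
  proof -
    have "S - {t1,t2} = sym_diff S (sym_diff {t1} {t2})" using t1 t2 t12 by auto
    then have "bd (S - {t1,t2}) = sym_diff (bd S) (sym_diff (bd {t1}) (bd {t2}))"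
      using bd_sym_diff[of S "sym_diff {t1} {t2}"] bd_sym_diff[of "{t1}" "{t2}"] finS by simp
    moreover have "bd {t1} = {{a,b},{b,z},{a,z}}" unfolding z(3) by (rule bd_single) (use z ne in auto)
    moreover have "bd {t2} = {{b,c},{c,z},{b,z}}" unfolding t2z by (rule bd_single) (use z zc ne in auto)
    moreover have "sym_diff {p,m,r} {q,u,m} = {p,r,q,u}"
      if "p \<noteq> m" "r \<noteq> m" "q \<noteq> m" "u \<noteq> m" "p \<noteq> q" "p \<noteq> u" "r \<noteq> q" "r \<noteq> u" for p q r u m :: "'a set"
      using that by auto
    then have "sym_diff {{a,b},{b,z},{a,z}} {{b,c},{z,c},{b,z}} = {{a,b},{a,z},{b,c},{z,c}}"
      using z zc ne by (simp add: doubleton_eq_iff)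
    then have "sym_diff {{a,b},{b,z},{a,z}} {{b,c},{c,z},{b,z}} = {{a,b},{a,z},{b,c},{z,c}}"
      by (simp only: insert_commute[of c z])
    moreover have "sym_diff (insert p (insert q R)) {p,r,q,u} = insert r (insert u R)"
      if "p \<notin> R" "q \<notin> R" "r \<notin> R" "u \<notin> R" "p \<noteq> r" "p \<noteq> u" "q \<noteq> r" "q \<noteq> u" for p q r u :: "'a set"
      using that by auto
    moreover have "{a,b} \<notin> R" "{b,c} \<notin> R" "{a,z} \<notin> R" "{z,c} \<notin> R" using S(3) that by auto
    moreover have "{a,b} \<noteq> {a,z}" "{a,b} \<noteq> {z,c}" "{b,c} \<noteq> {a,z}" "{b,c} \<noteq> {z,c}"
      using z zc ne by (auto simp: doubleton_eq_iff)
    ultimately show ?thesis using S(2) by simp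
  qed
  moreover have "S - {t1,t2} \<subset> S" using t1 by blast
  ultimately show ?thesis using that[of "S - {t1,t2}" z] z(2) lz az by blast
qed

end

section \<open>Bigons between geodesics and the curvature at their ends\<close>

lemma cyc_edges_last: "vs \<noteq> [] \<Longrightarrow> cyc_edges vs = path_edges (last vs # vs)"
  by (cases vs) (auto simp: cyc_edges_def)

lemma path_edges_map_upt: "path_edges (map p [0..<Suc s]) = {{p i, p (Suc i)} |i. i < s}"
  unfolding path_edges_nth by (auto simp del: upt_Suc) (metis Suc_less_eq add_0 diff_zero length_upt less_Suc_eq nth_map_upt)+

text \<open>The loop runs through \<open>ks\<close> to \<open>p 0\<close>, along \<open>p\<close> to
  the far tip and back along \<open>q\<close>. The index ranges differ by one because the tip
  \<open>p s = q s\<close> may be listed only once.\<close>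

lemma cyc_edges_bigon:
  assumes "0 < s" "p s = q s"
  shows "cyc_edges (ks @ map p [0..<Suc s] @ rev (map q [0..<s])) =
    path_edges (q 0 # ks @ [p 0]) \<union> ({{p i, p (Suc i)} |i. i < s} \<union> {{q i, q (Suc i)} |i. i < s})"
proof -
  let ?P = "map p [0..<Suc s]" and ?Q = "rev (map q [0..<s])"
  have ne: "?P \<noteq> []" "?Q \<noteq> []" using assms(1) by auto
  have lh: "last ?Q = q 0" "hd ?P = p 0" "last ?P = p s" "hd ?Q = q (s - 1)"
    using assms(1) by (auto simp: last_rev hd_rev hd_map last_map simp del: upt_Suc)
  have "cyc_edges (ks @ ?P @ ?Q) = path_edges ((q 0 # ks) @ (?P @ ?Q))"
    using cyc_edges_last[of "ks @ ?P @ ?Q"] lh ne by simp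
  also have "\<dots> = insert {last (q 0 # ks), p 0} (path_edges (q 0 # ks) \<union> path_edges (?P @ ?Q))"
    using path_edges_append[of "q 0 # ks" "?P @ ?Q"] lh ne by (simp del: upt_Suc)
  also have "path_edges (?P @ ?Q) = insert {p s, q (s - 1)} (path_edges ?P \<union> path_edges (map q [0..<s]))"
    using path_edges_append[OF ne] lh path_edges_rev[of "map q [0..<s]"] by (simp del: upt_Suc)
  also have "insert {p s, q (s - 1)} (path_edges ?P \<union> path_edges (map q [0..<s])) = path_edges ?P \<union> path_edges (map q [0..<Suc s])"
    using path_edges_append[of "map q [0..<s]" "[q s]"] assms by (auto simp: last_map insert_commute)
  finally show ?thesis
    using path_edges_append[of "q 0 # ks" "[p 0]"] by (simp add: path_edges_map_upt del: upt_Suc path_edges.simps) auto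
qed

locale disc6 = disc +
  assumes deg6: "v \<in> \<Union>F - \<Union>(bd F) \<Longrightarrow> 6 \<le> deg F v"
begin

text \<open>Two geodesics towards \<open>x\<close> are followed until they first meet. Choose them such that the meeting
  point comes as early as possible and then such that the enclosed subdisc \<open>S\<close> is smallest. Every
  inner vertex of the geodesics then lies in at least three triangles of \<open>S\<close>, for otherwise \<open>flip\<close>
  would shrink \<open>S\<close>. By Gauss-Bonnet the curvature sits at the near end of the bigon.\<close>

lemma bigon:
  assumes x: "x \<in> \<Union>F" and pq: "p0 \<noteq> q0" "p0 \<in> \<Union>F" "q0 \<in> \<Union>F" "tdist F p0 x = r" "tdist F q0 x = r"
    and ks: "distinct ks" "\<And>v. v \<in> set ks \<Longrightarrow> r < tdist F v x" "path_edges (q0 # ks @ [p0]) \<subseteq> sides F"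
  obtains S p1 q1 where "0 < r" "S \<subseteq> F" "tdist F p1 x = r - 1" "tdist F q1 x = r - 1"
    "{{p0,p1},{q0,q1}} \<union> path_edges (q0 # ks @ [p0]) \<subseteq> bd S"
    "4 \<le> (\<Sum>v\<in>set ks \<union> {p0,q0}. 3 - int (deg S v))"
proof -
  \<comment> \<open>The near end of the bigon. It will be a single edge in
    \<open>triangle_condition\<close> and a path of two edges in
    \<open>interval_condition\<close>.\<close>
  define K where "K = path_edges (q0 # ks @ [p0])"
  define W where "W s p = {{p i, p (Suc i)} |i. i < s}" for s and p :: "nat \<Rightarrow> 'a"
  define Val where "Val s p q \<longleftrightarrow> p 0 = p0 \<and> q 0 = q0 \<and> p s = q s \<and> s \<le> r \<and>
     (\<forall>i<s. {p i, p (Suc i)} \<in> sides F) \<and> (\<forall>i<s. {q i, q (Suc i)} \<in> sides F) \<and>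
     (\<forall>i\<le>s. tdist F (p i) x = r - i) \<and> (\<forall>i\<le>s. tdist F (q i) x = r - i)" for s p q
  obtain p q where "p 0 = p0" "p r = x" "\<forall>i<r. {p i, p (Suc i)} \<in> sides F" "\<forall>i\<le>r. tdist F (p i) x = r - i"
     "q 0 = q0" "q r = x" "\<forall>i<r. {q i, q (Suc i)} \<in> sides F" "\<forall>i\<le>r. tdist F (q i) x = r - i"
    using geodesic[OF pq(2) x pq(4)] geodesic[OF pq(3) x pq(5)] by blast
  then have ex: "\<exists>p q. Val r p q" unfolding Val_def by (intro exI[of _ p] exI[of _ q]) auto
  define s where "s = (LEAST s. \<exists>p q. Val s p q)"
  have exs: "\<exists>p q. Val s p q" unfolding s_def by (rule LeastI[of _ r]) (rule ex)
  have mins: "s \<le> i" if "Val i p q" for i p q unfolding s_def by (rule Least_le) (use that in blast)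
  \<comment> \<open>An earlier meeting at \<open>i\<close> would allow both geodesics to be
    truncated there, against the choice of \<open>s\<close>.\<close>
  have Vne: "p i \<noteq> q i" if "Val s p q" "i < s" for p q i
  proof
    assume "p i = q i"
    then have "Val i p q" using that unfolding Val_def by auto
    then show False using mins that(2) by fastforce
  qed
  have s0: "0 < s" using exs pq(1) unfolding Val_def by (cases "s = 0") auto
  have VS: "\<exists>S. S \<subseteq> F \<and> bd S = K \<union> (W s p \<union> W s q) \<and> circuit (bd S) \<and>
      \<Union>(bd S) = set ks \<union> p ` {0..s} \<union> q ` {0..<s}" if V: "Val s p q" for p q
  proof -
    let ?L = "ks @ map p [0..<Suc s] @ rev (map q [0..<s])"
    have c: "cyc_edges ?L = K \<union> (W s p \<union> W s q)"
      unfolding K_def W_def using cyc_edges_bigon[OF s0, of p q ks] V unfolding Val_def by simp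
    have inj: "inj_on p {0..s}" "inj_on q {0..<s}"
      using V unfolding Val_def inj_on_def by (auto) (metis diff_diff_cancel le_trans, metis diff_diff_cancel le_trans less_imp_le_nat)
    \<comment> \<open>Distances to \<open>x\<close> separate different indices, and the previous
      fact separates equal ones. So the loop is simple and has a filling.\<close>
    have pqd: "p i \<noteq> q j" if "i \<le> s" "j < s" for i j
    proof (cases "i = j")
      case True then show ?thesis using Vne[OF V] that by simp
    next
      case False
      then have "r - i \<noteq> r - j" using that V unfolding Val_def by linarith
      then show ?thesis using that V unfolding Val_def by (metis less_imp_le_nat)
    qed
    have lev: "tdist F v x \<le> r" if "v \<in> p ` {0..s} \<union> q ` {0..<s}" for v
      using that V unfolding Val_def by auto
    have s1: "set (map p [0..<Suc s]) = p ` {0..s}" "set (rev (map q [0..<s])) = q ` {0..<s}"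
      by (auto simp del: upt_Suc)
    have "distinct (map p [0..<Suc s])" "distinct (rev (map q [0..<s]))"
      using inj by (auto simp: distinct_map atLeastLessThanSuc_atLeastAtMost simp del: upt_Suc)
    moreover have "p ` {0..s} \<inter> q ` {0..<s} = {}" using pqd by fastforce
    moreover have "set ks \<inter> (p ` {0..s} \<union> q ` {0..<s}) = {}" using lev ks(2) by fastforce
    ultimately have d: "distinct ?L" using ks(1) s1 by (simp only: distinct_append set_append)
    have l: "3 \<le> length ?L" using s0 by simp
    have sE: "cyc_edges ?L \<subseteq> sides F" unfolding c K_def W_def using V ks(3) unfolding Val_def by blast
    note cc = circuit_cyc[OF d l]
    obtain S where "S \<subseteq> F" "bd S = cyc_edges ?L" using fill[OF sE circuit_even[OF cc(1)]] by (elim exE conjE)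
    moreover have "set ?L = set ks \<union> p ` {0..s} \<union> q ` {0..<s}" using s1 by (simp only: set_append Un_assoc)
    ultimately show ?thesis using cc c by metis
  qed
  define Q where "Q pqS \<longleftrightarrow> (case pqS of (p, q, S) \<Rightarrow> Val s p q \<and> S \<subseteq> F \<and> bd S = K \<union> (W s p \<union> W s q))" for pqS
  obtain p' q' where V': "Val s p' q'" using exs by blast
  obtain S' where "S' \<subseteq> F" "bd S' = K \<union> (W s p' \<union> W s q')" using VS[OF V'] by metis
  then have "Q (p', q', S')" using V' unfolding Q_def by simp
  then have "\<exists>pqS. Q pqS" by blast
  then obtain pqS where Qm: "Q pqS" "\<And>y. Q y \<Longrightarrow> card (snd (snd pqS)) \<le> card (snd (snd y))"
    using ex_has_least_nat[of Q _ "\<lambda>y. card (snd (snd y))"] by blast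
  obtain p q S where pqS: "pqS = (p, q, S)" by (cases pqS) auto
  have V: "Val s p q" and S: "S \<subseteq> F" "bd S = K \<union> (W s p \<union> W s q)" using Qm(1) pqS by (auto simp: Q_def)
  have smin: "card S \<le> card S'" if "Val s p' q'" "S' \<subseteq> F" "bd S' = K \<union> (W s p' \<union> W s q')" for p' q' S'
    using Qm(2)[of "(p',q',S')"] that pqS by (simp add: Q_def)
  have finS: "finite S" using fin_sub S(1) by blast
  have KV: "v \<in> set ks \<union> {p0,q0}" if "e \<in> K" "v \<in> e" for e v
    using that path_edges_sub[of e "q0 # ks @ [p0]"] unfolding K_def by auto
  \<comment> \<open>The two sides play symmetric roles: \<open>f\<close> is the side under
    consideration and \<open>g\<close> the other one.\<close>
  have interior: "3 \<le> deg S (f i)"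
    if V': "(f = p \<and> g = q) \<or> (f = q \<and> g = p)" and i: "0 < i" "i < s" for f g i
  proof (rule ccontr)
    assume "\<not> 3 \<le> deg S (f i)"
    then have d2: "deg S (f i) \<le> 2" by simp
    have sr: "s \<le> r" using V by (simp add: Val_def)
    have f: "f s = g s" "\<forall>j\<le>s. tdist F (f j) x = r - j" "\<forall>j\<le>s. tdist F (g j) x = r - j" "\<forall>j<s. {f j, f (Suc j)} \<in> sides F"
      using V' V unfolding Val_def by auto
    have bS: "bd S = K \<union> (W s f \<union> W s g)" using S(2) V' by auto
    define R where "R = K \<union> ({{f j, f (Suc j)} |j. j < s \<and> j \<noteq> i - 1 \<and> j \<noteq> i} \<union> W s g)"
    have Wf: "W s h = insert {h (i-1), h i} (insert {h i, h (Suc i)} {{h j, h (Suc j)} |j. j < s \<and> j \<noteq> i - 1 \<and> j \<noteq> i})" for h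
    proof -
      have e: "{h (i-1), h i} = {h (i-1), h (Suc (i-1))}" using i by simp
      have "{j. j < s} = insert (i-1) (insert i {j. j < s \<and> j \<noteq> i - 1 \<and> j \<noteq> i})" using i by auto
      then have "(\<lambda>j. {h j, h (Suc j)}) ` {j. j < s} = insert {h (i-1), h (Suc (i-1))}
          (insert {h i, h (Suc i)} ((\<lambda>j. {h j, h (Suc j)}) ` {j. j < s \<and> j \<noteq> i - 1 \<and> j \<noteq> i}))"
        by (simp only: image_insert)
      then show ?thesis unfolding W_def e by (simp only: setcompr_eq_image)
    qed
    have bR: "bd S = insert {f (i-1), f i} (insert {f i, f (Suc i)} R)"
      unfolding bS R_def Wf[of f] by blast
    have Rlev: "v \<in> set ks \<union> {p0,q0} \<or> (\<exists>j\<le>s. j \<noteq> i \<and> v = f j) \<or> (\<exists>j\<le>s. v = g j)" if "v \<in> \<Union>R" for v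
    proof -
      from that obtain e where e: "v \<in> e" "e \<in> R" by blast
      then consider "e \<in> K" | j where "e = {f j, f (Suc j)}" "j < s" "j \<noteq> i - 1" "j \<noteq> i" | j where "e = {g j, g (Suc j)}" "j < s"
        unfolding R_def W_def by blast
      then show ?thesis
      proof cases
        case 1 then show ?thesis using KV e(1) by blast
      next
        case 2
        then have "v = f j \<and> j \<le> s \<and> j \<noteq> i \<or> v = f (Suc j) \<and> Suc j \<le> s \<and> Suc j \<noteq> i" using e(1) by auto
        then show ?thesis by blast
      next
        case 3
        then have "v = g j \<and> j \<le> s \<or> v = g (Suc j) \<and> Suc j \<le> s" using e(1) by auto
        then show ?thesis by blast
      qed
    qed
    \<comment> \<open>On the loop, only \<open>f i\<close> and \<open>g i\<close> have distance
      \<open>r - i\<close> to \<open>x\<close>, because the near end has distance at least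
      \<open>r\<close> and \<open>i\<close> is positive.\<close>
    have notR: "v \<notin> \<Union>R" if v: "tdist F v x = r - i" "v \<noteq> g i" for v
    proof
      assume "v \<in> \<Union>R"
      from Rlev[OF this] show False
      proof (elim disjE exE conjE)
        assume "v \<in> set ks \<union> {p0,q0}"
        then have "r \<le> tdist F v x" using ks(2)[of v] pq(4,5) by auto
        then show False using v(1) i sr by linarith
      next
        fix j assume "j \<le> s" "j \<noteq> i" "v = f j"
        then show False using f(2) v(1) i sr by (metis diff_diff_cancel le_trans less_imp_le_nat)
      next
        fix j assume "j \<le> s" "v = g j"
        then show False using f(3) v i sr by (metis diff_diff_cancel le_trans less_imp_le_nat)
      qed
    qed
    have fgne: "f i \<noteq> g i" using Vne[OF V i(2)] V' by auto
    have fb: "f i \<notin> \<Union>R" using notR f(2) fgne i by simp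
    obtain l where l: "r - i = Suc l" using i sr by (metis Suc_diff_Suc order_less_le_trans)
    have lv: "tdist F (f (i-1)) x = Suc (Suc l)" "tdist F (f i) x = Suc l" "tdist F (f (Suc i)) x = l"
      using f(2) i l sr by auto
    obtain z S' where z: "S' \<subset> S" "z \<noteq> f i" "tdist F z x = Suc l" "{f (i-1),z} \<in> sides F" "{z,f (Suc i)} \<in> sides F"
      "z \<notin> \<Union>R \<longrightarrow> bd S' = insert {f (i-1),z} (insert {z,f (Suc i)} R)"
      by (rule flip[OF x S(1) bR fb lv d2]) blast
    define f' where "f' = f(i := z)"
    have f'e: "{f' j, f' (Suc j)} \<in> sides F" if "j < s" for j
      using that z(4,5) f(4) i unfolding f'_def by (cases "j = i"; cases "Suc j = i") auto
    have f'l: "tdist F (f' j) x = r - j" if "j \<le> s" for j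
      using that z(3) f(2) l unfolding f'_def by auto
    have f'0: "f' 0 = f 0" "f' s = f s" using i unfolding f'_def by auto
    have V2: "(f = p \<and> Val s f' q) \<or> (f = q \<and> g = p \<and> Val s p f')"
      using V' V f'e f'l f'0 unfolding Val_def by auto
    \<comment> \<open>The replaced geodesic together with the other one is again a valid pair, so by
      the minimality of \<open>s\<close> they do not meet at \<open>i\<close>. Hence
      \<open>z\<close> is new on the loop, and the smaller filling contradicts the choice of
      \<open>S\<close>.\<close>
    have "f' i \<noteq> g i"
    proof (cases "f = p \<and> Val s f' q \<and> g = q")
      case True then show ?thesis using Vne[of f' q i] i by auto
    next
      case False
      then have "Val s p f' \<and> g = p" using V2 V' by auto
      then show ?thesis using Vne[of p f' i] i by auto
    qed
    then have "z \<noteq> g i" by (simp add: f'_def)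
    then have "z \<notin> \<Union>R" using notR z(3) l by simp
    then have "bd S' = insert {f (i-1),z} (insert {z,f (Suc i)} R)" using z(6) by blast
    also have "\<dots> = K \<union> (W s f' \<union> W s g)"
    proof -
      have 1: "f' (i-1) = f (i-1)" "f' i = z" "f' (Suc i) = f (Suc i)" using i unfolding f'_def by auto
      have 2: "{{f' j, f' (Suc j)} |j. j < s \<and> j \<noteq> i - 1 \<and> j \<noteq> i} = {{f j, f (Suc j)} |j. j < s \<and> j \<noteq> i - 1 \<and> j \<noteq> i}"
      proof -
        have "f' j = f j \<and> f' (Suc j) = f (Suc j)" if "j \<noteq> i - 1" "j \<noteq> i" for j
          using that i unfolding f'_def by auto
        then show ?thesis unfolding setcompr_eq_image by (intro image_cong) simp_all
      qed
      show ?thesis unfolding Wf[of f'] 1 2 R_def by blast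
    qed
    finally have bS': "bd S' = K \<union> (W s f' \<union> W s g)" .
    have "S' \<subseteq> F" using z(1) S(1) by blast
    then have "card S \<le> card S'"
      using V2 V' smin[of f' q S'] smin[of p f' S'] bS' by (auto simp: Un_commute)
    then show False using psubset_card_mono[OF finS z(1)] by linarith
  qed
  obtain S2 where S2: "S2 \<subseteq> F" "bd S2 = K \<union> (W s p \<union> W s q)" "circuit (bd S2)"
      "\<Union>(bd S2) = set ks \<union> p ` {0..s} \<union> q ` {0..<s}" using VS[OF V] by metis
  then have "S2 = S" using bd_inj S by metis
  then have cS: "circuit (bd S)" and US: "\<Union>(bd S) = set ks \<union> p ` {0..s} \<union> q ` {0..<s}" using S2 by auto
  let ?A = "set ks \<union> {p0,q0}" and ?U = "\<Union>(bd S)" and ?f = "\<lambda>v. 3 - int (deg S v)"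
  have finU: "finite ?U" unfolding US by simp
  have V0: "p 0 = p0" "q 0 = q0" "p s = q s" "s \<le> r" using V by (auto simp: Val_def)
  have AU: "?A \<subseteq> ?U" unfolding US using V0 s0 by auto
  have gb: "6 \<le> sum ?f ?U" by (rule sub_gauss_bonnet) (use deg6 S(1) cS in auto)
  have "sum ?f ?U = sum ?f ?A + sum ?f (?U - ?A)" using sum.subset_diff[OF AU finU, of ?f] by linarith
  \<comment> \<open>Inner vertices of the sides contribute at most 0. The tip lies in some triangle
    and contributes at most 2, so 4 of the total 6 remain for the near end.\<close>
  moreover have "sum ?f (?U - ?A) \<le> (\<Sum>v\<in>?U - ?A. if v = p s then 2 else 0)"
  proof (rule sum_mono)
    fix v assume v: "v \<in> ?U - ?A"
    then consider i where "i \<le> s" "v = p i" | i where "i < s" "v = q i" unfolding US by auto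
    then consider "v = p s" | i where "0 < i" "i < s" "v = p i" | i where "0 < i" "i < s" "v = q i"
      using v V0 by (cases) (metis DiffD2 UnI2 bot_nat_0.not_eq_extremum insertCI le_neq_implies_less)+
    then show "?f v \<le> (if v = p s then 2 else 0)"
    proof cases
      case 1
      then have "v \<in> ?U" using v by blast
      then obtain t where "t \<in> S" "v \<in> t" using bd_subset_sides[of S] unfolding sides_def by blast
      then have "deg S v > 0" using finS by (auto simp: deg_def card_gt_0_iff)
      then show ?thesis using 1 by simp
    next
      case 2 then show ?thesis using interior[of p q i] by auto
    next
      case 3 then show ?thesis using interior[of q p i] by auto
    qed
  qed
  moreover have "(\<Sum>v\<in>?U - ?A. if v = p s then 2 else (0::int)) \<le> 2"
    using finU by (simp add: sum.delta)
  ultimately have "4 \<le> sum ?f ?A" using gb by linarith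
  moreover have "tdist F (p 1) x = r - 1" "tdist F (q 1) x = r - 1" using V s0 unfolding Val_def by auto
  moreover have "{{p0,p 1},{q0,q 1}} \<union> path_edges (q0 # ks @ [p0]) \<subseteq> bd S"
    unfolding S(2) K_def W_def using s0 V0 by force
  moreover have "0 < r" using s0 V0 by simp
  ultimately show ?thesis using that[of S "p 1" "q 1"] S(1) by blast
qed

lemma deg_pos: "S \<subseteq> F \<Longrightarrow> e \<in> bd S \<Longrightarrow> v \<in> e \<Longrightarrow> \<exists>t\<in>S. e \<subseteq> t \<and> 0 < deg S v"
proof -
  assume S: "S \<subseteq> F" and e: "e \<in> bd S" "v \<in> e"
  then obtain t where t: "t \<in> S" "e \<subseteq> t" using bd_subset_sides[of S] unfolding sides_def by blast
  then have "{t\<in>S. v \<in> t} \<noteq> {}" using e by blast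
  then show ?thesis using t fin_sub[OF S] by (auto simp: deg_def card_gt_0_iff)
qed

lemma deg_1_same:
  assumes S: "S \<subseteq> F" and d: "deg S v = 1" and e: "e \<in> bd S" "v \<in> e" "e' \<in> bd S" "v \<in> e'"
  shows "\<exists>t\<in>S. e \<union> e' \<subseteq> t"
proof -
  obtain t t' where t: "t \<in> S" "e \<subseteq> t" "t' \<in> S" "e' \<subseteq> t'" using deg_pos[OF S] e by blast
  obtain u where "{t\<in>S. v \<in> t} = {u}" using d by (auto simp: deg_def card_1_singleton_iff)
  then have "t = u" "t' = u" using t e by blast+
  then show ?thesis using t by blast
qed

text \<open>The near end of the bigon consists of \<open>a\<close> and \<open>b\<close>, each
  contributing at most 2, while 4 is required. So \<open>a\<close> lies in a single triangle of the
  bigon, which contains both \<open>b\<close> and the next vertex \<open>p1\<close> of the geodesic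
  from \<open>a\<close>; \<open>p1\<close> is the vertex sought.\<close>

lemma triangle_condition:
  assumes e: "{a,b} \<in> sides F" and x: "x \<in> \<Union>F" and l: "tdist F a x = r" "tdist F b x = r"
  shows "\<exists>c. {a,b,c} \<in> F \<and> r = Suc (tdist F c x)"
proof -
  note v = sides_vert[OF e]
  obtain S p1 q1 where S: "0 < r" "S \<subseteq> F" "tdist F p1 x = r - 1" "tdist F q1 x = r - 1"
    "{{a,p1},{b,q1}} \<union> path_edges (b # [] @ [a]) \<subseteq> bd S" "4 \<le> (\<Sum>v\<in>set [] \<union> {a,b}. 3 - int (deg S v))"
    by (rule bigon[OF x v(3,1,2) l, of "[]"]) (use e in \<open>auto simp: insert_commute\<close>)
  have ab: "{a,b} \<in> bd S" "{a,p1} \<in> bd S" using S(5) by (auto simp: insert_commute)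
  have "0 < deg S a" "0 < deg S b" using deg_pos[OF S(2) ab(1)] by auto
  moreover have "4 \<le> (3 - int (deg S a)) + (3 - int (deg S b))" using S(6) v(3) by simp
  ultimately have "deg S a = 1" by linarith
  then obtain t where t: "t \<in> S" "{a,b} \<union> {a,p1} \<subseteq> t" using deg_1_same[OF S(2) _ ab(1) _ ab(2)] by auto
  have "p1 \<noteq> a" "p1 \<noteq> b" using S(1,3) l by auto
  then have "t = {a,b,p1}" using card3D[of t a b] card3 t S(2) v(3) by auto
  then show ?thesis using t(1) S(1,2,3) by auto
qed

text \<open>The near end is \<open>a, v, b\<close>. A single bigon triangle at \<open>a\<close>
  would contain \<open>v\<close> and \<open>p1\<close>, whose levels differ by two; so
  \<open>a\<close>, and likewise \<open>b\<close>, contributes at most 1. To reach 4,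
  \<open>v\<close> must contribute 2 and lie in one triangle only, which then contains
  \<open>a\<close> and \<open>b\<close>.\<close>

lemma interval_condition:
  assumes e: "{v,a} \<in> sides F" "{v,b} \<in> sides F" "a \<noteq> b" and x: "x \<in> \<Union>F"
    and l: "tdist F v x = Suc r" "tdist F a x = r" "tdist F b x = r"
  shows "{v,a,b} \<in> F"
proof -
  note va = sides_vert[OF e(1)] and vb = sides_vert[OF e(2)]
  obtain S p1 q1 where S: "0 < r" "S \<subseteq> F" "tdist F p1 x = r - 1" "tdist F q1 x = r - 1"
    "{{a,p1},{b,q1}} \<union> path_edges (b # [v] @ [a]) \<subseteq> bd S" "4 \<le> (\<Sum>v\<in>set [v] \<union> {a,b}. 3 - int (deg S v))"
    by (rule bigon[OF x e(3) va(2) vb(2) l(2,3), of "[v]"]) (use e l in \<open>auto simp: insert_commute\<close>)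
  have E: "{v,a} \<in> bd S" "{v,b} \<in> bd S" "{a,p1} \<in> bd S" "{b,q1} \<in> bd S" using S(5) by (auto simp: insert_commute)
  have two: "2 \<le> deg S u" if u: "{v,u} \<in> bd S" "{u,w} \<in> bd S" "tdist F w x = r - 1" for u w
  proof (rule ccontr)
    assume "\<not> 2 \<le> deg S u"
    then have "deg S u = 1" using deg_pos[OF S(2) u(1), of u] by auto
    then obtain t where t: "t \<in> S" "{v,u} \<union> {u,w} \<subseteq> t" using deg_1_same[OF S(2) _ u(1) _ u(2)] by auto
    moreover have "v \<noteq> w" using u(3) l(1) by auto
    ultimately have "{v,w} \<in> sides F" using sidesI[of t v w] S(2) by auto
    then show False using tdist_step[OF _ x] u(3) l(1) S(1) by fastforce
  qed
  have "2 \<le> deg S a" "2 \<le> deg S b" using two E S by auto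
  moreover have "0 < deg S v" using deg_pos[OF S(2) E(1)] by auto
  moreover have "4 \<le> (3 - int (deg S v)) + (3 - int (deg S a)) + (3 - int (deg S b))"
    using S(6) va(3) vb(3) e(3) by simp
  ultimately have "deg S v = 1" by linarith
  then obtain t where t: "t \<in> S" "{v,a} \<union> {v,b} \<subseteq> t" using deg_1_same[OF S(2) _ E(1) _ E(2)] by auto
  then have "t = {v,a,b}" using card3D[of t v a] card3 S(2) va(3) vb(3) e(3) by auto
  then show ?thesis using t(1) S(2) by auto
qed

end

section \<open>Cutting off a band along the boundary\<close>

lemma bd_remove:
  assumes "finite S" "t \<in> S" shows "bd (S - {t}) = sym_diff (bd S) (bd {t})"
proof -
  have "S - {t} = sym_diff S {t}" using assms(2) by auto
  then show ?thesis using bd_sym_diff[of S "{t}"] assms(1) by simp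
qed

lemma tdist_map_le:
  assumes uv: "(u, v) \<in> {(x, y). {x,y} \<in> sides F} ^^ n"
    and \<rho>: "\<And>a b. {a,b} \<in> sides F \<Longrightarrow> \<rho> a = \<rho> b \<or> {\<rho> a, \<rho> b} \<in> sides G"
  shows "tdist G (\<rho> u) (\<rho> v) \<le> n"
proof -
  have "\<exists>m\<le>n. (\<rho> u, \<rho> v) \<in> {(x, y). {x,y} \<in> sides G} ^^ m"
    using uv
  proof (induction n arbitrary: v)
    case 0 then show ?case by auto
  next
    case (Suc n)
    then obtain y where y: "(u, y) \<in> {(x, y). {x,y} \<in> sides F} ^^ n" "{y,v} \<in> sides F" by auto
    obtain m where m: "m \<le> n" "(\<rho> u, \<rho> y) \<in> {(x, y). {x,y} \<in> sides G} ^^ m" using Suc.IH[OF y(1)] by blast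
    show ?case
    proof (cases "\<rho> y = \<rho> v")
      case True then show ?thesis using m by (intro exI[of _ m]) auto
    next
      case False
      then have "(\<rho> u, \<rho> v) \<in> {(x, y). {x,y} \<in> sides G} ^^ Suc m" using m(2) \<rho>[OF y(2)] by auto
      then show ?thesis using m(1) by blast
    qed
  qed
  then obtain m where "m \<le> n" "(\<rho> u, \<rho> v) \<in> {(x, y). {x,y} \<in> sides G} ^^ m" by blast
  then show ?thesis using tdist_le_relpow[of "\<rho> u" "\<rho> v" m G] by linarith
qed

text \<open>The boundary segment \<open>vs ! 0, \<dots>, vs ! Suc k\<close> is one step longer than the path \<open>w 0, \<dots>, w k\<close>
  between the same ends, and the band of triangles between the two is to be cut off.\<close>

locale strip = disc6 F for F :: "'a set set" +
  fixes vs :: "'a list" and k :: nat and w :: "nat \<Rightarrow> 'a"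
  assumes bdF: "bd F = cyc_edges vs" and dist: "distinct vs" and len4: "4 \<le> length vs"
    and k0: "0 < k" and kn: "Suc k < length vs"
    and w0: "w 0 = vs ! 0" and wk: "w k = vs ! Suc k"
    and wlev: "i \<le> k \<Longrightarrow> tdist F (w i) (vs ! 0) = i"
    and tri1: "i < k \<Longrightarrow> {vs ! Suc i, w i, w (Suc i)} \<in> F"
    and tri2: "0 < i \<Longrightarrow> i < k \<Longrightarrow> {vs ! i, vs ! Suc i, w i} \<in> F"
    and wnew: "0 < i \<Longrightarrow> i < k \<Longrightarrow> w i \<notin> set vs"
begin

text \<open>Intermediate stages that remove the triangles in pairs, one of each kind. The full
  \<open>band\<close> ends with an unpaired triangle, because the path and the segment meet in
  \<open>w k = vs ! Suc k\<close>.\<close>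

definition band_upto :: "nat \<Rightarrow> 'a set set" where
  "band_upto j = {{vs ! Suc i, w i, w (Suc i)} |i. i < j} \<union> {{vs ! i, vs ! Suc i, w i} |i. 0 < i \<and> i \<le> j}"

definition rim_upto :: "nat \<Rightarrow> 'a list" where "rim_upto j = map w [0..<Suc j] @ drop (Suc j) vs"

definition band :: "'a set set" where
  "band = {{vs ! Suc i, w i, w (Suc i)} |i. i < k} \<union> {{vs ! i, vs ! Suc i, w i} |i. 0 < i \<and> i < k}"

definition cut :: "'a set set" where "cut = F - band"

text \<open>The range stops before \<open>k\<close> because \<open>w k\<close> is already the first
  entry \<open>vs ! Suc k\<close> of the remaining list.\<close>

definition rim :: "'a list" where "rim = map w [0..<k] @ drop (Suc k) vs"

lemma bd_vert: "set vs \<subseteq> \<Union>F"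
  by (rule boundary_vertices[OF bdF dist]) (use len4 in simp)

lemma vsF: "i < length vs \<Longrightarrow> vs ! i \<in> \<Union>F" using bd_vert nth_mem by blast

lemma vs_ne: "vs \<noteq> []" using len4 by auto

lemma wF: "i \<le> k \<Longrightarrow> w i \<in> \<Union>F"
proof (cases "i < k")
  case True then show ?thesis using tri1[of i] by blast
next
  case False assume "i \<le> k"
  then show ?thesis using False wk kn vsF[of "Suc k"] by auto
qed

lemma vs_eq: "i < length vs \<Longrightarrow> j < length vs \<Longrightarrow> vs ! i = vs ! j \<longleftrightarrow> i = j"
  using dist nth_eq_iff_index_eq by blast

lemma w_eq: "i \<le> k \<Longrightarrow> j \<le> k \<Longrightarrow> w i = w j \<longleftrightarrow> i = j"
  using wlev by metis

lemma wv_ne: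
  assumes "i \<le> k" "0 < j" "j \<le> k" shows "w i \<noteq> vs ! j"
proof (cases "i = 0 \<or> i = k")
  case True then show ?thesis using assms w0 wk vs_eq[of 0 j] vs_eq[of "Suc k" j] kn vs_ne by auto
next
  case False
  then have "w i \<notin> set vs" using wnew assms(1) by simp
  then show ?thesis using assms kn nth_mem[of j vs] by auto
qed

lemma set_drop_vs: "u \<in> set (drop m vs) \<longleftrightarrow> (\<exists>j. m \<le> j \<and> j < length vs \<and> u = vs ! j)"
  unfolding in_set_conv_nth
proof
  assume "\<exists>i<length (drop m vs). drop m vs ! i = u"
  then obtain i where "i < length vs - m" "u = vs ! (m + i)" by auto
  then show "\<exists>j. m \<le> j \<and> j < length vs \<and> u = vs ! j" by (intro exI[of _ "m + i"]) auto
next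
  assume "\<exists>j. m \<le> j \<and> j < length vs \<and> u = vs ! j"
  then obtain j where "m \<le> j" "j < length vs" "u = vs ! j" by blast
  then show "\<exists>i<length (drop m vs). drop m vs ! i = u" by (intro exI[of _ "j - m"]) auto
qed

lemma w_notin_drop:
  assumes "i < k" shows "w i \<notin> set (drop (Suc m) vs)"
proof
  assume "w i \<in> set (drop (Suc m) vs)"
  then obtain j where j: "Suc m \<le> j" "j < length vs" "w i = vs ! j" unfolding set_drop_vs by blast
  show False
  proof (cases "i = 0")
    case True then show False using j w0 vs_eq[of 0 j] vs_ne by auto
  next
    case False then show False using wnew[of i] assms j nth_mem[of j vs] by auto
  qed
qed

lemma distinct_wdrop: "j \<le> k \<Longrightarrow> distinct (map w [0..<j] @ drop (Suc m) vs)"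
proof -
  assume j: "j \<le> k"
  have "inj_on w {0..<j}" using w_eq j by (auto simp: inj_on_def)
  moreover have "w ` {0..<j} \<inter> set (drop (Suc m) vs) = {}" using w_notin_drop j by fastforce
  ultimately show ?thesis using dist by (simp add: distinct_map)
qed

lemma bd_band_upto: "j < k \<Longrightarrow> band_upto j \<subseteq> F \<and> bd (F - band_upto j) = cyc_edges (rim_upto j)"
proof (induction j)
  case 0
  have "rim_upto 0 = vs" using w0 vs_ne Cons_nth_drop_Suc[of 0 vs] unfolding rim_upto_def by simp
  moreover have "band_upto 0 = {}" by (auto simp: band_upto_def)
  ultimately show ?case using bdF by simp
next
  case (Suc j)
  let ?t1 = "{w j, vs ! Suc j, w (Suc j)}" and ?t2 = "{vs ! Suc j, w (Suc j), vs ! Suc (Suc j)}"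
  have IH: "band_upto j \<subseteq> F" "bd (F - band_upto j) = cyc_edges (rim_upto j)" using Suc by auto
  have tF: "?t1 \<in> F" "?t2 \<in> F" using tri1[of j] tri2[of "Suc j"] Suc.prems by (auto simp: insert_commute)
  have Tj: "band_upto (Suc j) = insert ?t1 (insert ?t2 (band_upto j))"
  proof -
    have "{{vs ! Suc i, w i, w (Suc i)} |i. i < Suc j} = insert {vs ! Suc j, w j, w (Suc j)} {{vs ! Suc i, w i, w (Suc i)} |i. i < j}"
      by (auto simp: less_Suc_eq)
    moreover have "{{vs ! i, vs ! Suc i, w i} |i. 0 < i \<and> i \<le> Suc j} =
        insert {vs ! Suc j, vs ! Suc (Suc j), w (Suc j)} {{vs ! i, vs ! Suc i, w i} |i. 0 < i \<and> i \<le> j}"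
      by (auto simp: le_Suc_eq)
    moreover have "?t1 = {vs ! Suc j, w j, w (Suc j)}" "?t2 = {vs ! Suc j, vs ! Suc (Suc j), w (Suc j)}" by auto
    ultimately show ?thesis unfolding band_upto_def by (simp only:) blast
  qed
  have "w (Suc j) \<notin> t" if "t \<in> band_upto j" for t
  proof -
    consider i where "t = {vs ! Suc i, w i, w (Suc i)}" "i < j" | i where "t = {vs ! i, vs ! Suc i, w i}" "0 < i" "i \<le> j"
      using \<open>t \<in> band_upto j\<close> unfolding band_upto_def by blast
    then show ?thesis
    proof cases
      case 1 then show ?thesis using wv_ne[of "Suc j" "Suc i"] w_eq[of "Suc j"] Suc.prems by auto
    next
      case 2 then show ?thesis using wv_ne[of "Suc j" "Suc i"] wv_ne[of "Suc j" i] w_eq[of "Suc j" i] Suc.prems by auto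
    qed
  qed
  then have nT: "?t1 \<notin> band_upto j" "?t2 \<notin> band_upto j" by blast+
  have "vs ! Suc (Suc j) \<notin> ?t1"
    using wv_ne[of j "Suc (Suc j)"] wv_ne[of "Suc j" "Suc (Suc j)"] vs_eq[of "Suc j" "Suc (Suc j)"] Suc.prems kn by auto
  then have t12: "?t1 \<noteq> ?t2" by blast
  have dr: "drop (Suc j) vs = vs ! Suc j # vs ! Suc (Suc j) # drop (Suc (Suc (Suc j))) vs"
    using Cons_nth_drop_Suc[of "Suc j" vs] Cons_nth_drop_Suc[of "Suc (Suc j)" vs] Suc.prems kn by simp
  have dr2: "drop (Suc (Suc j)) vs = vs ! Suc (Suc j) # drop (Suc (Suc (Suc j))) vs"
    using Cons_nth_drop_Suc[of "Suc (Suc j)" vs] Suc.prems kn by simp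
  let ?R = "drop (Suc (Suc (Suc j))) vs"
  \<comment> \<open>The cycle between two stages. Removing \<open>?t2\<close> inserts
    \<open>w (Suc j)\<close> into the boundary, which is the shortcut read backwards; removing
    \<open>?t1\<close> then drops \<open>vs ! Suc j\<close>.\<close>
  let ?M = "map w [0..<j] @ w j # vs ! Suc j # w (Suc j) # vs ! Suc (Suc j) # ?R"
  have Lj: "rim_upto j = map w [0..<Suc j] @ vs ! Suc j # vs ! Suc (Suc j) # ?R" unfolding rim_upto_def dr by simp
  have LSj: "rim_upto (Suc j) = map w [0..<j] @ w j # w (Suc j) # vs ! Suc (Suc j) # ?R" unfolding rim_upto_def dr2 by simp
  have dM: "distinct ?M"
  proof -
    have d: "distinct (map w [0..<Suc (Suc j)] @ drop (Suc j) vs)" using distinct_wdrop[of "Suc (Suc j)" j] Suc.prems by simp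
    then show ?thesis unfolding dr by auto
  qed
  have "cyc_edges (map w [0..<Suc j] @ vs ! Suc j # vs ! Suc (Suc j) # ?R) =
      sym_diff (cyc_edges (map w [0..<Suc j] @ vs ! Suc j # w (Suc j) # vs ! Suc (Suc j) # ?R)) (bd {?t2})"
    by (rule cyc_edges_shortcut') (use dM in auto)
  then have c1: "cyc_edges (rim_upto j) = sym_diff (cyc_edges ?M) (bd {?t2})" unfolding Lj by simp
  have c2: "cyc_edges (rim_upto (Suc j)) = sym_diff (cyc_edges ?M) (bd {?t1})" unfolding LSj
    by (rule cyc_edges_shortcut') (use dM in auto)
  have "bd (F - band_upto j - {?t2}) = sym_diff (cyc_edges (rim_upto j)) (bd {?t2})"
    using bd_remove[of "F - band_upto j" ?t2] fin nT tF IH(2) by simp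
  also have "\<dots> = cyc_edges ?M" unfolding c1 by blast
  finally have "bd (F - band_upto j - {?t2}) = cyc_edges ?M" .
  then have "bd (F - band_upto j - {?t2} - {?t1}) = cyc_edges (rim_upto (Suc j))"
    using bd_remove[of "F - band_upto j - {?t2}" ?t1] fin nT tF t12 c2 by simp
  moreover have "F - band_upto j - {?t2} - {?t1} = F - band_upto (Suc j)" unfolding Tj by blast
  ultimately show ?case using IH(1) tF Tj by auto
qed

lemma band_eq: "band = insert {w (k - 1), vs ! k, vs ! Suc k} (band_upto (k - 1))"
proof -
  have "{{vs ! Suc i, w i, w (Suc i)} |i. i < k} = insert {vs ! k, w (k - 1), w k} {{vs ! Suc i, w i, w (Suc i)} |i. i < k - 1}"
    using k0 by (cases k) (auto simp: less_Suc_eq)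
  moreover have "{{vs ! i, vs ! Suc i, w i} |i. 0 < i \<and> i < k} = {{vs ! i, vs ! Suc i, w i} |i. 0 < i \<and> i \<le> k - 1}"
    using k0 by (cases k) (auto simp: less_Suc_eq_le)
  moreover have "{vs ! k, w (k - 1), w k} = {w (k - 1), vs ! k, vs ! Suc k}" using wk by auto
  ultimately show ?thesis unfolding band_def band_upto_def by simp
qed

lemma band_sub: "band \<subseteq> F" using tri1 tri2 unfolding band_def by blast

lemma distinct_rim: "distinct rim" unfolding rim_def by (rule distinct_wdrop) simp

lemma length_rim: "length rim = length vs - 1" using kn by (simp add: rim_def)

lemma bd_cut: "bd cut = cyc_edges rim"
proof -
  let ?t = "{w (k - 1), vs ! k, vs ! Suc k}"
  have IH: "bd (F - band_upto (k-1)) = cyc_edges (rim_upto (k-1))" using bd_band_upto[of "k-1"] k0 by simp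
  have tF: "?t \<in> F" using band_sub band_eq by blast
  have "vs ! Suc k \<notin> t" if "t \<in> band_upto (k-1)" for t
  proof -
    consider i where "t = {vs ! Suc i, w i, w (Suc i)}" "i < k - 1" | i where "t = {vs ! i, vs ! Suc i, w i}" "0 < i" "i \<le> k - 1"
      using \<open>t \<in> band_upto (k-1)\<close> unfolding band_upto_def by blast
    then show ?thesis
    proof cases
      case 1 then show ?thesis using vs_eq[of "Suc k" "Suc i"] w_eq[of k i] w_eq[of k "Suc i"] kn wk by auto
    next
      case 2 then show ?thesis using vs_eq[of "Suc k" "Suc i"] vs_eq[of "Suc k" i] w_eq[of k i] kn wk by auto
    qed
  qed
  then have nT: "?t \<notin> band_upto (k-1)" by blast
  have "bd (F - band_upto (k-1) - {?t}) = sym_diff (cyc_edges (rim_upto (k-1))) (bd {?t})"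
    using bd_remove[of "F - band_upto (k-1)" ?t] fin nT tF IH by simp
  moreover have "F - band_upto (k-1) - {?t} = cut" unfolding cut_def band_eq by blast
  moreover have "cyc_edges rim = sym_diff (cyc_edges (rim_upto (k-1))) (bd {?t})"
  proof -
    have kk: "Suc (k-1) = k" using k0 by simp
    let ?R = "drop (Suc (Suc k)) vs"
    have dr: "drop k vs = vs ! k # vs ! Suc k # ?R" "drop (Suc k) vs = vs ! Suc k # ?R"
      using Cons_nth_drop_Suc[of k vs] Cons_nth_drop_Suc[of "Suc k" vs] kn by auto
    have mw: "map w [0..<k] = map w [0..<k-1] @ [w (k-1)]" using k0 by (metis kk append_Nil list.simps(8,9) map_append upt_Suc_append zero_le)
    have l1: "rim_upto (k-1) = map w [0..<k-1] @ w (k-1) # vs ! k # vs ! Suc k # ?R" unfolding rim_upto_def kk dr mw by simp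
    have l2: "rim = map w [0..<k-1] @ w (k-1) # vs ! Suc k # ?R" unfolding rim_def dr mw by simp
    have d: "distinct (rim_upto (k-1))" unfolding rim_upto_def kk using distinct_wdrop[of k "k-1"] k0 by simp
    \<comment> \<open>For \<open>k = 1\<close> this uses the length bound 4: cutting the only
      triangle of the band must leave a cycle.\<close>
    have "map w [0..<k-1] @ ?R \<noteq> []" using len4 k0 kn by (cases "k = 1") auto
    then show ?thesis unfolding l2 l1 by (intro cyc_edges_shortcut') (use d l1 in auto)
  qed
  ultimately show ?thesis by simp
qed

lemma circuit_cut: "circuit (bd cut)"
  unfolding bd_cut by (rule circuit_cyc) (use distinct_rim length_rim len4 in auto)

lemma Union_bd_cut: "\<Union>(bd cut) = set rim"
  unfolding bd_cut by (rule circuit_cyc) (use distinct_rim length_rim len4 in auto)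

lemma set_rim: "set rim = w ` {0..k} \<union> set (drop (Suc (Suc k)) vs)"
proof -
  have "drop (Suc k) vs = w k # drop (Suc (Suc k)) vs" using Cons_nth_drop_Suc[of "Suc k" vs] kn wk by simp
  then have "set rim = insert (w k) (w ` {0..<k}) \<union> set (drop (Suc (Suc k)) vs)" unfolding rim_def by auto
  moreover have "insert (w k) (w ` {0..<k}) = w ` {0..k}" by (auto simp: le_less)
  ultimately show ?thesis by simp
qed

lemma v_notin_rim: "0 < i \<Longrightarrow> i \<le> k \<Longrightarrow> vs ! i \<notin> set rim"
proof
  assume i: "0 < i" "i \<le> k" "vs ! i \<in> set rim"
  then consider j where "j \<le> k" "vs ! i = w j" | j where "Suc (Suc k) \<le> j" "j < length vs" "vs ! i = vs ! j"
    unfolding set_rim Un_iff set_drop_vs by auto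
  then show False
  proof cases
    case 1 then show False using wv_ne[of j i] i by simp
  next
    case 2 then show False using vs_eq[of i j] i kn by simp
  qed
qed

lemma cut_sub: "cut \<subseteq> F" unfolding cut_def by blast

lemma disc_cut: "disc cut" by (rule subdisc[OF cut_sub circuit_cut])

text \<open>A removed vertex is on no boundary edge of \<open>cut\<close>, so every boundary edge of
  the band at this vertex is a boundary edge of \<open>F\<close>, and \<open>star_subset\<close>
  applies to the band.\<close>

lemma star_v:
  assumes "0 < i" "i \<le> k" shows "{t\<in>F. vs ! i \<in> t} \<subseteq> band"
proof (rule star_subset[OF band_sub])
  show "{vs ! Suc (i - 1), w (i - 1), w (Suc (i - 1))} \<in> band" unfolding band_def using assms
    by (intro UnI1 CollectI exI[of _ "i-1"]) auto
  show "vs ! i \<in> {vs ! Suc (i - 1), w (i - 1), w (Suc (i - 1))}" using assms by simp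
  fix e assume e: "e \<in> bd band" "vs ! i \<in> e"
  have "band = sym_diff F cut" using band_sub unfolding cut_def by blast
  then have "bd band = sym_diff (bd F) (bd cut)" using bd_sym_diff[OF fin fin_sub[OF cut_sub]] by simp
  moreover have "e \<notin> bd cut" using e(2) v_notin_rim[OF assms] Union_bd_cut by blast
  ultimately show "e \<in> bd F" using e(1) by blast
qed

lemma vert_cut: "\<Union>cut = \<Union>F - (!) vs ` {1..k}"
proof
  have "vs ! i \<notin> \<Union>cut" if "i \<in> {1..k}" for i
    using star_v[of i] that cut_sub unfolding cut_def by auto
  then show "\<Union>cut \<subseteq> \<Union>F - (!) vs ` {1..k}" using cut_sub by blast
  show "\<Union>F - (!) vs ` {1..k} \<subseteq> \<Union>cut"
  proof
    fix u assume u: "u \<in> \<Union>F - (!) vs ` {1..k}"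
    then obtain t where t: "t \<in> F" "u \<in> t" by blast
    show "u \<in> \<Union>cut"
    proof (cases "t \<in> band")
      case False then show ?thesis using t unfolding cut_def by blast
    next
      case True
      then consider i where "t = {vs ! Suc i, w i, w (Suc i)}" "i < k" | i where "t = {vs ! i, vs ! Suc i, w i}" "0 < i" "i < k"
        unfolding band_def by blast
      then have "u \<in> w ` {0..k}"
      proof cases
        case 1
        then have "u \<noteq> vs ! Suc i" using u by auto
        then show ?thesis using 1 t(2) by auto
      next
        case 2
        then have "u \<noteq> vs ! Suc i" "u \<noteq> vs ! i" using u by auto
        then show ?thesis using 2 t(2) by auto
      qed
      then have "u \<in> \<Union>(bd cut)" unfolding Union_bd_cut set_rim by (rule UnI1)
      then show ?thesis using bd_subset_sides[of cut] unfolding sides_def by blast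
    qed
  qed
qed

lemma disc6_cut: "disc6 cut"
proof -
  interpret G: disc cut by (rule disc_cut)
  show ?thesis
  proof
    fix u assume u: "u \<in> \<Union>cut - \<Union>(bd cut)"
    then obtain t0 where t0: "t0 \<in> cut" "u \<in> t0" by blast
    note st = star_subset'[OF cut_sub t0]
    have "{t\<in>F. u \<in> t} = {t\<in>cut. u \<in> t}" using st(1) u cut_sub by blast
    then have "deg cut u = deg F u" by (simp add: deg_def)
    moreover have "u \<in> \<Union>F - \<Union>(bd F)" using st(2) u cut_sub by blast
    ultimately show "6 \<le> deg cut u" using deg6 by simp
  qed
qed

lemma ww_sides: "i < k \<Longrightarrow> {w i, w (Suc i)} \<in> sides cut"
proof -
  assume i: "i < k"
  have "drop (Suc k) vs = w k # drop (Suc (Suc k)) vs" using Cons_nth_drop_Suc[of "Suc k" vs] kn wk by simp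
  then have "rim = map w [0..<Suc k] @ drop (Suc (Suc k)) vs" unfolding rim_def by simp
  moreover have "{w i, w (Suc i)} \<in> path_edges (map w [0..<Suc k])" unfolding path_edges_map_upt using i by blast
  moreover have "path_edges xs \<subseteq> cyc_edges (xs @ ys)" if "xs \<noteq> []" for xs ys :: "'a list"
    using that by (cases "ys = []") (auto simp: cyc_edges_def path_edges_append)
  moreover have "map w [0..<Suc k] \<noteq> []" by simp
  ultimately have "{w i, w (Suc i)} \<in> cyc_edges rim" by (simp only:) blast
  then show ?thesis using bd_cut bd_subset_sides by blast
qed

lemma vs_drop_in: "vs ! j \<in> set rim" if "Suc k \<le> j" "j < length vs"
  unfolding rim_def using that by (auto simp: set_drop_vs)

text \<open>Sliding every removed vertex \<open>vs ! i\<close> to \<open>w i\<close>, or every one to \<open>w (i - 1)\<close>, retracts the disc onto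
  the remaining one without increasing distances.\<close>

lemma retract:
  assumes \<rho>: "\<And>u. u \<in> \<Union>cut \<Longrightarrow> \<rho> u = u" "\<And>i. 0 < i \<Longrightarrow> i \<le> k \<Longrightarrow> \<rho> (vs ! i) = w (g i)"
    and g: "\<And>i. i < k \<Longrightarrow> g (Suc i) = i \<or> g (Suc i) = Suc i" "\<And>i. 0 < i \<Longrightarrow> i < k \<Longrightarrow> g (Suc i) = Suc (g i)"
    and u: "u \<in> \<Union>F" and x: "x \<in> \<Union>cut"
  shows "tdist cut (\<rho> u) x \<le> tdist F u x"
proof -
  have w_cut: "w i \<in> \<Union>cut" if "i \<le> k" for i
    unfolding vert_cut using that wF wv_ne by fastforce
  have r: "\<rho> a = \<rho> b \<or> {\<rho> a, \<rho> b} \<in> sides cut" if ab: "{a,b} \<in> sides F" for a b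
  proof -
    obtain t where t: "t \<in> F" "{a,b} \<subseteq> t" using ab by (auto simp: sides_def)
    have ne: "a \<noteq> b" using sides_vert(3)[OF ab] .
    show ?thesis
    proof (cases "t \<in> band")
      case False
      then have t_cut: "t \<in> cut" using t unfolding cut_def by blast
      then have "{a,b} \<in> sides cut" using t ne unfolding sides_def by auto
      moreover have "\<rho> a = a" "\<rho> b = b" using \<rho>(1) t_cut t(2) by auto
      ultimately show ?thesis by simp
    next
      case True
      \<comment> \<open>Each band triangle is collapsed onto one edge of the path \<open>w\<close>,
        which belongs to the remaining disc.\<close>
      then obtain i where i: "i < k" "\<rho> ` t \<subseteq> {w i, w (Suc i)}"
      proof -
        consider i where "t = {vs ! Suc i, w i, w (Suc i)}" "i < k" | i where "t = {vs ! i, vs ! Suc i, w i}" "0 < i" "i < k"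
          using True unfolding band_def by blast
        then show ?thesis
        proof cases
          case 1
          then show ?thesis using that[of i] \<rho>(1)[OF w_cut[of i]] \<rho>(1)[OF w_cut[of "Suc i"]] \<rho>(2)[of "Suc i"] g(1)[of i] by auto
        next
          case 2
          have gi: "g (Suc i) = i \<or> g (Suc i) = Suc i" "g (Suc i) = Suc (g i)" using g(1)[OF 2(3)] g(2)[OF 2(2,3)] by auto
          have "\<rho> (vs ! i) = w (g i)" "\<rho> (vs ! Suc i) = w (Suc (g i))" "\<rho> (w i) = w i"
            using \<rho>(2)[of i] \<rho>(2)[of "Suc i"] \<rho>(1)[OF w_cut[of i]] gi(2) 2 by auto
          then have "\<rho> ` t \<subseteq> {w (g i), w (Suc (g i))}" using gi 2(1) by auto
          moreover have "g i < k" using gi 2 by auto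
          ultimately show ?thesis using that by blast
        qed
      qed
      then have "\<rho> a \<in> {w i, w (Suc i)}" "\<rho> b \<in> {w i, w (Suc i)}" using t(2) by blast+
      then show ?thesis using ww_sides[OF i(1)] by (auto simp: insert_commute)
    qed
  qed
  have xF: "x \<in> \<Union>F" using x cut_sub by blast
  have "tdist cut (\<rho> u) (\<rho> x) \<le> tdist F u x" by (rule tdist_map_le[OF tdist_relpow[OF u xF] r])
  then show ?thesis using \<rho>(1)[OF x] by simp
qed

lemma retract_w:
  assumes x: "x \<in> \<Union>cut"
  shows "u \<in> \<Union>cut \<Longrightarrow> tdist cut u x \<le> tdist F u x"
    "0 < i \<Longrightarrow> i \<le> k \<Longrightarrow> tdist cut (w i) x \<le> tdist F (vs ! i) x"
    "i < k \<Longrightarrow> tdist cut (w i) x \<le> tdist F (vs ! Suc i) x"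
proof -
  define idx where "idx u = (THE i. i \<in> {1..k} \<and> u = vs ! i)" for u
  have idx: "idx (vs ! i) = i" if "0 < i" "i \<le> k" for i
    unfolding idx_def by (rule the_equality) (use that kn vs_eq in auto)
  define \<rho> where "\<rho> g u = (if u \<in> (!) vs ` {1..k} then w (g (idx u)) else u)" for g :: "nat \<Rightarrow> nat" and u
  have 1: "\<rho> g u = u" if "u \<in> \<Union>cut" for g u using that unfolding \<rho>_def vert_cut by simp
  have 2: "\<rho> g (vs ! i) = w (g i)" if "0 < i" "i \<le> k" for g i
    using that idx[OF that] unfolding \<rho>_def by simp
  have vF: "vs ! i \<in> \<Union>F" if "i \<le> k" for i using vsF kn that by simp
  have A: "tdist cut (\<rho> id u) x \<le> tdist F u x" if "u \<in> \<Union>F" for u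
    by (rule retract[where g = id]) (use 1 2 that x in auto)
  have B: "tdist cut (\<rho> (\<lambda>i. i - 1) u) x \<le> tdist F u x" if "u \<in> \<Union>F" for u
    by (rule retract[where g = "\<lambda>i. i - 1"]) (use 1 2 that x in auto)
  show "tdist cut u x \<le> tdist F u x" if "u \<in> \<Union>cut" using A[of u] 1[OF that] that cut_sub by auto
  show "tdist cut (w i) x \<le> tdist F (vs ! i) x" if "0 < i" "i \<le> k" using A[OF vF[OF that(2)]] 2[OF that, of id] by simp
  show "tdist cut (w i) x \<le> tdist F (vs ! Suc i) x" if "i < k" using B[of "vs ! Suc i"] vF[of "Suc i"] 2[of "Suc i" "\<lambda>i. i - 1"] that by simp
qed

lemma tdist_cut:
  assumes "u \<in> \<Union>cut" "x \<in> \<Union>cut" shows "tdist cut u x = tdist F u x"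
proof (rule antisym)
  show "tdist cut u x \<le> tdist F u x" using retract_w(1) assms by blast
  interpret G: disc cut by (rule disc_cut)
  have "tdist F (id u) (id x) \<le> tdist cut u x"
    by (rule tdist_map_le[OF G.tdist_relpow[OF assms]]) (use sides_mono[OF cut_sub] in auto)
  then show "tdist F u x \<le> tdist cut u x" by simp
qed

lemma w_in_cut: "i \<le> k \<Longrightarrow> w i \<in> \<Union>cut"
  unfolding vert_cut using wF wv_ne by fastforce

text \<open>The two retractions show that \<open>w i\<close> is no farther from \<open>x\<close>
  than \<open>vs ! i\<close> and \<open>vs ! Suc i\<close>, and adjacency bounds the gain by 1. If
  the two distances differ, this fixes the value. If they agree, \<open>triangle_condition\<close>
  gives a triangle on \<open>{vs ! i, vs ! Suc i}\<close> with a closer third vertex, which is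
  \<open>w i\<close> because a boundary edge lies in one triangle only.\<close>

lemma tdist_w:
  assumes i: "0 < i" "i < k" and x: "x \<in> \<Union>cut"
  shows "tdist F (w i) x = (if tdist F (vs ! i) x = tdist F (vs ! Suc i) x then tdist F (vs ! i) x - 1
     else min (tdist F (vs ! i) x) (tdist F (vs ! Suc i) x))"
proof -
  have xF: "x \<in> \<Union>F" using x cut_sub by blast
  have b: "{vs ! i, vs ! Suc i} \<in> bd F"
    unfolding bdF cyc_edges_nth[of vs] using i kn len4 by (subst cyc_edges_nth) (auto intro!: exI[of _ i])
  have e: "{vs ! i, vs ! Suc i} \<in> sides F" using b bd_subset_sides by blast
  have wn: "w i \<noteq> vs ! i" "w i \<noteq> vs ! Suc i" using wv_ne[of i i] wv_ne[of i "Suc i"] i by auto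
  have e2: "{w i, vs ! i} \<in> sides F" "{w i, vs ! Suc i} \<in> sides F" using sidesI[OF tri2[OF i]] wn by auto
  have le: "tdist F (w i) x \<le> tdist F (vs ! i) x" "tdist F (w i) x \<le> tdist F (vs ! Suc i) x"
    using retract_w(2,3)[OF x, of i] i tdist_cut[OF w_in_cut[of i] x] by auto
  have ge: "tdist F (vs ! i) x \<le> Suc (tdist F (w i) x)" "tdist F (vs ! Suc i) x \<le> Suc (tdist F (w i) x)"
    using tdist_step[of "vs ! i" "w i" x] tdist_step[of "vs ! Suc i" "w i" x] e2 xF by (auto simp: insert_commute)
  show ?thesis
  proof (cases "tdist F (vs ! i) x = tdist F (vs ! Suc i) x")
    case True
    obtain c where c: "{vs ! i, vs ! Suc i, c} \<in> F" "tdist F (vs ! i) x = Suc (tdist F c x)"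
      using triangle_condition[OF e xF refl] True by auto
    have "card {t\<in>F. {vs ! i, vs ! Suc i} \<subseteq> t} = 1" using ncof[OF e] b by simp
    moreover have "{vs ! i, vs ! Suc i, c} \<in> {t\<in>F. {vs ! i, vs ! Suc i} \<subseteq> t}" "{vs ! i, vs ! Suc i, w i} \<in> {t\<in>F. {vs ! i, vs ! Suc i} \<subseteq> t}"
      using c(1) tri2[OF i] by auto
    ultimately have "{vs ! i, vs ! Suc i, c} = {vs ! i, vs ! Suc i, w i}"
      by (metis (no_types, lifting) card_1_singletonE singletonD)
    then have "c = w i" using c(2) True wn by auto
    then show ?thesis using c(2) True by simp
  next
    case False
    then show ?thesis using le ge by simp
  qed
qed

text \<open>The path gives the upper bound. It moves away from \<open>vs ! 0\<close> by one in each
  step, which gives the lower bound.\<close>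

lemma tdist_ww:
  assumes "i \<le> j" "j \<le> k" shows "tdist F (w i) (w j) = j - i"
proof (rule antisym)
  have "tdist F (w (i + 0)) (w (i + (j - i))) \<le> j - i"
    by (rule tdist_walk[of "j - i" "\<lambda>m. w (i + m)"]) (use ww_sides sides_mono[OF cut_sub] wF assms in auto)
  then show "tdist F (w i) (w j) \<le> j - i" using assms by simp
  have v0: "vs ! 0 \<in> \<Union>F" using vsF vs_ne by simp
  have "tdist F (w j) (vs ! 0) \<le> tdist F (w j) (w i) + tdist F (w i) (vs ! 0)"
    using tdist_triangle wF assms v0 by simp
  then have "j - i \<le> tdist F (w j) (w i)" using wlev assms by simp
  then show "j - i \<le> tdist F (w i) (w j)" using tdist_sym[of "w i" "w j"] wF assms by simp
qed

end

section \<open>Chords of the boundary and the choice of a segment\<close>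

lemma nth_edge_cyc: "Suc i < length vs \<Longrightarrow> {vs ! i, vs ! Suc i} \<in> cyc_edges vs"
  by (subst cyc_edges_nth) (auto intro!: exI[of _ i])

lemma last_edge_cyc: "vs \<noteq> [] \<Longrightarrow> {vs ! (length vs - 1), vs ! 0} \<in> cyc_edges vs"
  by (auto simp: cyc_edges_def last_conv_nth hd_conv_nth)

context disc begin

text \<open>Fill the cycle formed by the chord and one of its arcs. The filling contains the whole
  star of \<open>vs ! i\<close>, since its boundary edges there are boundary edges of
  \<open>F\<close>. An edge to \<open>vs ! j\<close> would put \<open>vs ! j\<close> into a triangle
  of the filling but off its boundary, so by \<open>star_subset'\<close> it would be an inner vertex
  of \<open>F\<close>.\<close>

lemma chord_separates:
  assumes bdF: "bd F = cyc_edges vs" and d: "distinct vs" and m: "2 \<le> m" "{vs ! 0, vs ! m} \<in> sides F"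
    and ij: "0 < i" "i < m" "m < j" "j < length vs"
  shows "{vs ! i, vs ! j} \<notin> sides F"
proof
  assume e: "{vs ! i, vs ! j} \<in> sides F"
  let ?C = "take (Suc m) vs"
  have dC: "distinct ?C" "3 \<le> length ?C" using d m ij by auto
  have neC: "?C \<noteq> []" "vs \<noteq> []" using ij by auto
  have "last ?C = vs ! m" using ij by (simp add: last_conv_nth neC)
  moreover have "hd ?C = vs ! 0" using neC by (simp add: hd_conv_nth)
  ultimately have cC: "cyc_edges ?C = insert {vs ! m, vs ! 0} (path_edges ?C)" using neC by (simp add: cyc_edges_def)
  have "path_edges ?C \<subseteq> bd F"
  proof
    fix e assume "e \<in> path_edges ?C"
    then obtain l where "e = {?C ! l, ?C ! Suc l}" "Suc l < length ?C" unfolding path_edges_nth by blast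
    then have "e = {vs ! l, vs ! Suc l}" "Suc l < length vs" by auto
    then show "e \<in> bd F" unfolding bdF using nth_edge_cyc by blast
  qed
  note pC = this
  have "cyc_edges ?C \<subseteq> sides F" unfolding cC using pC bd_subset_sides[of F] m(2) by (auto simp: insert_commute)
  then obtain S where S: "S \<subseteq> F" "bd S = cyc_edges ?C" using fill circuit_even[OF circuit_cyc(1)[OF dC]] by (metis (no_types))
  have U: "\<Union>(bd S) = set ?C" unfolding S(2) by (rule circuit_cyc(2)[OF dC])
  have eq: "vs ! a = vs ! b \<longleftrightarrow> a = b" if "a < length vs" "b < length vs" for a b
    using d that nth_eq_iff_index_eq by blast
  have sC: "vs ! l \<in> set ?C" if "l \<le> m" for l
    using that ij by (auto simp: in_set_conv_nth intro!: exI[of _ l])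
  have vj: "vs ! j \<notin> set ?C" using ij eq by (auto simp: in_set_conv_nth)
  have "vs ! i \<in> \<Union>(bd S)" using sC[of i] U ij by simp
  then obtain e0 where e0: "e0 \<in> bd S" "vs ! i \<in> e0" by blast
  then obtain t0 where t0: "t0 \<in> S" "e0 \<subseteq> t0" using bd_subset_sides[of S] unfolding sides_def by blast
  have "{t\<in>F. vs ! i \<in> t} \<subseteq> S"
  proof (rule star_subset[OF S(1) t0(1)])
    show "vs ! i \<in> t0" using e0 t0 by blast
    fix f assume f: "f \<in> bd S" "vs ! i \<in> f"
    then have "f \<noteq> {vs ! m, vs ! 0}" using eq[of i m] eq[of i 0] ij neC(2) by auto
    then show "f \<in> bd F" using f(1) pC unfolding S(2) cC by blast
  qed
  moreover obtain t where t: "t \<in> F" "vs ! i \<in> t" "vs ! j \<in> t" using e unfolding sides_def by blast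
  ultimately have "t \<in> S" by blast
  then have "vs ! j \<notin> \<Union>(bd F)" using star_subset'(2)[OF S(1) _ t(3)] vj U by blast
  moreover have "\<Union>(bd F) = set vs" unfolding bdF by (rule circuit_cyc(2)) (use d m ij in auto)
  ultimately show False using ij(4) by simp
qed

text \<open>The segment is chosen inside a minimal arc of the boundary whose ends are adjacent: by minimality
  and by \<open>chord_separates\<close> no chord of the boundary leaves an inner vertex of this arc.\<close>

lemma segment_exists:
  assumes bdF: "bd F = cyc_edges vs" and d: "distinct vs" and n: "4 \<le> length vs"
  obtains r k where "0 < k" "Suc k < length vs"
    "\<And>i j. i < j \<Longrightarrow> j \<le> Suc k \<Longrightarrow> (i, j) \<noteq> (0, Suc k) \<Longrightarrow> tdist F (rotate r vs ! i) (rotate r vs ! j) = j - i"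
    "tdist F (rotate r vs ! 0) (rotate r vs ! Suc k) \<le> k"
    "\<And>i u. 0 < i \<Longrightarrow> i \<le> k \<Longrightarrow> u \<in> set vs \<Longrightarrow> {rotate r vs ! i, u} \<in> sides F \<Longrightarrow>
       u = rotate r vs ! (i - 1) \<or> u = rotate r vs ! Suc i"
proof -
  let ?n = "length vs"
  define P where "P rm \<longleftrightarrow> 2 \<le> snd rm \<and> snd rm < ?n \<and> {rotate (fst rm) vs ! 0, rotate (fst rm) vs ! snd rm} \<in> sides F" for rm
  have be: "e \<in> sides F" if "e \<in> cyc_edges (rotate r vs)" for e r
    using that bdF bd_subset_sides[of F] by (auto simp: cyc_edges_rotate)
  have ne: "vs \<noteq> []" using n by auto
  \<comment> \<open>If there is no chord, the arc is the whole boundary without its closing edge, so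
    the minimum always exists.\<close>
  have "P (0, ?n - 1)" unfolding P_def using n be[of _ 0] last_edge_cyc[OF ne] by (auto simp: insert_commute)
  then obtain rm where rm: "P rm" "\<And>y. P y \<Longrightarrow> snd rm \<le> snd y"
    using ex_has_least_nat[of P _ snd] by blast
  obtain r m where rmeq: "rm = (r, m)" by (cases rm) auto
  define ws where "ws = rotate r vs"
  have m: "2 \<le> m" "m < ?n" "{ws ! 0, ws ! m} \<in> sides F" using rm(1) rmeq unfolding P_def ws_def by auto
  have lw: "length ws = ?n" "distinct ws" "set ws = set vs" "cyc_edges ws = cyc_edges vs" using d by (auto simp: ws_def cyc_edges_rotate)
  have rot: "rotate (a + r) vs ! i = ws ! (a + i)" if "a + i < ?n" for a i
    using that nth_rotate[of i ws a] lw unfolding ws_def rotate_rotate by simp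
  have inner: "{ws ! a, ws ! b} \<notin> sides F" if "a + 2 \<le> b" "b \<le> m" "(a, b) \<noteq> (0, m)" for a b
  proof
    assume "{ws ! a, ws ! b} \<in> sides F"
    then have "P (a + r, b - a)" unfolding P_def using rot[of a 0] rot[of a "b - a"] that m by auto
    then have "m \<le> b - a" using rm(2) rmeq by fastforce
    then show False using that by auto
  qed
  have wV: "ws ! i \<in> \<Union>F" if "i < ?n" for i
  proof -
    have "set vs \<subseteq> \<Union>F" by (rule boundary_vertices[OF bdF d]) (use n in simp)
    then show ?thesis using lw that nth_mem[of i ws] by auto
  qed
  have weq: "ws ! a = ws ! b \<longleftrightarrow> a = b" if "a < ?n" "b < ?n" for a b
    using lw that nth_eq_iff_index_eq by metis
  have up: "tdist F (ws ! a) (ws ! b) \<le> b - a" if "a \<le> b" "b < ?n" for a b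
  proof -
    have "tdist F (ws ! (a + 0)) (ws ! (a + (b - a))) \<le> b - a"
    proof (rule tdist_walk[of "b - a" "\<lambda>i. ws ! (a + i)"])
      fix i assume "i < b - a"
      then have "{ws ! (a + i), ws ! Suc (a + i)} \<in> cyc_edges ws" using that lw by (intro nth_edge_cyc) auto
      then show "{ws ! (a + i), ws ! (a + Suc i)} \<in> sides F" using be[of _ r] by (auto simp: ws_def)
    qed (use wV that in simp)
    then show ?thesis using that by simp
  qed
  define Q where "Q al \<longleftrightarrow> fst al + snd al \<le> m \<and> tdist F (ws ! fst al) (ws ! (fst al + snd al)) < snd al" for al
  \<comment> \<open>The arc has length at least 2 and adjacent ends, so it is not a geodesic.
    \<open>Q\<close> collects the subsegments, given by start and length, that are not
    geodesics.\<close>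
  have "Q (0, m)" unfolding Q_def using tdist_le_1[OF m(3)] m(1) by simp
  then obtain al where al: "Q al" "\<And>y. Q y \<Longrightarrow> snd al \<le> snd y"
    using ex_has_least_nat[of Q _ snd] by blast
  obtain a l where aleq: "al = (a, l)" by (cases al) auto
  have a: "a + l \<le> m" "tdist F (ws ! a) (ws ! (a + l)) < l" using al(1) aleq unfolding Q_def by auto
  have l2: "2 \<le> l"
  proof (rule ccontr)
    assume "\<not> 2 \<le> l"
    then have l1: "l = 1" "tdist F (ws ! a) (ws ! (a + l)) = 0" using a(2) by auto
    then have "ws ! a = ws ! (a + l)" using tdist_0[OF wV wV] a m by simp
    then show False using weq[of a "a + l"] a m l1 by simp
  qed
  define k where "k = l - 1"
  have k: "l = Suc k" "0 < k" using l2 by (auto simp: k_def)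
  have xs: "rotate (a + r) vs ! i = ws ! (a + i)" if "i \<le> l" for i using rot[of a i] that a(1) m by simp
  show ?thesis
  proof (rule that[of k "a + r"])
    show "0 < k" "Suc k < length vs" using k a m by auto
    show "tdist F (rotate (a + r) vs ! 0) (rotate (a + r) vs ! Suc k) \<le> k" using xs[of 0] xs[of l] a(2) k by simp
    show "tdist F (rotate (a + r) vs ! i) (rotate (a + r) vs ! j) = j - i" if ij: "i < j" "j \<le> Suc k" "(i, j) \<noteq> (0, Suc k)" for i j
    proof (rule antisym)
      have e: "rotate (a + r) vs ! i = ws ! (a + i)" "rotate (a + r) vs ! j = ws ! (a + j)" using xs ij k by auto
      show "tdist F (rotate (a + r) vs ! i) (rotate (a + r) vs ! j) \<le> j - i"
        unfolding e using up[of "a + i" "a + j"] ij k a m by simp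
      have "\<not> Q (a + i, j - i)"
      proof
        assume "Q (a + i, j - i)"
        then have "l \<le> j - i" using al(2) aleq by fastforce
        then show False using ij k by auto
      qed
      then show "j - i \<le> tdist F (rotate (a + r) vs ! i) (rotate (a + r) vs ! j)"
        unfolding e Q_def using ij k a by auto
    qed
    show "u = rotate (a + r) vs ! (i - 1) \<or> u = rotate (a + r) vs ! Suc i"
      if i: "0 < i" "i \<le> k" and u: "u \<in> set vs" "{rotate (a + r) vs ! i, u} \<in> sides F" for i u
    proof -
      let ?b = "a + i"
      have b: "0 < ?b" "?b < m" using i k a by auto
      obtain c where c: "c < ?n" "u = ws ! c" using u(1) lw by (metis in_set_conv_nth)
      have e: "{ws ! ?b, ws ! c} \<in> sides F" using u(2) c(2) xs[of i] i k by simp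
      have "c \<le> m"
      proof (rule ccontr)
        assume "\<not> c \<le> m"
        then have "{ws ! ?b, ws ! c} \<notin> sides F"
          by (intro chord_separates[of ws m]) (use bdF lw m b c in auto)
        then show False using e by blast
      qed
      moreover have "\<not> ?b + 2 \<le> c"
        using inner[of ?b c] e b \<open>c \<le> m\<close> by auto
      moreover have "\<not> c + 2 \<le> ?b"
        using inner[of c ?b] e b by (auto simp: insert_commute)
      moreover have "c \<noteq> ?b" using sides_vert(3)[OF e] by auto
      ultimately have "c = a + (i - 1) \<or> c = a + Suc i" using i by auto
      then show ?thesis using c(2) xs[of "i - 1"] xs[of "Suc i"] i k by auto
    qed
  qed
qed

end

context disc6 begin

text \<open>Base of the induction. Two boundary vertices have the same distance 1 to the third, so
  \<open>triangle_condition\<close> yields the triangle on all three; its boundary is already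
  \<open>bd F\<close>.\<close>

lemma boundary_triangle:
  assumes bdF: "bd F = cyc_edges vs" and d: "distinct vs" and n: "length vs = 3"
  shows "F = {set vs}"
proof -
  obtain a b c where vs: "vs = [a,b,c]" using n by (auto simp: numeral_3_eq_3 length_Suc_conv)
  have abc: "a \<noteq> b" "b \<noteq> c" "a \<noteq> c" using d vs by auto
  have bF: "bd F = {{a,b},{b,c},{a,c}}" unfolding bdF vs by (auto simp: cyc_edges_def)
  have E: "{a,b} \<in> sides F" "{a,c} \<in> sides F" "{b,c} \<in> sides F" using bF bd_subset_sides[of F] by auto
  have c: "c \<in> \<Union>F" using sides_vert(2)[OF E(3)] .
  have "tdist F a c = 1" "tdist F b c = 1" using tdist_sides E by simp_all
  then obtain e where e: "{a,b,e} \<in> F" "tdist F e c = 0" using triangle_condition[OF E(1) c, of 1] by auto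
  have "e = c" using tdist_0[OF _ c e(2)] e(1) by blast
  then have T: "{a,b,c} \<in> F" using e by simp
  moreover have "bd {{a,b,c}} = bd F" unfolding bF using abc by (rule bd_single)
  ultimately have "{{a,b,c}} = F" using bd_inj[of "{{a,b,c}}" F] by auto
  then show ?thesis using vs by auto
qed

text \<open>The path \<open>w\<close> is found backwards from \<open>vs ! Suc k\<close>, descending towards \<open>vs ! 0\<close>: the triangle
  condition yields the next vertex, and the interval condition joins it to the segment.\<close>

lemma strip_exists:
  assumes bdF: "bd F = cyc_edges vs" and d: "distinct vs" and n: "4 \<le> length vs" and k: "0 < k" "Suc k < length vs"
    and s1: "\<And>i j. i < j \<Longrightarrow> j \<le> Suc k \<Longrightarrow> (i, j) \<noteq> (0, Suc k) \<Longrightarrow> tdist F (vs ! i) (vs ! j) = j - i"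
    and s1': "tdist F (vs ! 0) (vs ! Suc k) \<le> k"
    and s2: "\<And>i u. 0 < i \<Longrightarrow> i \<le> k \<Longrightarrow> u \<in> set vs \<Longrightarrow> {vs ! i, u} \<in> sides F \<Longrightarrow> u = vs ! (i - 1) \<or> u = vs ! Suc i"
  shows "\<exists>w. strip F vs k w"
proof -
  have "set vs \<subseteq> \<Union>F" by (rule boundary_vertices[OF bdF d]) (use n in simp)
  then have V: "vs ! i \<in> \<Union>F" if "i < length vs" for i using that nth_mem by blast
  have veq: "vs ! a = vs ! b \<longleftrightarrow> a = b" if "a < length vs" "b < length vs" for a b
    using d that nth_eq_iff_index_eq by blast
  have be: "{vs ! i, vs ! Suc i} \<in> sides F" if "Suc i < length vs" for i
    using nth_edge_cyc[OF that] bdF bd_subset_sides[of F] by auto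
  let ?x = "vs ! 0"
  have l0: "0 < length vs" using k by linarith
  have x: "?x \<in> \<Union>F" by (rule V[OF l0])
  have lv: "tdist F (vs ! i) ?x = i" if "i \<le> k" for i
  proof (cases "i = 0")
    case False
    then show ?thesis using s1[of 0 i] that tdist_sym[OF x V[of i]] k by simp
  qed simp
  have lvk: "tdist F (vs ! Suc k) ?x = k"
  proof -
    have le: "tdist F (vs ! Suc k) ?x \<le> k" using s1' tdist_sym[OF x V[of "Suc k"]] k by simp
    have ge: "k \<le> Suc (tdist F (vs ! Suc k) ?x)" using tdist_step[OF be[of k] x] lv[of k] k by simp
    \<comment> \<open>Otherwise \<open>vs ! k\<close> would have two closer neighbours
      \<open>vs ! (k - 1)\<close> and \<open>vs ! Suc k\<close>, adjacent by
      \<open>interval_condition\<close>. For \<open>k > 1\<close> this contradicts that the segment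
      between them is a geodesic, and for \<open>k = 1\<close> the last vertex would be
      \<open>vs ! 0\<close>.\<close>
    have "tdist F (vs ! Suc k) ?x \<noteq> k - 1"
    proof
      assume a: "tdist F (vs ! Suc k) ?x = k - 1"
      obtain k' where k': "k = Suc k'" using k by (cases k) auto
      have e1: "{vs ! k, vs ! k'} \<in> sides F" using be[of k'] k k' by (simp add: insert_commute)
      have "{vs ! k, vs ! k', vs ! Suc k} \<in> F"
        by (rule interval_condition[OF e1 be[of k] _ x, of k']) (use k k' veq[of k' "Suc k"] lv[of k] lv[of k'] a in auto)
      then have e: "{vs ! k', vs ! Suc k} \<in> sides F" using sidesI[of _ "vs ! k'" "vs ! Suc k"] veq[of k' "Suc k"] k k' by auto
      show False
      proof (cases "k' = 0")
        case True
        then have "vs ! Suc k = ?x" using a k' tdist_0[OF V[of "Suc k"] x] k by simp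
        then show False using veq[of "Suc k" 0] k by (cases vs) auto
      next
        case False
        then have "tdist F (vs ! k') (vs ! Suc k) = 2" using s1[of k' "Suc k"] k' by simp
        then show False using tdist_le_1[OF e] by simp
      qed
    qed
    then show ?thesis using le ge by linarith
  qed
  \<comment> \<open>The bound \<open>k - i\<close> on the distance to the far end keeps a new
    \<open>w i\<close> off the segment: by minimality of the segment, \<open>vs ! i\<close> with
    \<open>0 < i\<close> has the larger distance \<open>Suc k - i\<close>. The interval condition
    requires these two vertices to differ.\<close>
  define Q where "Q j w \<longleftrightarrow> w k = vs ! Suc k \<and>
     (\<forall>i. j \<le> i \<and> i \<le> k \<longrightarrow> {vs ! i, w i} \<in> sides F \<and> tdist F (w i) ?x = i \<and> tdist F (w i) (vs ! Suc k) \<le> k - i) \<and>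
     (\<forall>i. j \<le> i \<and> i < k \<longrightarrow> {vs ! Suc i, w i, w (Suc i)} \<in> F \<and> {vs ! i, vs ! Suc i, w i} \<in> F)" for j w
  have "\<exists>w. Q (k - m) w" if "m < k" for m
    using that
  proof (induction m)
    case 0
    have "Q k (\<lambda>_. vs ! Suc k)" unfolding Q_def using be[of k] k lvk by auto
    then show ?case by auto
  next
    case (Suc m)
    define j where "j = k - Suc m"
    have j: "0 < j" "j < k" "k - m = Suc j" using Suc.prems by (auto simp: j_def)
    obtain w where w: "Q (Suc j) w" using Suc.IH Suc.prems j(3) by auto
    have wS: "{vs ! Suc j, w (Suc j)} \<in> sides F" "tdist F (w (Suc j)) ?x = Suc j" "tdist F (w (Suc j)) (vs ! Suc k) \<le> k - Suc j"
      using w j unfolding Q_def by auto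
    obtain c where c: "{vs ! Suc j, w (Suc j), c} \<in> F" "tdist F c ?x = j"
      using triangle_condition[OF wS(1) x lv[of "Suc j"] wS(2)] j by auto
    have cne: "c \<noteq> vs ! Suc j" "c \<noteq> w (Suc j)" using c(2) wS(2) lv[of "Suc j"] j by auto
    have ec: "{vs ! Suc j, c} \<in> sides F" "{c, w (Suc j)} \<in> sides F" using sidesI[OF c(1)] cne by auto
    have gc: "tdist F c (vs ! Suc k) \<le> k - j" using tdist_step[OF ec(2) V[of "Suc k"]] wS(3) k j by simp
    have "c \<noteq> vs ! j"
    proof
      assume "c = vs ! j"
      then have "tdist F c (vs ! Suc k) = Suc k - j" using s1[of j "Suc k"] j by simp
      then show False using gc j by simp
    qed
    have ej: "{vs ! Suc j, vs ! j} \<in> sides F" using be[of j] j k by (simp add: insert_commute)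
    have tri: "{vs ! Suc j, vs ! j, c} \<in> F"
      by (rule interval_condition[OF ej ec(1) _ x, of j]) (use \<open>c \<noteq> vs ! j\<close> lv[of "Suc j"] lv[of j] c(2) j in auto)
    have evc: "{vs ! j, c} \<in> sides F" using sidesI[OF tri] \<open>c \<noteq> vs ! j\<close> by auto
    have "Q j (w(j := c))" unfolding Q_def
    proof (intro conjI allI impI)
      show "(w(j := c)) k = vs ! Suc k" using w j unfolding Q_def by simp
      fix i assume i: "j \<le> i \<and> i \<le> k"
      have "i = j \<or> Suc j \<le> i" using i by auto
      then show "{vs ! i, (w(j := c)) i} \<in> sides F" "tdist F ((w(j := c)) i) ?x = i" "tdist F ((w(j := c)) i) (vs ! Suc k) \<le> k - i"
        using w i evc c(2) gc unfolding Q_def by (auto split: if_splits)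
    next
      fix i assume i: "j \<le> i \<and> i < k"
      have tri': "{vs ! j, vs ! Suc j, c} \<in> F" using tri by (simp add: insert_commute)
      have c': "{vs ! Suc j, c, w (Suc j)} \<in> F" using c(1) by (simp add: insert_commute)
      have "i = j \<or> Suc j \<le> i" using i by auto
      then show "{vs ! Suc i, (w(j := c)) i, (w(j := c)) (Suc i)} \<in> F" "{vs ! i, vs ! Suc i, (w(j := c)) i} \<in> F"
        using w i tri' c' unfolding Q_def by auto
    qed
    then show ?case unfolding j_def by blast
  qed
  from this[of "k - 1"] obtain w where w: "Q 1 w" using k by auto
  \<comment> \<open>At level 1 the closer third vertex has distance 0 and is \<open>?x\<close>
    itself. This closes the band, and \<open>w 0\<close> is set by hand.\<close>
  have w1: "{vs ! 1, w 1} \<in> sides F" "tdist F (w 1) ?x = 1" using w k unfolding Q_def by auto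
  obtain c where c: "{vs ! 1, w 1, c} \<in> F" "tdist F c ?x = 0" using triangle_condition[OF w1(1) x lv[of 1] w1(2)] k by auto
  have "c = ?x" using tdist_0[OF _ x c(2)] c(1) by blast
  then have t0: "{vs ! Suc 0, ?x, w (Suc 0)} \<in> F" using c(1) by (simp add: insert_commute)
  let ?w = "w(0 := ?x)"
  have adj2: "{vs ! i, w i} \<in> sides F \<and> {vs ! Suc i, w i} \<in> sides F" if "0 < i" "i < k" for i
  proof -
    have t: "{vs ! i, vs ! Suc i, w i} \<in> F" "tdist F (w i) ?x = i" "{vs ! i, w i} \<in> sides F" using w that unfolding Q_def by auto
    have "w i \<noteq> vs ! Suc i" using t(2) lv[of "Suc i"] that by auto
    then show ?thesis using t(3) sidesI[OF t(1), of "vs ! Suc i" "w i"] by auto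
  qed
  have "strip F vs k ?w"
  proof
    show "?w k = vs ! Suc k" using w k unfolding Q_def by simp
    show "tdist F (?w i) ?x = i" if "i \<le> k" for i using w that unfolding Q_def by (cases "i = 0") auto
    show "{vs ! Suc i, ?w i, ?w (Suc i)} \<in> F" if "i < k" for i using w that t0 unfolding Q_def by (cases "i = 0") auto
    show "{vs ! i, vs ! Suc i, ?w i} \<in> F" if "0 < i" "i < k" for i using w that unfolding Q_def by auto
    show "?w i \<notin> set vs" if i: "0 < i" "i < k" for i
    proof
      assume "?w i \<in> set vs"
      then have m: "w i \<in> set vs" using i by simp
      \<comment> \<open>On the boundary, \<open>w i\<close> would be a cyclic neighbour of both
        \<open>vs ! i\<close> and \<open>vs ! Suc i\<close>, as no chord starts at these vertices.
        The two pairs of candidates are disjoint.\<close>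
      have a: "w i = vs ! (i - 1) \<or> w i = vs ! Suc i" using s2[of i "w i"] adj2[OF i] m i by auto
      have b: "w i = vs ! i \<or> w i = vs ! Suc (Suc i)" using s2[of "Suc i" "w i"] adj2[OF i] m i by auto
      obtain i' where i': "i = Suc i'" using i by (cases i) auto
      show False using a b veq[of i' i] veq[of i' "Suc (Suc i)"] veq[of "Suc i" i] veq[of "Suc i" "Suc (Suc i)"] i k
        unfolding i' by auto
    qed
  qed (use bdF d n k in auto)
  then show ?thesis by blast
qed

end

section \<open>Boundary rigidity of triangulated discs\<close>

text \<open>The cyclic order of the boundary is assumed here and is supplied by
  \<open>boundary_cycle_preserved\<close>. The induction is on the boundary length, which drops by
  one with each band.\<close>

lemma disc6_rigid:
  assumes "disc6 F1" "disc6 F2" "distinct vs" "inj_on \<phi> (set vs)" "3 \<le> length vs"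
    "bd F1 = cyc_edges vs" "bd F2 = cyc_edges (map \<phi> vs)"
    "\<And>u v. u \<in> set vs \<Longrightarrow> v \<in> set vs \<Longrightarrow> tdist F1 u v = tdist F2 (\<phi> u) (\<phi> v)"
  shows "\<exists>\<psi>. inj_on \<psi> (\<Union>F1) \<and> (\<forall>v\<in>set vs. \<psi> v = \<phi> v) \<and> F2 = image \<psi> ` F1"
  using assms
proof (induction "length vs" arbitrary: F1 F2 vs \<phi> rule: less_induct)
  case less
  interpret D1: disc6 F1 by fact
  interpret D2: disc6 F2 by fact
  have dm: "distinct (map \<phi> vs)" using less.prems by (simp add: distinct_map)
  show ?case
  proof (cases "length vs = 3")
    case True
    have "F1 = {set vs}" using D1.boundary_triangle less.prems True by blast
    moreover have "F2 = {set (map \<phi> vs)}" using D2.boundary_triangle[OF _ dm] less.prems True by simp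
    ultimately show ?thesis using less.prems by (intro exI[of _ \<phi>]) auto
  next
    case False
    then have n4: "4 \<le> length vs" using less.prems by simp
    obtain r k where k: "0 < k" "Suc k < length vs"
      and s1: "\<And>i j. i < j \<Longrightarrow> j \<le> Suc k \<Longrightarrow> (i, j) \<noteq> (0, Suc k) \<Longrightarrow> tdist F1 (rotate r vs ! i) (rotate r vs ! j) = j - i"
      and s1': "tdist F1 (rotate r vs ! 0) (rotate r vs ! Suc k) \<le> k"
      and s2: "\<And>i u. 0 < i \<Longrightarrow> i \<le> k \<Longrightarrow> u \<in> set vs \<Longrightarrow> {rotate r vs ! i, u} \<in> sides F1 \<Longrightarrow>
       u = rotate r vs ! (i - 1) \<or> u = rotate r vs ! Suc i"
      by (rule D1.segment_exists[OF less.prems(6,3) n4]) blast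
    define ws where "ws = rotate r vs"
    have ws: "length ws = length vs" "distinct ws" "set ws = set vs" "cyc_edges ws = cyc_edges vs"
      using less.prems(3) by (auto simp: ws_def cyc_edges_rotate)
    have ws2: "map \<phi> ws = rotate r (map \<phi> vs)" by (simp add: ws_def rotate_map)
    have dw2: "distinct (map \<phi> ws)" using dm unfolding ws2 by simp
    have b1: "bd F1 = cyc_edges ws" and b2: "bd F2 = cyc_edges (map \<phi> ws)" using less.prems ws ws2 by (auto simp: cyc_edges_rotate)
    have U1: "set ws \<subseteq> \<Union>F1" by (rule D1.boundary_vertices[OF b1 ws(2)]) (use ws n4 in simp)
    have dd: "tdist F1 u v = tdist F2 (\<phi> u) (\<phi> v)" if "u \<in> set ws" "v \<in> set ws" for u v
      using less.prems(8) that ws by simp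
    have nin: "ws ! i \<in> set ws" if "i < length vs" for i using that ws(1) nth_mem[of i ws] by simp
    have l0: "0 < length vs" using k by linarith
    note n0 = nin[OF l0] and nk = nin[OF k(2)]
    obtain w where "strip F1 ws k w"
      using D1.strip_exists[OF b1 ws(2) _ k(1), unfolded ws(1), OF n4 k(2)] s1 s1' s2 ws(3) unfolding ws_def by blast
    then interpret S1: strip F1 ws k w .
    \<comment> \<open>All conditions on the segment concern distances between boundary vertices,
      with adjacency read as distance 1. They therefore carry over to the image segment.\<close>
    have "\<exists>w2. strip F2 (map \<phi> ws) k w2"
    proof (rule D2.strip_exists[OF b2 dw2 _ k(1)])
      show "4 \<le> length (map \<phi> ws)" "Suc k < length (map \<phi> ws)" using n4 k ws by auto
      show "tdist F2 (map \<phi> ws ! 0) (map \<phi> ws ! Suc k) \<le> k"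
        using s1' dd[OF n0 nk] k l0 ws(1) nth_map[of 0 ws \<phi>] nth_map[of "Suc k" ws \<phi>] unfolding ws_def[symmetric]
        by simp
      show "tdist F2 (map \<phi> ws ! i) (map \<phi> ws ! j) = j - i" if "i < j" "j \<le> Suc k" "(i, j) \<noteq> (0, Suc k)" for i j
        using s1[OF that] dd[of "ws ! i" "ws ! j"] nin[of i] nin[of j] k ws(1) that unfolding ws_def[symmetric] by simp
      show "u = map \<phi> ws ! (i - 1) \<or> u = map \<phi> ws ! Suc i"
        if i: "0 < i" "i \<le> k" and u: "u \<in> set (map \<phi> ws)" "{map \<phi> ws ! i, u} \<in> sides F2" for i u
      proof -
        obtain u' where u': "u' \<in> set ws" "u = \<phi> u'" using u(1) by auto
        have wi: "ws ! i \<in> set ws" using nin i k by simp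
        have "i < length ws" using i k ws(1) by linarith
        then have "{\<phi> (ws ! i), \<phi> u'} \<in> sides F2" using u(2) u'(2) by simp
        then have "tdist F2 (\<phi> (ws ! i)) (\<phi> u') = 1" by (rule D2.tdist_sides)
        then have "tdist F1 (ws ! i) u' = 1" using dd[OF wi u'(1)] by simp
        then have "{ws ! i, u'} \<in> sides F1" using D1.tdist_1 U1 wi u'(1) by blast
        then have "u' = ws ! (i - 1) \<or> u' = ws ! Suc i" using s2[OF i, of u'] u'(1) ws(3) unfolding ws_def by blast
        then show ?thesis using u'(2) i k ws(1) by auto
      qed
    qed
    then obtain w2 where "strip F2 (map \<phi> ws) k w2" by blast
    then interpret S2: strip F2 "map \<phi> ws" k w2 .
    interpret G1: disc6 S1.cut by (rule S1.disc6_cut)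
    interpret G2: disc6 S2.cut by (rule S2.disc6_cut)
    have mnth: "map \<phi> ws ! i = \<phi> (ws ! i)" if "i \<le> Suc k" for i using that k ws(1) by simp
    define idx where "idx u = (THE i. i \<le> k \<and> u = w i)" for u
    have idx: "idx (w i) = i" if "i \<le> k" for i
      unfolding idx_def by (rule the_equality) (use that S1.w_eq in auto)
    \<comment> \<open>The correspondence of the new boundaries. The ends \<open>w 0\<close> and
      \<open>w k\<close> are old boundary vertices; there \<open>\<phi>\<close> already takes the
      values \<open>w2 0\<close> and \<open>w2 k\<close>.\<close>
    define \<phi>' where "\<phi>' u = (if u \<in> w ` {0<..<k} then w2 (idx u) else \<phi> u)" for u
    have \<phi>'O: "\<phi>' u = \<phi> u" if "u \<in> set ws" for u
      using that S1.wnew unfolding \<phi>'_def by auto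
    have \<phi>'w: "\<phi>' (w i) = w2 i" if "i \<le> k" for i
    proof -
      consider "0 < i \<and> i < k" | "i = 0" | "i = k" using \<open>i \<le> k\<close> by linarith
      then show ?thesis
      proof cases
        case 1 then show ?thesis using idx[of i] unfolding \<phi>'_def by auto
      next
        case 2
        have "w 0 \<in> set ws" using n0 S1.w0 by simp
        then show ?thesis using \<phi>'O[of "w 0"] S1.w0 S2.w0 mnth[of 0] 2 by simp
      next
        case 3
        have "w k \<in> set ws" using nk S1.wk by simp
        then show ?thesis using \<phi>'O[of "w k"] S1.wk S2.wk mnth[of "Suc k"] 3 by simp
      qed
    qed
    have mL: "map \<phi>' S1.rim = S2.rim"
    proof -
      have "map \<phi>' (map w [0..<k]) = map w2 [0..<k]" using \<phi>'w by simp
      moreover have "map \<phi>' (drop (Suc k) ws) = drop (Suc k) (map \<phi> ws)"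
        using \<phi>'O by (auto simp: drop_map dest: in_set_dropD)
      ultimately show ?thesis unfolding S1.rim_def S2.rim_def by simp
    qed
    have inj': "inj_on \<phi>' (set S1.rim)" using S2.distinct_rim unfolding mL[symmetric] by (simp add: distinct_map)
    have L1V: "set S1.rim \<subseteq> \<Union>S1.cut"
      using S1.Union_bd_cut bd_subset_sides[of S1.cut] G1.sidesD by blast
    have L2V: "set S2.rim \<subseteq> \<Union>S2.cut"
      using S2.Union_bd_cut bd_subset_sides[of S2.cut] G2.sidesD by blast
    have classes: "(\<exists>i. 0 < i \<and> i < k \<and> u = w i) \<or> u \<in> set ws \<and> u \<in> \<Union>S1.cut \<and> \<phi>' u = \<phi> u \<and> \<phi> u \<in> \<Union>S2.cut"
      if u: "u \<in> set S1.rim" for u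
    proof -
      have "u \<in> set ws" if nex: "\<not> (\<exists>i. 0 < i \<and> i < k \<and> u = w i)"
      proof -
        have "(\<exists>i\<le>k. u = w i) \<or> u \<in> set (drop (Suc (Suc k)) ws)" using u unfolding S1.set_rim by auto
        then consider "u = w 0" | "u = w k" | "u \<in> set (drop (Suc (Suc k)) ws)" using nex by (metis bot_nat_0.not_eq_extremum le_neq_implies_less)
        then show ?thesis
        proof cases
          case 1 then show ?thesis using n0 S1.w0 by simp
        next
          case 2 then show ?thesis using nk S1.wk by simp
        next
          case 3 then show ?thesis by (rule in_set_dropD)
        qed
      qed
      moreover have "\<phi>' u \<in> set S2.rim" using u unfolding mL[symmetric] by simp
      ultimately show ?thesis using \<phi>'O L1V L2V u by fastforce
    qed
    have wO: "tdist F1 (w i) x = tdist F2 (w2 i) (\<phi> x)"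
      if i: "0 < i" "i < k" and x: "x \<in> set ws" "x \<in> \<Union>S1.cut" "\<phi> x \<in> \<Union>S2.cut" for i x
    proof -
      have "tdist F1 (ws ! i) x = tdist F2 (map \<phi> ws ! i) (\<phi> x)" "tdist F1 (ws ! Suc i) x = tdist F2 (map \<phi> ws ! Suc i) (\<phi> x)"
        using dd[OF _ x(1)] nin mnth i k by auto
      then show ?thesis using S1.tdist_w[OF i x(2)] S2.tdist_w[OF i x(3)] by simp
    qed
    have ww: "tdist F1 (w i) (w j) = tdist F2 (w2 i) (w2 j)" if "i \<le> k" "j \<le> k" for i j
    proof (cases "i \<le> j")
      case True then show ?thesis using S1.tdist_ww S2.tdist_ww that by simp
    next
      case False
      then have "tdist F1 (w j) (w i) = tdist F2 (w2 j) (w2 i)" using S1.tdist_ww S2.tdist_ww that by simp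
      then show ?thesis using D1.tdist_sym S1.wF D2.tdist_sym S2.wF that by metis
    qed
    have dist: "tdist S1.cut u v = tdist S2.cut (\<phi>' u) (\<phi>' v)" if uv: "u \<in> set S1.rim" "v \<in> set S1.rim" for u v
    proof -
      have V: "u \<in> \<Union>S1.cut" "v \<in> \<Union>S1.cut" using uv L1V by auto
      have V1: "u \<in> \<Union>F1" "v \<in> \<Union>F1" using V S1.cut_sub by auto
      have "\<phi>' u \<in> set S2.rim" "\<phi>' v \<in> set S2.rim" using uv unfolding mL[symmetric] by auto
      then have V2: "\<phi>' u \<in> \<Union>S2.cut" "\<phi>' v \<in> \<Union>S2.cut" using L2V by auto
      have V3: "\<phi>' u \<in> \<Union>F2" "\<phi>' v \<in> \<Union>F2" using V2 S2.cut_sub by auto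
      have "tdist F1 u v = tdist F2 (\<phi>' u) (\<phi>' v)"
      proof (cases "\<exists>i. 0 < i \<and> i < k \<and> u = w i")
        case True
        then obtain i where i: "0 < i" "i < k" "u = w i" by blast
        show ?thesis
        proof (cases "\<exists>j. 0 < j \<and> j < k \<and> v = w j")
          case True
          then obtain j where j: "0 < j" "j < k" "v = w j" by blast
          then show ?thesis using ww[of i j] i \<phi>'w by simp
        next
          case False
          then have v: "v \<in> set ws" "\<phi>' v = \<phi> v" "\<phi> v \<in> \<Union>S2.cut" using classes[OF uv(2)] by auto
          then show ?thesis using wO[OF i(1,2) v(1) V(2) v(3)] i \<phi>'w by simp
        qed
      next
        case False
        then have u: "u \<in> set ws" "\<phi>' u = \<phi> u" "\<phi> u \<in> \<Union>S2.cut" using classes[OF uv(1)] by auto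
        show ?thesis
        proof (cases "\<exists>j. 0 < j \<and> j < k \<and> v = w j")
          case True
          then obtain j where j: "0 < j" "j < k" "v = w j" by blast
          have "tdist F1 v u = tdist F2 (\<phi>' v) (\<phi>' u)" using wO[OF j(1,2) u(1) V(1) u(3)] j \<phi>'w u by simp
          then show ?thesis using D1.tdist_sym[OF V1] D2.tdist_sym[OF V3] by simp
        next
          case False
          then have v: "v \<in> set ws" "\<phi>' v = \<phi> v" using classes[OF uv(2)] by auto
          then show ?thesis using dd u by simp
        qed
      qed
      then show ?thesis using S1.tdist_cut[OF V] S2.tdist_cut[OF V2] by simp
    qed
    have "\<exists>\<psi>. inj_on \<psi> (\<Union>S1.cut) \<and> (\<forall>v\<in>set S1.rim. \<psi> v = \<phi>' v) \<and> S2.cut = image \<psi> ` S1.cut"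
    proof (rule less.hyps)
      show "length S1.rim < length vs" using S1.length_rim ws n4 by simp
      show "3 \<le> length S1.rim" using S1.length_rim ws n4 by simp
      show "bd S2.cut = cyc_edges (map \<phi>' S1.rim)" unfolding mL by (rule S2.bd_cut)
    qed (use S1.disc6_cut S2.disc6_cut S1.distinct_rim inj' S1.bd_cut dist in auto)
    then obtain \<psi>' where p: "inj_on \<psi>' (\<Union>S1.cut)" "\<And>v. v \<in> set S1.rim \<Longrightarrow> \<psi>' v = \<phi>' v" "S2.cut = image \<psi>' ` S1.cut"
      by blast
    let ?A = "(!) ws ` {1..k}"
    \<comment> \<open>The isomorphism of the remaining discs is extended by \<open>\<phi>\<close> to
      the removed vertices. It stays injective because these go to the removed vertices of
      \<open>F2\<close>, which \<open>S2.cut\<close> avoids.\<close>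
    define \<psi> where "\<psi> u = (if u \<in> ?A then \<phi> u else \<psi>' u)" for u
    have As: "?A \<subseteq> set ws" using nin k by auto
    have \<psi>1: "\<psi> u = \<psi>' u" if "u \<in> \<Union>S1.cut" for u using that unfolding \<psi>_def S1.vert_cut by simp
    have \<psi>w: "\<psi> (w i) = w2 i" if "i \<le> k" for i
    proof -
      have "w i \<in> set S1.rim" unfolding S1.set_rim using that by auto
      then show ?thesis using \<psi>1[OF S1.w_in_cut[OF that]] p(2) \<phi>'w[OF that] by simp
    qed
    have \<psi>v: "\<psi> (ws ! i) = map \<phi> ws ! i" if "0 < i" "i \<le> k" for i
      using that mnth[of i] unfolding \<psi>_def by auto
    have im1: "\<psi> ` \<Union>S1.cut = \<Union>S2.cut"
    proof -
      have "\<psi> ` \<Union>S1.cut = \<psi>' ` \<Union>S1.cut" using \<psi>1 by (intro image_cong) auto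
      then show ?thesis unfolding p(3) by blast
    qed
    have U1: "\<Union>F1 = \<Union>S1.cut \<union> ?A" unfolding S1.vert_cut using As U1 by blast
    have imA: "\<psi> ` ?A \<subseteq> (!) (map \<phi> ws) ` {1..k}"
    proof
      fix y assume "y \<in> \<psi> ` ?A"
      then obtain i where "i \<in> {1..k}" "y = \<psi> (ws ! i)" by blast
      then show "y \<in> (!) (map \<phi> ws) ` {1..k}" using \<psi>v[of i] by auto
    qed
    have "inj_on \<psi> (\<Union>F1)" unfolding U1
    proof (rule inj_on_Un[THEN iffD2], intro conjI)
      show "inj_on \<psi> (\<Union>S1.cut)" using p(1) \<psi>1 by (metis inj_on_cong)
      have "inj_on \<phi> ?A" using less.prems(4) As ws(3) inj_on_subset by metis
      then show "inj_on \<psi> ?A" unfolding \<psi>_def by (simp add: inj_on_def)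
      have "\<psi> ` \<Union>S1.cut \<inter> \<psi> ` ?A = {}" using im1 imA S2.vert_cut by blast
      then show "\<psi> ` (\<Union>S1.cut - ?A) \<inter> \<psi> ` (?A - \<Union>S1.cut) = {}" by blast
    qed
    moreover have "\<psi> v = \<phi> v" if v: "v \<in> set vs" for v
    proof (cases "v \<in> ?A")
      case True then show ?thesis by (simp add: \<psi>_def)
    next
      case False
      have "v \<in> set ws" using v ws(3) by simp
      then obtain i where i: "i < length ws" "v = ws ! i" by (metis in_set_conv_nth)
      then have "i = 0 \<or> Suc k \<le> i" using False by (cases "i = 0") auto
      then have "v \<in> set S1.rim"
      proof
        assume "i = 0" then show ?thesis using i(2) S1.w0 unfolding S1.set_rim by (metis UnI1 atLeastAtMost_iff bot_nat_0.extremum imageI)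
      next
        assume "Suc k \<le> i" then show ?thesis using i S1.vs_drop_in by simp
      qed
      then show ?thesis using p(2) \<phi>'O[OF \<open>v \<in> set ws\<close>] False by (simp add: \<psi>_def)
    qed
    moreover have "F2 = image \<psi> ` F1"
    proof -
      have "image \<psi> ` S1.cut = image \<psi>' ` S1.cut" using \<psi>1 by (intro image_cong) (auto intro!: image_cong)
      then have e1: "image \<psi> ` S1.cut = S2.cut" by (rule trans) (rule p(3)[symmetric])
      have e2: "image \<psi> ` S1.band = S2.band"
      proof -
        have a: "image \<psi> ` {{ws ! Suc i, w i, w (Suc i)} |i. i < k} = {{map \<phi> ws ! Suc i, w2 i, w2 (Suc i)} |i. i < k}"
          unfolding setcompr_eq_image image_image using \<psi>v \<psi>w by (intro image_cong) auto
        have b: "image \<psi> ` {{ws ! i, ws ! Suc i, w i} |i. 0 < i \<and> i < k} = {{map \<phi> ws ! i, map \<phi> ws ! Suc i, w2 i} |i. 0 < i \<and> i < k}"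
          unfolding setcompr_eq_image image_image using \<psi>v \<psi>w by (intro image_cong) auto
        show ?thesis unfolding S1.band_def S2.band_def image_Un a b ..
      qed
      have f: "F1 = S1.cut \<union> S1.band" "F2 = S2.cut \<union> S2.band"
        using S1.band_sub S2.band_sub unfolding S1.cut_def S2.cut_def by auto
      have "image \<psi> ` F1 = image \<psi> ` (S1.cut \<union> S1.band)" by (rule arg_cong[OF f(1)])
      also have "\<dots> = S2.cut \<union> S2.band" by (simp only: image_Un e1 e2)
      finally show ?thesis using f(2) by (simp only:)
    qed
    ultimately show ?thesis by blast
  qed
qed

text \<open>Adjacent boundary vertices form a chord iff their removal disconnects the graph induced on the
  boundary vertices, and this graph is known from the distances.\<close>

lemma boundary_cycle_preserved:
  assumes D1: "disc F1" and D2: "disc F2" and vs: "distinct vs" "3 \<le> length vs" "bd F1 = cyc_edges vs"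
    and us: "distinct us" "3 \<le> length us" "bd F2 = cyc_edges us"
    and bij: "bij_betw \<phi> (set vs) (set us)"
    and dd: "\<And>u v. u \<in> set vs \<Longrightarrow> v \<in> set vs \<Longrightarrow> tdist F1 u v = tdist F2 (\<phi> u) (\<phi> v)"
  shows "cyc_edges us = cyc_edges (map \<phi> vs)"
proof -
  interpret D1: disc F1 by fact
  interpret D2: disc F2 by fact
  note c1 = circuit_cyc[OF vs(1,2)] and c2 = circuit_cyc[OF us(1,2)]
  have V2: "set us \<subseteq> \<Union>F2" by (rule D2.boundary_vertices[OF us(3,1,2)])
  have \<phi>: "\<phi> u \<in> set us" if "u \<in> set vs" for u using bij that by (auto simp: bij_betw_def)
  have adj: "{\<phi> u, \<phi> v} \<in> sides F2" if "u \<in> set vs" "v \<in> set vs" "{u,v} \<in> sides F1" for u v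
  proof -
    have "tdist F1 u v = 1" by (rule D1.tdist_sides[OF that(3)])
    then have "tdist F2 (\<phi> u) (\<phi> v) = 1" using dd that by simp
    moreover have "\<phi> u \<in> \<Union>F2" "\<phi> v \<in> \<Union>F2" using \<phi> that V2 by blast+
    ultimately show ?thesis using D2.tdist_1 by metis
  qed
  \<comment> \<open>One inclusion suffices, since both cycles have as many edges as
    vertices.\<close>
  have "image \<phi> ` cyc_edges vs \<subseteq> cyc_edges us"
  proof (rule ccontr)
    assume "\<not> ?thesis"
    then obtain e where e: "e \<in> cyc_edges vs" "image \<phi> e \<notin> cyc_edges us" by blast
    \<comment> \<open>With \<open>e\<close> as the closing edge, the boundary vertices not on
      \<open>e\<close> form a path, whose image stays connected.\<close>
    obtain ws where ws: "distinct ws" "ws \<noteq> []" "set ws = set vs" "cyc_edges ws = cyc_edges vs" "e = {last ws, hd ws}" "length ws = length vs"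
      using cyc_edges_opening[OF e(1) vs(1)] by metis
    let ?n = "length ws"
    have n3: "3 \<le> ?n" using ws(6) vs(2) by simp
    have e': "e = {ws ! (?n - 1), ws ! 0}" using ws(2,5) by (simp add: last_conv_nth hd_conv_nth)
    have win: "ws ! i \<in> set vs" if "i < ?n" for i using that ws(3) nth_mem by blast
    have weq: "ws ! i = ws ! j \<longleftrightarrow> i = j" if "i < ?n" "j < ?n" for i j using ws(1) that nth_eq_iff_index_eq by blast
    let ?a = "\<phi> (ws ! 0)" and ?b = "\<phi> (ws ! (?n - 1))"
    have i0: "0 < ?n" "?n - 1 < ?n" using n3 by linarith+
    have ab: "{?a, ?b} \<in> sides F2"
    proof (rule adj[OF win[OF i0(1)] win[OF i0(2)]])
      show "{ws ! 0, ws ! (?n - 1)} \<in> sides F1" using e(1) vs(3) bd_subset_sides[of F1] unfolding e' by (auto simp: insert_commute)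
    qed
    have nab: "{?b, ?a} \<notin> cyc_edges us" using e(2) unfolding e' by simp
    obtain s xs where "rotate s us = ?a # xs" using cyc_edges_rotate_to[OF \<phi>[OF win[OF i0(1)]]] by blast
    define zs where "zs = rotate s us"
    have zs: "distinct zs" "set zs = set us" "cyc_edges zs = cyc_edges us" "length zs = length us"
      using us(1) by (simp_all add: zs_def cyc_edges_rotate)
    have "zs = ?a # xs" using \<open>rotate s us = ?a # xs\<close> by (simp add: zs_def)
    then have zs0: "zs ! 0 = ?a" by simp
    let ?m' = "length zs"
    have zn: "zs \<noteq> []" "3 \<le> ?m'" using zs(4) us(2) by auto
    have "?b \<in> set zs" using \<phi>[OF win[OF i0(2)]] zs(2) by simp
    then obtain m where m: "m < ?m'" "zs ! m = ?b" by (metis in_set_conv_nth)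
    have zeq: "zs ! i = zs ! j \<longleftrightarrow> i = j" if "i < ?m'" "j < ?m'" for i j using zs(1) that nth_eq_iff_index_eq by blast
    have "m \<noteq> 0"
    proof
      assume "m = 0"
      then have "?a = ?b" using m zs0 by simp
      then show False using D2.sides_vert(3)[OF ab] by simp
    qed
    moreover have "m \<noteq> 1"
    proof
      assume "m = 1"
      then have "{?a, ?b} \<in> cyc_edges zs" using nth_edge_cyc[of 0 zs] zn m zs0 by simp
      then show False using nab zs(3) by (simp add: insert_commute)
    qed
    moreover have "m \<noteq> ?m' - 1"
    proof
      assume "m = ?m' - 1"
      then have "{?b, ?a} \<in> cyc_edges zs" using last_edge_cyc[OF zn(1)] m zs0 by simp
      then show False using nab zs(3) by simp
    qed
    ultimately have m2: "2 \<le> m" "Suc m < ?m'" using m by auto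
    \<comment> \<open>One open side of the supposed chord from \<open>?a = zs ! 0\<close> to
      \<open>?b = zs ! m\<close>; by \<open>chord_separates\<close> no edge of \<open>F2\<close>
      leads from it to the other side.\<close>
    define A where "A = {zs ! i |i. 0 < i \<and> i < m}"
    have sep: "{x,y} \<notin> sides F2" if xy: "x \<in> A" "y \<in> set us" "y \<notin> A" "y \<noteq> ?a" "y \<noteq> ?b" for x y
    proof -
      obtain i where i: "0 < i" "i < m" "x = zs ! i" using \<open>x \<in> A\<close> unfolding A_def by blast
      obtain j where j: "j < ?m'" "y = zs ! j" using xy(2) zs(2) by (metis in_set_conv_nth)
      have "j \<noteq> 0" "j \<noteq> m" using j xy(4,5) m(2) zs0 by metis+
      moreover have "\<not> (0 < j \<and> j < m)" using xy(3) j(2) unfolding A_def by blast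
      ultimately have "m < j" by linarith
      have "{zs ! 0, zs ! m} \<in> sides F2" using ab m(2) zs0 by simp
      from D2.chord_separates[OF _ zs(1) m2(1) this i(1,2) \<open>m < j\<close> j(1)] us(3) zs(3)
      show ?thesis unfolding i(3) j(2) by simp
    qed
    have ne: "\<phi> (ws ! i) \<noteq> ?a \<and> \<phi> (ws ! i) \<noteq> ?b" if "0 < i" "Suc i < ?n" for i
    proof -
      have "inj_on \<phi> (set vs)" using bij by (simp add: bij_betw_def)
      then have "\<phi> (ws ! i) = \<phi> (ws ! j) \<longleftrightarrow> i = j" if "j < ?n" for j
        using inj_on_eq_iff[of \<phi> "set vs" "ws ! i" "ws ! j"] win weq that \<open>Suc i < ?n\<close> by simp
      from this[OF i0(1)] this[OF i0(2)] show ?thesis using that by simp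
    qed
    have step: "\<phi> (ws ! i) \<in> A \<longleftrightarrow> \<phi> (ws ! Suc i) \<in> A" if i: "0 < i" "Suc (Suc i) < ?n" for i
    proof -
      have w: "ws ! i \<in> set vs" "ws ! Suc i \<in> set vs" using win i by auto
      have "{ws ! i, ws ! Suc i} \<in> cyc_edges vs" using nth_edge_cyc[of i ws] i ws(4) by simp
      then have "{ws ! i, ws ! Suc i} \<in> sides F1" using vs(3) bd_subset_sides[of F1] by auto
      then have "{\<phi> (ws ! i), \<phi> (ws ! Suc i)} \<in> sides F2" using adj w by blast
      moreover have "\<phi> (ws ! i) \<noteq> ?a" "\<phi> (ws ! i) \<noteq> ?b" "\<phi> (ws ! Suc i) \<noteq> ?a" "\<phi> (ws ! Suc i) \<noteq> ?b"
        using ne[of i] ne[of "Suc i"] i by auto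
      ultimately show ?thesis
        using sep[of "\<phi> (ws ! i)" "\<phi> (ws ! Suc i)"] sep[of "\<phi> (ws ! Suc i)" "\<phi> (ws ! i)"] \<phi>[OF w(1)] \<phi>[OF w(2)]
        by (auto simp: insert_commute)
    qed
    \<comment> \<open>The image of the path cannot change sides, yet it covers all remaining
      boundary vertices of \<open>F2\<close>; these include \<open>zs ! 1\<close> on one side and
      \<open>zs ! Suc m\<close> on the other.\<close>
    have const: "\<phi> (ws ! Suc i) \<in> A \<longleftrightarrow> \<phi> (ws ! 1) \<in> A" if "Suc (Suc i) < ?n" for i
      using that by (induction i) (use step in auto)
    have pre: "\<exists>i. 0 < i \<and> Suc i < ?n \<and> y = \<phi> (ws ! i)" if y: "y \<in> set us" "y \<noteq> ?a" "y \<noteq> ?b" for y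
    proof -
      obtain x where x: "x \<in> set vs" "y = \<phi> x" using y(1) bij by (auto simp: bij_betw_def)
      then obtain i where i: "i < ?n" "x = ws ! i" using ws(3) by (metis in_set_conv_nth)
      then have "i \<noteq> 0" "i \<noteq> ?n - 1" using x(2) y(2,3) by metis+
      then show ?thesis using i x by (intro exI[of _ i]) auto
    qed
    have all: "y \<in> A \<longleftrightarrow> \<phi> (ws ! 1) \<in> A" if y: "y \<in> set us" "y \<noteq> ?a" "y \<noteq> ?b" for y
    proof -
      obtain i where i: "0 < i" "Suc i < ?n" "y = \<phi> (ws ! i)" using pre[OF y] by blast
      then obtain i' where "i = Suc i'" by (cases i) auto
      then show ?thesis using const[of i'] i by simp
    qed
    have z1: "zs ! 1 \<in> set us" "zs ! 1 \<noteq> ?a" "zs ! 1 \<noteq> ?b"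
      using zeq[of 1 0] zeq[of 1 m] m m2 zs(2) zs0 zn(1) nth_mem[of 1 zs] by auto
    have z2: "zs ! Suc m \<in> set us" "zs ! Suc m \<noteq> ?a" "zs ! Suc m \<noteq> ?b"
      using zeq[of "Suc m" 0] zeq[of "Suc m" m] m m2 zs(2) zs0 nth_mem[of "Suc m" zs] zn by auto
    have "zs ! 1 \<in> A" unfolding A_def using m2 by auto
    moreover have "zs ! Suc m \<notin> A"
    proof
      assume "zs ! Suc m \<in> A"
      then obtain i where "0 < i" "i < m" "zs ! Suc m = zs ! i" unfolding A_def by blast
      then show False using zeq[of "Suc m" i] m2 by simp
    qed
    ultimately show False using all[OF z1] all[OF z2] by blast
  qed
  moreover have "card (image \<phi> ` cyc_edges vs) = card (cyc_edges us)"
  proof -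
    have inj: "inj_on \<phi> (set vs)" using bij by (simp add: bij_betw_def)
    have "inj_on (image \<phi>) (cyc_edges vs)"
      using inj_on_subset[OF inj_on_image_Pow[OF inj]] cyc_edges_sub by blast
    then have "card (image \<phi> ` cyc_edges vs) = card (cyc_edges vs)" by (rule card_image)
    also have "\<dots> = card (set vs)" using card_circuit(1)[OF c1(1)] c1(2) by simp
    also have "\<dots> = card (set us)" using bij by (rule bij_betw_same_card)
    also have "\<dots> = card (cyc_edges us)" using card_circuit(1)[OF c2(1)] c2(2) by simp
    finally show ?thesis .
  qed
  ultimately have "image \<phi> ` cyc_edges vs = cyc_edges us" by (intro card_subset_eq finite_cyc)
  then show ?thesis by (simp add: cyc_edges_map)
qed

section \<open>Cycles in plane graphs\<close>

text \<open>In a longest path, the first vertex has a second edge by evenness, and its other end is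
  on the path by maximality. This edge closes a cycle.\<close>

lemma even_set_contains_cycle:
  fixes Z :: "'a set set"
  assumes Z: "finite Z" "\<And>e. e \<in> Z \<Longrightarrow> card e = 2" "even_set Z" "Z \<noteq> {}"
  obtains vs where "distinct vs" "3 \<le> length vs" "cyc_edges vs \<subseteq> Z"
proof -
  define P where "P xs \<longleftrightarrow> distinct xs \<and> 2 \<le> length xs \<and> path_edges xs \<subseteq> Z" for xs
  have fU: "finite (\<Union>Z)" using Z(1,2) by (metis card.infinite finite_Union zero_neq_numeral)
  have "set xs \<subseteq> \<Union>Z" if "P xs" for xs
    using that
  proof (induction xs rule: path_edges.induct)
    case (1 a b xs)
    show ?case
    proof (cases xs)
      case Nil then show ?thesis using 1(2) unfolding P_def by auto
    next
      case (Cons c ys)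
      then have "P (b # xs)" using 1(2) unfolding P_def by auto
      then show ?thesis using 1 unfolding P_def by auto
    qed
  qed (auto simp: P_def)
  then have bnd: "length xs \<le> card (\<Union>Z)" if "P xs" for xs
    using that card_mono[OF fU] distinct_card unfolding P_def by metis
  obtain e where "e \<in> Z" using Z(4) by blast
  then obtain u v where "e = {u,v}" "u \<noteq> v" using Z(2) by (metis card_2_iff)
  then have "P [u,v]" using \<open>e \<in> Z\<close> by (auto simp: P_def)
  then obtain xs where xs: "P xs" "\<And>ys. P ys \<Longrightarrow> length ys \<le> length xs"
    using ex_has_greatest_nat[of P "[u,v]" length "Suc (card (\<Union>Z))"] bnd by (metis le_imp_less_Suc less_imp_le)
  then obtain a b ys where abys: "xs = a # b # ys" unfolding P_def
    by (metis Suc_le_length_iff numeral_2_eq_2)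
  have ab: "{a,b} \<in> Z" "a \<noteq> b" using xs(1) abys by (auto simp: P_def)
  have "{e\<in>Z. a \<in> e} \<noteq> {{a,b}}"
  proof
    assume "{e\<in>Z. a \<in> e} = {{a,b}}"
    then have "deg Z a = 1" by (simp add: deg_def)
    then show False using Z(3) unfolding even_set_def by (metis odd_one)
  qed
  then obtain e' where e': "e' \<in> Z" "a \<in> e'" "e' \<noteq> {a,b}" using ab by blast
  then obtain c where c: "c \<noteq> a" "e' = {a,c}" using card2D[OF Z(2)[OF e'(1)] e'(2)] by blast
  have cb: "c \<noteq> b" using c e' by auto
  have "c \<in> set xs"
  proof (rule ccontr)
    assume "c \<notin> set xs"
    then have "P (c # xs)" using xs(1) abys c e'(1) unfolding P_def by (auto simp: insert_commute)
    then show False using xs(2) by fastforce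
  qed
  then have "c \<in> set ys" using abys c cb by auto
  then obtain us ws where yu: "ys = us @ c # ws" using split_list by metis
  let ?vs = "a # b # us @ [c]"
  have "xs = ?vs @ ws" using abys yu by simp
  then have d: "distinct ?vs" using xs(1) unfolding P_def by simp
  have "path_edges as \<subseteq> path_edges (as @ bs)" for as bs :: "'a list"
    by (cases "as = []"; cases "bs = []") (auto simp: path_edges_append)
  from this[of ?vs ws] have "path_edges ?vs \<subseteq> path_edges xs" using \<open>xs = ?vs @ ws\<close> by (simp only:)
  then have p: "path_edges ?vs \<subseteq> Z" using xs(1) unfolding P_def by blast
  have "cyc_edges ?vs \<subseteq> Z" using p e'(1) c by (auto simp: cyc_edges_def insert_commute)
  then show ?thesis using that[of ?vs] d by simp
qed

definition ends2 :: "pgraph \<Rightarrow> complex set set" where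
  "ends2 G = (\<lambda>e. e \<inter> verts G) ` edges G"

text \<open>Leads back from abstract edges to point sets. In a plane graph an edge is determined by
  its ends, so nothing is lost in between.\<close>

definition pts :: "pgraph \<Rightarrow> complex set set \<Rightarrow> complex set" where
  "pts G A = \<Union>{e\<in>edges G. e \<inter> verts G \<in> A}"

lemma adjacent_ends2: "adjacent G u v \<longleftrightarrow> {u,v} \<in> ends2 G"
  unfolding adjacent_def ends2_def by auto

lemma is_cycle_cyc: "is_cycle G vs \<longleftrightarrow> 3 \<le> length vs \<and> distinct vs \<and> cyc_edges vs \<subseteq> ends2 G"
proof (cases "vs = []")
  case False
  show ?thesis unfolding is_cycle_def cyc_edges_nth[OF False] adjacent_ends2 by blast
qed (simp add: is_cycle_def)

lemma cycle_edges_cyc: "vs \<noteq> [] \<Longrightarrow> \<Union>(cycle_edges G vs) = pts G (cyc_edges vs)"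
  unfolding cycle_edges_def pts_def by (subst cyc_edges_nth) auto

locale plane =
  fixes G :: pgraph
  assumes pg: "plane_graph G"
begin

lemma fin_verts: "finite (verts G)" using pg by (simp add: plane_graph_def)

lemma edge_arc:
  assumes "e \<in> edges G" "e \<inter> verts G = {a,b}"
  obtains g where "arc g" "path_image g = e" "pathstart g = a" "pathfinish g = b"
proof -
  obtain g where g: "arc g" "path_image g = e" "e \<inter> verts G = {pathstart g, pathfinish g}"
    using pg assms(1) unfolding plane_graph_def by metis
  show ?thesis
  proof (cases "pathstart g = a")
    case True
    then have "pathfinish g = b" using g(3) assms(2) arc_distinct_ends[OF g(1)] by (auto simp: doubleton_eq_iff)
    then show ?thesis using that[of g] g True by blast
  next
    case False
    then have "pathstart g = b" "pathfinish g = a" using g(3) assms(2) arc_distinct_ends[OF g(1)] by (auto simp: doubleton_eq_iff)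
    then show ?thesis using that[of "reversepath g"] g arc_reversepath[OF g(1)] by simp
  qed
qed

lemma edge_ends: "e \<in> edges G \<Longrightarrow> \<exists>a b. a \<noteq> b \<and> e \<inter> verts G = {a,b}"
  using pg unfolding plane_graph_def by (metis arc_distinct_ends)

lemma edge_card2: "e \<in> edges G \<Longrightarrow> card (e \<inter> verts G) = 2"
  using edge_ends by (fastforce simp: card_2_iff)

lemma ends2_card: "d \<in> ends2 G \<Longrightarrow> card d = 2 \<and> d \<subseteq> verts G"
  unfolding ends2_def using edge_card2 by auto

lemma edge_inj: "e \<in> edges G \<Longrightarrow> e' \<in> edges G \<Longrightarrow> e \<inter> verts G = e' \<inter> verts G \<Longrightarrow> e = e'"
  using pg unfolding plane_graph_def by blast

lemma edge_disj: "e \<in> edges G \<Longrightarrow> e' \<in> edges G \<Longrightarrow> p \<in> e \<Longrightarrow> p \<in> e' \<Longrightarrow> p \<notin> verts G \<Longrightarrow> e = e'"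
  using pg unfolding plane_graph_def by blast

lemma fin_edges: "finite (edges G)"
proof (rule finite_imageD)
  show "finite ((\<lambda>e. e \<inter> verts G) ` edges G)"
    by (rule finite_subset[of _ "Pow (verts G)"]) (use fin_verts in auto)
  show "inj_on (\<lambda>e. e \<inter> verts G) (edges G)" using edge_inj by (auto simp: inj_on_def)
qed

lemma edge_closed: "e \<in> edges G \<Longrightarrow> closed e"
  using edge_ends edge_arc closed_path_image arc_imp_path by metis

lemma edge_interior_nonempty: "e \<in> edges G \<Longrightarrow> \<exists>p\<in>e. p \<notin> verts G"
proof -
  assume e: "e \<in> edges G"
  then obtain a b g where g: "e \<inter> verts G = {a,b}" "arc g" "path_image g = e" "pathstart g = a" "pathfinish g = b"
    using edge_ends edge_arc by metis
  have "path_image g - {a,b} \<noteq> {}" using nonempty_simple_path_endless[OF arc_imp_simple_path[OF g(2)]] g by simp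
  then show ?thesis using g by blast
qed

text \<open>An arc is homeomorphic to an interval, so by invariance of dimension it contains no
  nonempty open set of the plane.\<close>

lemma edge_empty_interior: "e \<in> edges G \<Longrightarrow> interior e = {}"
proof (rule ccontr)
  assume e: "e \<in> edges G" and ne: "interior e \<noteq> {}"
  then obtain g where g: "arc g" "path_image g = e" using edge_ends edge_arc by metis
  obtain h where h: "homeomorphism {0..1} (path_image g) g h" using homeomorphism_arc[OF g(1)] by blast
  have s: "interior e \<subseteq> path_image g" using interior_subset g by simp
  have "continuous_on (interior e) h" using h s continuous_on_subset unfolding homeomorphism_def by blast
  moreover have "inj_on h (interior e)"
    using h s unfolding homeomorphism_def inj_on_def by (metis subsetD)
  ultimately have "DIM(complex) \<le> DIM(real)" using invariance_of_dimension[of "interior e" h] ne by simp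
  then show False by simp
qed

lemma closed_support: "closed (support G)" using compact_support[OF pg] compact_imp_closed by blast

lemma support_empty_interior: "interior (support G) = {}"
proof -
  have "interior (\<Union>A) = {}" if "finite A" "A \<subseteq> edges G" for A
    using that
  proof (induction A)
    case (insert e A)
    have "interior (\<Union>A \<union> e) = interior (\<Union>A)"
    proof (rule interior_closed_Un_empty_interior)
      show "closed (\<Union>A)" using insert edge_closed by (intro closed_Union) auto
      show "interior e = {}" using edge_empty_interior insert by blast
    qed
    then show ?case using insert by (simp add: Un_commute)
  qed simp
  then have "interior (\<Union>(edges G)) = {}" using fin_edges by blast
  then have "interior (verts G \<union> \<Union>(edges G)) = interior (verts G)"
    by (intro interior_closed_Un_empty_interior) (use fin_verts in \<open>auto intro: finite_imp_closed\<close>)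
  also have "\<dots> = {}" using fin_verts by (rule empty_interior_finite)
  finally show ?thesis by (simp add: support_def)
qed

lemma faceD:
  assumes "f \<in> faces G" shows "open f" "connected f" "f \<noteq> {}" "f \<inter> support G = {}"
  using assms closed_support in_components_connected[of f] in_components_nonempty[of f] in_components_subset[of f]
    open_components[of "- support G" f] unfolding faces_def by (auto simp: open_Compl)

lemma face_eq: "f \<in> faces G \<Longrightarrow> f' \<in> faces G \<Longrightarrow> z \<in> f \<Longrightarrow> z \<in> f' \<Longrightarrow> f = f'"
  unfolding faces_def using components_eq by blast

lemma in_some_face: "z \<notin> support G \<Longrightarrow> \<exists>f\<in>faces G. z \<in> f"
  unfolding faces_def using Union_components[of "- support G"] by blast

lemma pts_edge_iff:
  assumes "e \<in> edges G" "p \<in> e" "p \<notin> verts G" shows "p \<in> pts G A \<longleftrightarrow> e \<inter> verts G \<in> A"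
  using assms edge_disj unfolding pts_def by blast

lemma pts_support: "pts G A \<subseteq> support G" unfolding pts_def support_def by blast

lemma pts_insert:
  assumes "e \<in> edges G" shows "pts G (insert (e \<inter> verts G) A) = e \<union> pts G A"
proof
  show "pts G (insert (e \<inter> verts G) A) \<subseteq> e \<union> pts G A"
  proof
    fix x assume "x \<in> pts G (insert (e \<inter> verts G) A)"
    then obtain e' where "e' \<in> edges G" "x \<in> e'" "e' \<inter> verts G = e \<inter> verts G \<or> e' \<inter> verts G \<in> A"
      unfolding pts_def by blast
    then show "x \<in> e \<union> pts G A" using edge_inj[OF _ assms] unfolding pts_def by blast
  qed
qed (use assms in \<open>auto simp: pts_def\<close>)

lemma edge_near:
  assumes "e \<in> edges G" "p \<in> e" "p \<notin> verts G"
  obtains U where "open U" "p \<in> U" "U \<inter> support G \<subseteq> e" "U \<inter> verts G = {}"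
proof
  show "open (- (verts G \<union> \<Union>(edges G - {e})))"
    using fin_verts fin_edges edge_closed by (intro open_Compl closed_Un closed_Union finite_imp_closed) auto
  show "p \<in> - (verts G \<union> \<Union>(edges G - {e}))" using assms edge_disj by blast
qed (auto simp: support_def)

lemma arc_of_list:
  "distinct xs \<Longrightarrow> 2 \<le> length xs \<Longrightarrow> path_edges xs \<subseteq> ends2 G \<Longrightarrow>
    \<exists>g. arc g \<and> pathstart g = hd xs \<and> pathfinish g = last xs \<and> path_image g = pts G (path_edges xs)"
proof (induction xs rule: path_edges.induct)
  case (1 a b xs)
  have "{a,b} \<in> ends2 G" using 1(4) by simp
  then obtain e where e: "e \<in> edges G" "e \<inter> verts G = {a,b}" unfolding ends2_def by auto
  obtain g where g: "arc g" "path_image g = e" "pathstart g = a" "pathfinish g = b" using edge_arc[OF e] by blast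
  have path_edges: "pts G (path_edges (a # b # xs)) = e \<union> pts G (path_edges (b # xs))"
    using pts_insert[OF e(1), of "path_edges (b # xs)"] e(2) by simp
  show ?case
  proof (cases "xs = []")
    case True
    then show ?thesis using g path_edges by (intro exI[of _ g]) (simp add: pts_def)
  next
    case False
    then have "distinct (b # xs)" "2 \<le> length (b # xs)" "path_edges (b # xs) \<subseteq> ends2 G" using 1(2,4) by (auto simp: Suc_le_eq)
    then obtain h where h: "arc h" "pathstart h = b" "pathfinish h = last (b # xs)" "path_image h = pts G (path_edges (b # xs))"
      using 1(1) by auto
    have "e \<inter> pts G (path_edges (b # xs)) \<subseteq> {b}"
    proof
      fix x assume x: "x \<in> e \<inter> pts G (path_edges (b # xs))"
      then obtain e' where e': "e' \<in> edges G" "x \<in> e'" "e' \<inter> verts G \<in> path_edges (b # xs)" unfolding pts_def by blast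
      have sub: "e' \<inter> verts G \<subseteq> set (b # xs)" using path_edges_sub e'(3) by blast
      have "e' \<noteq> e" using sub e(2) 1(2) by auto
      then have xv: "x \<in> verts G" using edge_disj[OF e(1) e'(1)] x e'(2) by blast
      then have "x \<in> {a,b}" using x e(2) by blast
      moreover have "x \<in> set (b # xs)" using xv sub e'(2) by blast
      ultimately show "x \<in> {b}" using 1(2) by auto
    qed
    then have "arc (g +++ h)" using g h by (intro arc_join) auto
    then show ?thesis using g h path_edges False by (intro exI[of _ "g +++ h"]) (auto simp: path_image_join)
  qed
qed auto

text \<open>The chosen edge is kept as a separate arc \<open>g\<close>, because
  \<open>two_internal\<close> compares two curves that share it.\<close>

lemma loop_through_edge:
  assumes vs: "distinct vs" "3 \<le> length vs" "cyc_edges vs \<subseteq> ends2 G"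
    and g: "arc g" "path_image g \<in> edges G" "path_image g \<inter> verts G = {last vs, hd vs}" "pathstart g = last vs" "pathfinish g = hd vs"
  obtains h where "arc h" "pathstart h = hd vs" "pathfinish h = last vs" "path_image h = pts G (path_edges vs)"
    "simple_path (g +++ h)" "path_image (g +++ h) = pts G (cyc_edges vs)"
proof -
  have ne: "vs \<noteq> []" using vs(2) by auto
  have pv: "path_edges vs \<subseteq> ends2 G" using vs(3) ne by (auto simp: cyc_edges_def)
  obtain h where h: "arc h" "pathstart h = hd vs" "pathfinish h = last vs" "path_image h = pts G (path_edges vs)"
    using arc_of_list[OF vs(1) _ pv] vs(2) by auto
  let ?e = "path_image g"
  have nin: "{last vs, hd vs} \<notin> path_edges vs"
  proof
    assume m: "{last vs, hd vs} \<in> path_edges vs"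
    obtain a ys where ys: "vs = a # ys" "2 \<le> length ys" using vs(2) by (cases vs) auto
    have yne: "ys \<noteq> []" using ys(2) by auto
    have l: "last ys \<noteq> hd ys" "a \<notin> set ys" using vs(1) ys by (cases ys, auto)+
    have "path_edges vs = insert {a, hd ys} (path_edges ys)" using ys(1) yne by (cases ys) auto
    then have "{last ys, a} = {a, hd ys} \<or> {last ys, a} \<subseteq> set ys" using m ys(1) yne path_edges_sub[of "{last ys, a}" ys] by auto
    then show False using l by (auto simp: doubleton_eq_iff)
  qed
  have "?e \<inter> pts G (path_edges vs) \<subseteq> {last vs, hd vs}"
  proof
    fix x assume x: "x \<in> ?e \<inter> pts G (path_edges vs)"
    then obtain e' where e': "e' \<in> edges G" "x \<in> e'" "e' \<inter> verts G \<in> path_edges vs" unfolding pts_def by blast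
    have "e' \<noteq> ?e" using nin e'(3) g(3) by auto
    then have "x \<in> verts G" using edge_disj[OF g(2) e'(1)] x e'(2) by blast
    then show "x \<in> {last vs, hd vs}" using x g(3) by blast
  qed
  then have s: "simple_path (g +++ h)" using g h by (intro simple_path_join_loop) auto
  have "pts G (cyc_edges vs) = ?e \<union> pts G (path_edges vs)"
  proof -
    have "cyc_edges vs = insert (?e \<inter> verts G) (path_edges vs)" using ne g(3) by (simp add: cyc_edges_def)
    then show ?thesis using pts_insert[OF g(2), of "path_edges vs"] by simp
  qed
  then have "path_image (g +++ h) = pts G (cyc_edges vs)" using g h by (simp add: path_image_join)
  then show ?thesis using that h s by blast
qed

lemma loop_of_cycle:
  assumes vs: "distinct vs" "3 \<le> length vs" "cyc_edges vs \<subseteq> ends2 G"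
  obtains c where "simple_path c" "pathfinish c = pathstart c" "path_image c = pts G (cyc_edges vs)"
proof -
  have ne: "vs \<noteq> []" using vs(2) by auto
  have "{last vs, hd vs} \<in> ends2 G" using vs(3) ne by (auto simp: cyc_edges_def)
  then obtain e where e: "e \<in> edges G" "e \<inter> verts G = {last vs, hd vs}" unfolding ends2_def by auto
  obtain g where g: "arc g" "path_image g = e" "pathstart g = last vs" "pathfinish g = hd vs" using edge_arc[OF e] by blast
  obtain h where h: "arc h" "pathstart h = hd vs" "pathfinish h = last vs"
    "simple_path (g +++ h)" "path_image (g +++ h) = pts G (cyc_edges vs)"
    using loop_through_edge[OF vs g(1)] g e by metis
  then show ?thesis using that[of "g +++ h"] g by simp
qed

lemma Jordan:
  assumes vs: "distinct vs" "3 \<le> length vs" "cyc_edges vs \<subseteq> ends2 G"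
  defines "J \<equiv> pts G (cyc_edges vs)"
  shows "open (inside J)" "connected (inside J)" "open (outside J)" "connected (outside J)" "bounded (inside J)"
    "\<not> bounded (outside J)" "frontier (inside J) = J" "frontier (outside J) = J"
proof -
  obtain c where c: "simple_path c" "pathfinish c = pathstart c" "path_image c = J" using loop_of_cycle[OF vs] J_def by blast
  note j = Jordan_inside_outside[OF c(1,2), unfolded c(3)]
  show "open (inside J)" "connected (inside J)" "open (outside J)" "connected (outside J)" "bounded (inside J)"
    "\<not> bounded (outside J)" "frontier (inside J) = J" "frontier (outside J) = J" using j by blast+
qed

end

section \<open>Faces of near-triangulations\<close>

locale ntri =
  fixes G :: pgraph
  assumes nt: "near_triangulation G"

sublocale ntri \<subseteq> plane G
  by unfold_locales (use nt in \<open>simp add: near_triangulation_def\<close>)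

context ntri begin

lemma outer_is_face: "outer_face G \<in> faces G" "\<not> bounded (outer_face G)"
  using outer_face_iff[OF pg, of "outer_face G"] by simp_all

lemma face_cycle:
  assumes "f \<in> faces G"
  obtains vs where "distinct vs" "3 \<le> length vs" "cyc_edges vs \<subseteq> ends2 G" "frontier f = pts G (cyc_edges vs)"
    "f \<noteq> outer_face G \<longrightarrow> length vs = 3"
proof -
  have "\<exists>vs. bounded_by_cycle G f vs \<and> (f \<noteq> outer_face G \<longrightarrow> length vs = 3)"
    using nt assms unfolding near_triangulation_def internal_faces_def by (cases "f = outer_face G") auto
  then obtain vs where vs: "bounded_by_cycle G f vs" "f \<noteq> outer_face G \<longrightarrow> length vs = 3" by blast
  have c: "3 \<le> length vs" "distinct vs" "cyc_edges vs \<subseteq> ends2 G" "frontier f = \<Union>(cycle_edges G vs)"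
    using vs(1) unfolding bounded_by_cycle_def is_cycle_cyc by auto
  have "vs \<noteq> []" using c(1) by auto
  then show ?thesis using that[of vs] c vs(2) cycle_edges_cyc[of vs G] by auto
qed

lemma edge_in_pts: "e \<in> edges G \<Longrightarrow> e \<subseteq> pts G A \<longleftrightarrow> e \<inter> verts G \<in> A"
proof -
  assume e: "e \<in> edges G"
  obtain p where p: "p \<in> e" "p \<notin> verts G" using edge_interior_nonempty[OF e] by blast
  show ?thesis
  proof
    assume "e \<subseteq> pts G A"
    then have "p \<in> pts G A" using p(1) by blast
    then show "e \<inter> verts G \<in> A" using pts_edge_iff[OF e p] by blast
  qed (use e in \<open>auto simp: pts_def\<close>)
qed

lemma face_boundary_pts:
  assumes "frontier f = pts G A" "A \<subseteq> ends2 G" shows "face_boundary G f = A"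
proof -
  have "face_boundary G f = {e \<inter> verts G |e. e \<in> edges G \<and> e \<inter> verts G \<in> A}"
    unfolding face_boundary_def assms(1) using edge_in_pts by blast
  also have "\<dots> = A" using assms(2) unfolding ends2_def by auto
  finally show ?thesis .
qed

lemma frontier_face:
  assumes "f \<in> faces G" shows "frontier f = pts G (face_boundary G f)"
proof -
  obtain vs where "cyc_edges vs \<subseteq> ends2 G" "frontier f = pts G (cyc_edges vs)" using face_cycle[OF assms] by metis
  then show ?thesis using face_boundary_pts by simp
qed

lemma edge_frontier_iff: "f \<in> faces G \<Longrightarrow> e \<in> edges G \<Longrightarrow> e \<subseteq> frontier f \<longleftrightarrow> e \<inter> verts G \<in> face_boundary G f"
  using edge_in_pts frontier_face by simp

lemma face_frontier_disj: "f \<in> faces G \<Longrightarrow> f \<inter> frontier f = {}"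
  using faceD(1) by (auto simp: frontier_def interior_open)

lemma face_side:
  assumes "f \<in> faces G" "f \<inter> W \<noteq> {}" "frontier W \<subseteq> support G" shows "f \<subseteq> W"
proof (rule ccontr)
  assume "\<not> f \<subseteq> W"
  then have "f \<inter> frontier W \<noteq> {}" using connected_Int_frontier[OF faceD(2)[OF assms(1)] assms(2)] by blast
  then show False using faceD(4)[OF assms(1)] assms(3) by blast
qed

lemma face_is_side:
  assumes f: "f \<in> faces G" and W: "connected W" "W \<inter> frontier f = {}" "f \<inter> W \<noteq> {}" "frontier W \<subseteq> support G"
  shows "f = W"
proof
  show "f \<subseteq> W" by (rule face_side[OF f W(3,4)])
  show "W \<subseteq> f"
  proof (rule ccontr)
    assume "\<not> W \<subseteq> f"
    then show False using connected_Int_frontier[OF W(1), of f] W(2,3) by blast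
  qed
qed

text \<open>The frontier of a face is a Jordan curve. The face is connected and misses it, and
  neither side of the curve can leave the face without crossing it; so the face is a whole side, and
  boundedness tells which one.\<close>

lemma face_inside_outside:
  assumes f: "f \<in> faces G"
  shows "f = (if f = outer_face G then outside (frontier f) else inside (frontier f))"
proof -
  obtain vs where vs: "distinct vs" "3 \<le> length vs" "cyc_edges vs \<subseteq> ends2 G" "frontier f = pts G (cyc_edges vs)"
    using face_cycle[OF f] by metis
  note J = Jordan[OF vs(1-3), folded vs(4)]
  have s: "frontier f \<subseteq> support G" unfolding vs(4) by (rule pts_support)
  have d: "inside (frontier f) \<inter> frontier f = {}" "outside (frontier f) \<inter> frontier f = {}"
    using inside_no_overlap outside_no_overlap by blast+
  have "f \<inter> inside (frontier f) \<noteq> {} \<or> f \<inter> outside (frontier f) \<noteq> {}"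
    using face_frontier_disj[OF f] faceD(3)[OF f] inside_Un_outside[of "frontier f"] by blast
  then have "f = inside (frontier f) \<or> f = outside (frontier f)"
    using face_is_side[OF f J(2) d(1)] face_is_side[OF f J(4) d(2)] J(7,8) s by auto
  moreover have "f = outer_face G \<longleftrightarrow> \<not> bounded f" using outer_face_iff[OF pg, of f] f by simp
  ultimately show ?thesis using J(5,6) by (metis (full_types))
qed

text \<open>An internal face is the inside of a curve determined by a list of three vertices, and
  there are finitely many such lists.\<close>

lemma fin_internal: "finite (internal_faces G)"
proof -
  have "internal_faces G \<subseteq> (\<lambda>vs. inside (pts G (cyc_edges vs))) ` {vs. set vs \<subseteq> verts G \<and> length vs = 3}"
  proof
    fix f assume "f \<in> internal_faces G"
    then have f: "f \<in> faces G" "f \<noteq> outer_face G" by (auto simp: internal_faces_def)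
    obtain vs where vs: "distinct vs" "3 \<le> length vs" "cyc_edges vs \<subseteq> ends2 G" "frontier f = pts G (cyc_edges vs)" "length vs = 3"
      using face_cycle[OF f(1)] f(2) by metis
    have "set vs = \<Union>(cyc_edges vs)" using circuit_cyc(2)[OF vs(1,2)] by simp
    then have "set vs \<subseteq> verts G" using vs(3) ends2_card by blast
    moreover have "f = inside (pts G (cyc_edges vs))" using face_inside_outside[OF f(1)] f(2) vs(4) by simp
    ultimately show "f \<in> (\<lambda>vs. inside (pts G (cyc_edges vs))) ` {vs. set vs \<subseteq> verts G \<and> length vs = 3}" using vs(5) by blast
  qed
  then show ?thesis using finite_lists_length_eq[OF fin_verts] finite_surj by blast
qed

lemma faces_eq: "faces G = insert (outer_face G) (internal_faces G)"
  using outer_is_face(1) by (auto simp: internal_faces_def)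

lemma fin_faces: "finite (faces G)" unfolding faces_eq using fin_internal by simp

text \<open>The support has empty interior, so the points of \<open>W\<close> off the support are
  dense in \<open>W\<close>. They are covered by finitely many faces, whose closures form a closed
  set.\<close>

lemma closure_face:
  assumes W: "open W" "p \<in> closure W" shows "\<exists>f\<in>faces G. p \<in> closure f \<and> f \<inter> W \<noteq> {}"
proof -
  have "p \<in> closure (W - support G)"
  proof (rule ccontr)
    assume "p \<notin> closure (W - support G)"
    then have o: "open (W \<inter> - closure (W - support G))" and "p \<in> - closure (W - support G)" using W(1) by auto
    then have "W \<inter> - closure (W - support G) \<noteq> {}"
      using W(2) open_Int_closure_eq_empty[of "- closure (W - support G)" W] by blast
    moreover have "W \<inter> - closure (W - support G) \<subseteq> support G" using closure_subset[of "W - support G"] by blast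
    ultimately show False using interior_maximal[OF _ o] support_empty_interior by blast
  qed
  also have "closure (W - support G) \<subseteq> \<Union>(closure ` {f\<in>faces G. f \<inter> W \<noteq> {}})"
  proof (rule closure_minimal)
    show "W - support G \<subseteq> \<Union>(closure ` {f\<in>faces G. f \<inter> W \<noteq> {}})"
    proof
      fix z assume z: "z \<in> W - support G"
      then obtain f where "f \<in> faces G" "z \<in> f" using in_some_face by blast
      then show "z \<in> \<Union>(closure ` {f\<in>faces G. f \<inter> W \<noteq> {}})" using z closure_subset[of f] by blast
    qed
    show "closed (\<Union>(closure ` {f\<in>faces G. f \<inter> W \<noteq> {}}))" using fin_faces by (intro closed_Union) auto
  qed
  finally show ?thesis by blast
qed

lemma incident:
  assumes f: "f \<in> faces G" and e: "e \<in> edges G" "p \<in> e" "p \<notin> verts G"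
  shows "p \<in> closure f \<longleftrightarrow> e \<inter> verts G \<in> face_boundary G f"
proof -
  have "p \<notin> f" using faceD(4)[OF f] e by (auto simp: support_def)
  then have "p \<in> closure f \<longleftrightarrow> p \<in> frontier f" using faceD(1)[OF f] by (simp add: frontier_def interior_open)
  also have "\<dots> \<longleftrightarrow> e \<inter> verts G \<in> face_boundary G f" unfolding frontier_face[OF f] by (rule pts_edge_iff[OF e])
  finally show ?thesis .
qed

text \<open>Near an inner point of \<open>e\<close>, the winding number of the closed curve formed by the two remaining arcs
  of the boundaries of \<open>f1\<close> and \<open>f2\<close> is constant. It is nonzero on \<open>f1\<close>, but it would vanish on a
  third face.\<close>

lemma two_internal:
  assumes f: "f1 \<in> internal_faces G" "f2 \<in> internal_faces G" "f1 \<noteq> f2" "f3 \<in> faces G"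
    and e: "e \<in> edges G" and inc: "\<And>f. f \<in> {f1,f2,f3} \<Longrightarrow> e \<inter> verts G \<in> face_boundary G f"
  shows "f3 = f1 \<or> f3 = f2"
proof (rule ccontr)
  assume n3: "\<not> ?thesis"
  obtain p where p: "p \<in> e" "p \<notin> verts G" using edge_interior_nonempty[OF e] by blast
  obtain a b where ab: "a \<noteq> b" "e \<inter> verts G = {a,b}" using edge_ends[OF e] by blast
  obtain g where g: "arc g" "path_image g = e" "pathstart g = a" "pathfinish g = b" using edge_arc[OF e ab(2)] by blast
  have ex: "\<exists>h. arc h \<and> pathstart h = b \<and> pathfinish h = a \<and> p \<notin> path_image h \<and>
      simple_path (g +++ h) \<and> f = inside (path_image (g +++ h)) \<and> frontier f = path_image (g +++ h)"
    if fi: "f \<in> internal_faces G" "e \<inter> verts G \<in> face_boundary G f" for f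
  proof -
    have f: "f \<in> faces G" "f \<noteq> outer_face G" using fi by (auto simp: internal_faces_def)
    obtain vs where vs: "distinct vs" "3 \<le> length vs" "cyc_edges vs \<subseteq> ends2 G" "frontier f = pts G (cyc_edges vs)"
      using face_cycle[OF f(1)] by metis
    have "{a,b} \<in> cyc_edges vs" using fi(2) face_boundary_pts[OF vs(4,3)] ab(2) by simp
    then obtain ws where ws: "distinct ws" "length ws = length vs" "cyc_edges ws = cyc_edges vs" "last ws = a" "hd ws = b" "ws \<noteq> []"
      using cyc_edges_closing[OF _ vs(1) ab(1)] by blast
    obtain h where h: "arc h" "pathstart h = b" "pathfinish h = a" "path_image h = pts G (path_edges ws)"
      "simple_path (g +++ h)" "path_image (g +++ h) = pts G (cyc_edges ws)"
      using loop_through_edge[of ws g] ws vs g e ab(2) by metis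
    have "pathfinish g = pathstart h" using h g by simp
    then have "path_image g \<inter> path_image h \<subseteq> {pathstart g, pathstart h}" using simple_path_joinE[OF h(5)] by metis
    then have dis: "path_image g \<inter> path_image h \<subseteq> {a,b}" using g h by simp
    have "p \<notin> path_image h"
    proof
      assume "p \<in> path_image h"
      then have "p \<in> {a,b}" using dis p(1) g(2) by blast
      then show False using p(2) ab(2) by blast
    qed
    moreover have "f = inside (path_image (g +++ h))" using face_inside_outside[OF f(1)] f(2) vs(4) h(6) ws(3) by simp
    ultimately show ?thesis using h vs(4) ws(3) by metis
  qed
  obtain h1 where h1: "arc h1" "pathstart h1 = b" "pathfinish h1 = a" "p \<notin> path_image h1"
      "simple_path (g +++ h1)" "f1 = inside (path_image (g +++ h1))" "frontier f1 = path_image (g +++ h1)"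
    using ex[OF f(1)] inc by blast
  obtain h2 where h2: "arc h2" "pathstart h2 = b" "pathfinish h2 = a" "p \<notin> path_image h2"
      "simple_path (g +++ h2)" "f2 = inside (path_image (g +++ h2))" "frontier f2 = path_image (g +++ h2)"
    using ex[OF f(2)] inc by blast
  let ?P = "path_image h1 \<union> path_image h2"
  have "closed ?P" using h1 h2 by (intro closed_Un closed_path_image arc_imp_path)
  then have "open (- ?P)" by (rule open_Compl)
  moreover have "p \<in> - ?P" using h1(4) h2(4) by simp
  ultimately obtain r where r: "0 < r" "ball p r \<subseteq> - ?P" by (metis open_contains_ball)
  \<comment> \<open>The common arc \<open>g\<close> is left out, so this curve avoids a ball around
    \<open>p\<close>. Off \<open>e\<close>, its winding number in the ball is the difference of
    those of the two face boundaries.\<close>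
  let ?\<gamma> = "reversepath h1 +++ h2"
  have \<gamma>: "path ?\<gamma>" "pathfinish ?\<gamma> = pathstart ?\<gamma>" "path_image ?\<gamma> = ?P"
    using h1 h2 arc_imp_path by (auto simp: path_image_join)
  have wn: "winding_number ?\<gamma> z = winding_number (g +++ h2) z - winding_number (g +++ h1) z"
    if z: "z \<in> ball p r" "z \<notin> e" for z
  proof -
    have zP: "z \<notin> path_image h1" "z \<notin> path_image h2" "z \<notin> path_image g" using r(2) z g(2) by auto
    have "winding_number ?\<gamma> z = winding_number (reversepath h1) z + winding_number h2 z"
      using zP h1 h2 by (intro winding_number_join) (auto intro: arc_imp_path)
    moreover have "winding_number (reversepath h1) z = - winding_number h1 z"
      using zP h1 by (intro winding_number_reversepath) (auto intro: arc_imp_path)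
    moreover have "winding_number (g +++ h1) z = winding_number g z + winding_number h1 z"
      using zP h1 g by (intro winding_number_join) (auto intro: arc_imp_path)
    moreover have "winding_number (g +++ h2) z = winding_number g z + winding_number h2 z"
      using zP h2 g by (intro winding_number_join) (auto intro: arc_imp_path)
    ultimately show ?thesis by simp
  qed
  have zero: "winding_number (g +++ h) z = 0"
    if "simple_path (g +++ h)" "pathstart h = b" "pathfinish h = a" "z \<notin> inside (path_image (g +++ h))" "z \<notin> path_image (g +++ h)" for h z
  proof (rule winding_number_zero_in_outside)
    show "path (g +++ h)" using that simple_path_imp_path by blast
    show "pathfinish (g +++ h) = pathstart (g +++ h)" using that g by simp
    show "z \<in> outside (path_image (g +++ h))" using that inside_Un_outside[of "path_image (g +++ h)"] by blast
  qed
  have near: "\<exists>z\<in>ball p r. z \<in> f" if "f \<in> faces G" "e \<inter> verts G \<in> face_boundary G f" for f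
  proof -
    have "p \<in> closure f" using incident[OF that(1) e p] that(2) by simp
    then show ?thesis using r(1) by (metis closure_approachable dist_commute mem_ball)
  qed
  have fs: "f1 \<in> faces G" "f2 \<in> faces G" using f by (auto simp: internal_faces_def)
  have off: "z \<notin> path_image (g +++ h1)" "z \<notin> path_image (g +++ h2)" "z \<notin> e" if "z \<in> f'" "f' \<in> faces G" for z f'
  proof -
    have "z \<notin> support G" using faceD(4)[OF that(2)] that(1) by blast
    then show "z \<notin> path_image (g +++ h1)" "z \<notin> path_image (g +++ h2)" "z \<notin> e"
      using frontier_face[OF fs(1)] frontier_face[OF fs(2)] h1(7) h2(7) pts_support e
      unfolding support_def by (metis subsetD, metis subsetD, blast)
  qed
  obtain z1 where z1: "z1 \<in> ball p r" "z1 \<in> f1" using near[OF fs(1)] inc by blast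
  have "z1 \<notin> f2" using face_eq[OF fs z1(2)] f(3) by blast
  then have "winding_number (g +++ h2) z1 = 0" using zero[OF h2(5,2,3)] off[OF z1(2) fs(1)] h2(6) by blast
  moreover have "winding_number (g +++ h1) z1 \<noteq> 0"
    using simple_closed_path_norm_winding_number_inside[OF h1(5)] z1(2) h1(6) by (metis norm_zero zero_neq_one)
  ultimately have A: "winding_number ?\<gamma> z1 \<noteq> 0" using wn[OF z1(1)] off[OF z1(2) fs(1)] by simp
  obtain z3 where z3: "z3 \<in> ball p r" "z3 \<in> f3" using near[OF f(4)] inc by blast
  have "z3 \<notin> f1" "z3 \<notin> f2" using face_eq[OF f(4) fs(1) z3(2)] face_eq[OF f(4) fs(2) z3(2)] n3 by blast+
  then have "winding_number (g +++ h1) z3 = 0" "winding_number (g +++ h2) z3 = 0"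
    using zero[OF h1(5,2,3)] zero[OF h2(5,2,3)] off[OF z3(2) f(4)] h1(6) h2(6) by blast+
  then have B: "winding_number ?\<gamma> z3 = 0" using wn[OF z3(1)] off[OF z3(2) f(4)] by simp
  have "winding_number ?\<gamma> z1 = winding_number ?\<gamma> z3"
    by (rule winding_number_eq[OF \<gamma>(1,2) z1(1) z3(1)]) (use r(2) \<gamma>(3) in auto)
  then show False using A B by simp
qed

text \<open>One face at the edge exists by density, and a second one on the other side of the
  boundary curve of the first. Three faces would include two internal ones, against
  \<open>two_internal\<close>.\<close>

lemma two_faces:
  assumes e: "e \<in> edges G"
  obtains f f' where "f \<noteq> f'" "{f\<in>faces G. e \<inter> verts G \<in> face_boundary G f} = {f,f'}"
proof -
  let ?A = "{f\<in>faces G. e \<inter> verts G \<in> face_boundary G f}"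
  obtain p where p: "p \<in> e" "p \<notin> verts G" using edge_interior_nonempty[OF e] by blast
  obtain f where f: "f \<in> faces G" "p \<in> closure f" using closure_face[of UNIV p] by auto
  then have fA: "f \<in> ?A" using incident[OF f(1) e p] by simp
  obtain vs where vs: "distinct vs" "3 \<le> length vs" "cyc_edges vs \<subseteq> ends2 G" "frontier f = pts G (cyc_edges vs)"
    using face_cycle[OF f(1)] by metis
  note J = Jordan[OF vs(1-3), folded vs(4)]
  define W where "W = (if f = outer_face G then inside (frontier f) else outside (frontier f))"
  have W: "open W" "frontier W = frontier f" "f \<inter> W = {}"
  proof -
    show "open W" "frontier W = frontier f" using J unfolding W_def by metis+
    show "f \<inter> W = {}"
    proof (cases "f = outer_face G")
      case True
      then have "f = outside (frontier f)" using face_inside_outside[OF f(1)] by simp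
      then show ?thesis using inside_Int_outside[of "frontier f"] True unfolding W_def by auto
    next
      case False
      then have "f = inside (frontier f)" using face_inside_outside[OF f(1)] by simp
      then show ?thesis using inside_Int_outside[of "frontier f"] False unfolding W_def by auto
    qed
  qed
  have "p \<in> frontier f" using fA p(1) edge_frontier_iff[OF f(1) e] by blast
  then have "p \<in> closure W" using W(2) by (metis DiffD1 frontier_def)
  then obtain f' where f': "f' \<in> faces G" "p \<in> closure f'" "f' \<inter> W \<noteq> {}" using closure_face[OF W(1)] by blast
  have ne: "f \<noteq> f'" using f'(3) W(3) by blast
  have f'A: "f' \<in> ?A" using incident[OF f'(1) e p] f' by simp
  have "\<exists>f f'. f \<noteq> f' \<and> ?A = {f,f'}"
  proof (cases "\<exists>f1 f2. f1 \<in> ?A \<and> f2 \<in> ?A \<and> f1 \<noteq> f2 \<and> f1 \<noteq> outer_face G \<and> f2 \<noteq> outer_face G")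
    case True
    then obtain f1 f2 where f12: "f1 \<in> ?A" "f2 \<in> ?A" "f1 \<noteq> f2" "f1 \<in> internal_faces G" "f2 \<in> internal_faces G"
      by (auto simp: internal_faces_def)
    have "f3 = f1 \<or> f3 = f2" if "f3 \<in> ?A" for f3
      by (rule two_internal[OF f12(4,5,3) _ e]) (use that f12 in auto)
    then have "?A = {f1,f2}" using f12 by blast
    then show ?thesis using f12(3) by blast
  next
    case False
    then have "?A = {f,f'}" using fA f'A ne by blast
    then show ?thesis using ne by blast
  qed
  then show ?thesis using that by blast
qed

end

section \<open>The triangulated disc of a near-triangulation\<close>

context disc begin

text \<open>Edges at \<open>v\<close> against triangles at \<open>v\<close>: each triangle has two
  of the edges, and around an inner vertex each edge has two of the triangles. This turns vertex
  degree into the triangle count of \<open>gauss_bonnet\<close>.\<close>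

lemma deg_eq_neighbours:
  assumes v: "v \<notin> \<Union>(bd F)" shows "card {u. {v,u} \<in> sides F} = deg F v"
proof -
  let ?N = "{u. {v,u} \<in> sides F}" and ?S = "{t\<in>F. v \<in> t}"
  have "?N \<subseteq> \<Union>F" using sides_vert(2) by blast
  then have fN: "finite ?N" using finV finite_subset by blast
  have "(\<Sum>u\<in>?N. card {t\<in>?S. u \<in> t}) = (\<Sum>t\<in>?S. card {u\<in>?N. u \<in> t})"
    by (rule sum_multicount_gen[symmetric]) (use fN fin in auto)
  also have "\<dots> = (\<Sum>t\<in>?S. 2)"
  proof (rule sum.cong)
    fix t assume t: "t \<in> ?S"
    then obtain a b where ab: "t = {v,a,b}" "v \<noteq> a" "v \<noteq> b" "a \<noteq> b"
      using card3[of t] by (auto simp: card_3_iff)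
    have "{v,a} \<in> sides F" "{v,b} \<in> sides F" using sidesI[of t] t ab by auto
    moreover have "{v,v} \<notin> sides F" using sides_vert(3)[of v v] by blast
    ultimately have "{u\<in>?N. u \<in> t} = {a,b}" using ab(1) by auto
    then show "card {u\<in>?N. u \<in> t} = 2" using ab by simp
  qed simp
  also have "(\<Sum>u\<in>?N. card {t\<in>?S. u \<in> t}) = (\<Sum>u\<in>?N. 2)"
  proof (rule sum.cong)
    fix u assume u: "u \<in> ?N"
    then have "{v,u} \<notin> bd F" using v by blast
    moreover have "{v,u} \<in> sides F" using u by simp
    ultimately have "card {t\<in>F. {v,u} \<subseteq> t} = 2" using ncof[of "{v,u}"] by (simp only: if_False)
    moreover have "{t\<in>F. {v,u} \<subseteq> t} = {t\<in>?S. u \<in> t}" by auto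
    ultimately show "card {t\<in>?S. u \<in> t} = 2" by simp
  qed simp
  finally show ?thesis by (simp add: deg_def)
qed

end

section \<open>From internal faces to vertex triples\<close>

context plane begin

lemma verts_pts: "A \<subseteq> ends2 G \<Longrightarrow> verts G \<inter> pts G A = \<Union>A"
  unfolding pts_def ends2_def by blast

end

context ntri begin

definition corners :: "complex set \<Rightarrow> complex set" where "corners f = verts G \<inter> frontier f"

definition triangles :: "complex set set" where "triangles = corners ` internal_faces G"

lemma internalD: "f \<in> internal_faces G \<Longrightarrow> f \<in> faces G \<and> f \<noteq> outer_face G"
  by (simp add: internal_faces_def)

lemma face_boundary_ends2: "face_boundary G f \<subseteq> ends2 G"
  unfolding face_boundary_def ends2_def by blast

lemma corners_eq: "f \<in> faces G \<Longrightarrow> corners f = \<Union>(face_boundary G f)"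
  unfolding corners_def using frontier_face verts_pts[OF face_boundary_ends2] by simp

lemma internal_triangle:
  assumes "f \<in> internal_faces G"
  shows "face_boundary G f = {d. card d = 2 \<and> d \<subseteq> corners f}" "card (corners f) = 3"
proof -
  have f: "f \<in> faces G" "f \<noteq> outer_face G" using internalD[OF assms] by auto
  obtain vs where vs: "distinct vs" "3 \<le> length vs" "cyc_edges vs \<subseteq> ends2 G" "frontier f = pts G (cyc_edges vs)" "length vs = 3"
    using face_cycle[OF f(1)] f(2) by metis
  obtain a b c where abc: "vs = [a,b,c]" using vs(5) by (auto simp: numeral_3_eq_3 length_Suc_conv)
  have fb: "face_boundary G f = cyc_edges vs" using face_boundary_pts vs(3,4) by blast
  then have "corners f = set vs" using corners_eq[OF f(1)] circuit_cyc(2)[OF vs(1,2)] by simp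
  then have t: "corners f = {a,b,c}" using abc by simp
  have ne: "a \<noteq> b" "b \<noteq> c" "a \<noteq> c" using vs(1) abc by auto
  show "card (corners f) = 3" using t ne by simp
  show "face_boundary G f = {d. card d = 2 \<and> d \<subseteq> corners f}"
    unfolding t pairs_triangle[OF ne] fb abc by (auto simp: cyc_edges_def)
qed

text \<open>Two internal faces with the same corners have the same boundary curve and are both its
  inside. So replacing faces by vertex triples loses nothing.\<close>

lemma inj_corners: "inj_on corners (internal_faces G)"
proof (rule inj_onI)
  fix f f' assume f: "f \<in> internal_faces G" "f' \<in> internal_faces G" "corners f = corners f'"
  then have "face_boundary G f = face_boundary G f'" using internal_triangle(1) by simp
  then have "frontier f = frontier f'" using frontier_face internalD f by simp
  then show "f = f'" using face_inside_outside[of f] face_inside_outside[of f'] internalD[OF f(1)] internalD[OF f(2)] by simp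
qed

lemma card_corners:
  assumes "S \<subseteq> internal_faces G" "card d = 2"
  shows "card {t \<in> corners ` S. d \<subseteq> t} = card {f\<in>S. d \<in> face_boundary G f}"
proof -
  have "{t \<in> corners ` S. d \<subseteq> t} = corners ` {f\<in>S. d \<in> face_boundary G f}"
    using internal_triangle(1) assms by auto
  moreover have "inj_on corners {f\<in>S. d \<in> face_boundary G f}"
    by (rule inj_on_subset[OF inj_corners]) (use assms in auto)
  ultimately show ?thesis by (simp add: card_image)
qed

lemma bd_corners:
  assumes "S \<subseteq> internal_faces G"
  shows "bd (corners ` S) = {d. card d = 2 \<and> odd (card {f\<in>S. d \<in> face_boundary G f})}"
  unfolding bd_def using card_corners[OF assms] by auto

lemma internal_count:
  assumes e: "e \<in> edges G"
  shows "card {f\<in>internal_faces G. e \<inter> verts G \<in> face_boundary G f} =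
    (if e \<inter> verts G \<in> face_boundary G (outer_face G) then 1 else 2)"
proof -
  obtain f f' where f: "f \<noteq> f'" "{f\<in>faces G. e \<inter> verts G \<in> face_boundary G f} = {f,f'}" using two_faces[OF e] by blast
  have eq: "{f\<in>internal_faces G. e \<inter> verts G \<in> face_boundary G f} = {f,f'} - {outer_face G}"
    unfolding f(2)[symmetric] internal_faces_def by blast
  show ?thesis
  proof (cases "e \<inter> verts G \<in> face_boundary G (outer_face G)")
    case True
    then have "outer_face G \<in> {f,f'}" using f(2) outer_is_face(1) by blast
    then show ?thesis unfolding eq using True f(1) by (simp add: card_Diff_singleton)
  next
    case False
    then have "outer_face G \<notin> {f,f'}" using f(2) by blast
    then show ?thesis unfolding eq using False f(1) by simp
  qed
qed

lemma no_edge_no_face: "d \<notin> ends2 G \<Longrightarrow> card {f\<in>S. d \<in> face_boundary G f} = 0"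
  using face_boundary_ends2 by (metis (no_types, lifting) card.empty empty_Collect_eq subsetD)

lemma bd_triangles: "bd triangles = face_boundary G (outer_face G)"
proof -
  have "d \<in> bd triangles \<longleftrightarrow> d \<in> face_boundary G (outer_face G)" for d
  proof (cases "d \<in> ends2 G")
    case True
    then obtain e where e: "e \<in> edges G" "d = e \<inter> verts G" unfolding ends2_def by blast
    then show ?thesis unfolding triangles_def bd_corners[OF subset_refl] using internal_count[OF e(1)] edge_card2[OF e(1)] by auto
  next
    case False
    then have "d \<notin> face_boundary G (outer_face G)" using face_boundary_ends2 by blast
    then show ?thesis
      unfolding triangles_def bd_corners[OF subset_refl] mem_Collect_eq no_edge_no_face[OF False] by simp
  qed
  then show ?thesis by blast
qed

lemma outer_cycle:
  obtains vs where "distinct vs" "3 \<le> length vs" "face_boundary G (outer_face G) = cyc_edges vs" "boundary_verts G = set vs"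
proof -
  obtain vs where vs: "distinct vs" "3 \<le> length vs" "cyc_edges vs \<subseteq> ends2 G" "frontier (outer_face G) = pts G (cyc_edges vs)"
    using face_cycle[OF outer_is_face(1)] by metis
  have "boundary_verts G = \<Union>(cyc_edges vs)" unfolding boundary_verts_def vs(4) by (rule verts_pts[OF vs(3)])
  then show ?thesis using that[OF vs(1,2)] face_boundary_pts[OF vs(4,3)] circuit_cyc(2)[OF vs(1,2)] by simp
qed

lemma sides_triangles: "sides triangles = ends2 G"
proof
  show "sides triangles \<subseteq> ends2 G"
  proof
    fix d assume "d \<in> sides triangles"
    then obtain f where "card d = 2" "f \<in> internal_faces G" "d \<subseteq> corners f" unfolding sides_def triangles_def by blast
    then have "d \<in> face_boundary G f" using internal_triangle(1) by simp
    then show "d \<in> ends2 G" using face_boundary_ends2 by blast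
  qed
  show "ends2 G \<subseteq> sides triangles"
  proof
    fix d assume "d \<in> ends2 G"
    then obtain e where e: "e \<in> edges G" "d = e \<inter> verts G" unfolding ends2_def by blast
    have "card {f\<in>internal_faces G. d \<in> face_boundary G f} \<noteq> 0" using internal_count[OF e(1)] e(2) by simp
    then have "{f\<in>internal_faces G. d \<in> face_boundary G f} \<noteq> {}" by (metis card.empty)
    then obtain f where "f \<in> internal_faces G" "d \<in> face_boundary G f" by blast
    then show "d \<in> sides triangles" using internal_triangle(1) unfolding sides_def triangles_def by blast
  qed
qed

text \<open>Each vertex is in the closure of some face, hence on a face boundary that is a cycle of
  edges. In particular there are no isolated vertices.\<close>

lemma Un_triangles: "\<Union>triangles = verts G"
proof
  show "\<Union>triangles \<subseteq> verts G" unfolding triangles_def corners_def by blast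
  show "verts G \<subseteq> \<Union>triangles"
  proof
    fix v assume v: "v \<in> verts G"
    obtain f where f: "f \<in> faces G" "v \<in> closure f" using closure_face[of UNIV v] by auto
    have "v \<notin> f" using faceD(4)[OF f(1)] v by (auto simp: support_def)
    then have "v \<in> frontier f" using f faceD(1)[OF f(1)] by (simp add: frontier_def interior_open)
    then have "v \<in> \<Union>(face_boundary G f)" using corners_eq[OF f(1)] v by (auto simp: corners_def)
    then obtain d where "d \<in> sides triangles" "v \<in> d" unfolding sides_triangles using face_boundary_ends2 by blast
    then show "v \<in> \<Union>triangles" unfolding sides_def by blast
  qed
qed

text \<open>Without boundary edges, the closure of the union of these faces is open away from the vertices,
  and the plane minus finitely many points is connected.\<close>

lemma bd_corners_inj:
  assumes S: "S \<subseteq> internal_faces G" "bd (corners ` S) = {}" shows "S = {}"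
proof (rule ccontr)
  assume ne: "S \<noteq> {}"
  have SF: "S \<subseteq> faces G" using S(1) internalD by blast
  have finS: "finite S" using SF fin_faces finite_subset by blast
  define K where "K = \<Union>(closure ` S)"
  have clK: "closed K" unfolding K_def using finS by (intro closed_Union) auto
  \<comment> \<open>An edge has exactly two faces, and without boundary edges \<open>S\<close>
    contains an even number of them: both or neither.\<close>
  have both: "f' \<in> S" if e: "e \<in> edges G" and f: "f \<in> S" "e \<inter> verts G \<in> face_boundary G f"
    and f': "f' \<in> faces G" "e \<inter> verts G \<in> face_boundary G f'" for e f f'
  proof -
    let ?A = "{f\<in>faces G. e \<inter> verts G \<in> face_boundary G f}" and ?B = "{f\<in>S. e \<inter> verts G \<in> face_boundary G f}"
    have "card ?A = 2" using two_faces[OF e] by (metis card_2_iff)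
    have sub: "?B \<subseteq> ?A" using SF by blast
    have fA: "finite ?A" using fin_faces by simp
    have "e \<inter> verts G \<notin> bd (corners ` S)" using S(2) by simp
    then have "even (card ?B)" unfolding bd_corners[OF S(1)] using edge_card2[OF e] by simp
    moreover have "card ?B \<noteq> 0" using f finS by auto
    moreover have "card ?B \<le> 2" using card_mono[OF fA sub] \<open>card ?A = 2\<close> by simp
    ultimately have "card ?B = 2" by presburger
    then have "?B = ?A" using card_subset_eq[OF fA sub] \<open>card ?A = 2\<close> by simp
    then show "f' \<in> S" using f' by blast
  qed
  have loc: "\<exists>U. open U \<and> p \<in> U \<and> U \<inter> - verts G \<subseteq> K" if p: "p \<in> K" "p \<notin> verts G" for p
  proof (cases "p \<in> support G")
    case False
    obtain f where f: "f \<in> S" "p \<in> closure f" using p(1) unfolding K_def by blast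
    obtain f' where f': "f' \<in> faces G" "p \<in> f'" using in_some_face[OF False] by blast
    then have "f' \<inter> f \<noteq> {}" using open_Int_closure_eq_empty[OF faceD(1)[OF f'(1)], of f] f(2) by blast
    then have "f' = f" using face_eq[OF f'(1), of f] f(1) SF by blast
    then show ?thesis using f f' faceD(1)[OF f'(1)] closure_subset[of f] unfolding K_def by (intro exI[of _ f']) auto
  next
    case True
    then obtain e where e: "e \<in> edges G" "p \<in> e" using p(2) unfolding support_def by blast
    obtain f where f: "f \<in> S" "p \<in> closure f" using p(1) unfolding K_def by blast
    have fF: "f \<in> faces G" using f SF by blast
    have fe: "e \<inter> verts G \<in> face_boundary G f" using incident[OF fF e p(2)] f(2) by simp
    obtain U where U: "open U" "p \<in> U" "U \<inter> support G \<subseteq> e" "U \<inter> verts G = {}" using edge_near[OF e p(2)] by blast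
    \<comment> \<open>Removing the closures of the finitely many faces that stay away from
      \<open>p\<close> leaves a neighbourhood in which every face has \<open>e\<close> on its
      boundary.\<close>
    define N where "N = {f'\<in>faces G. p \<notin> closure f'}"
    define U' where "U' = U - \<Union>(closure ` N)"
    have "closed (\<Union>(closure ` N))" unfolding N_def using fin_faces by (intro closed_Union) auto
    then have "open U'" unfolding U'_def using U(1) by (rule open_Diff[rotated])
    moreover have "p \<in> U'" unfolding U'_def N_def using U(2) by blast
    moreover have "U' \<inter> - verts G \<subseteq> K"
    proof
      fix z assume z: "z \<in> U' \<inter> - verts G"
      show "z \<in> K"
      proof (cases "z \<in> support G")
        case True
        then have "z \<in> e" using z U(3) unfolding U'_def by blast
        then have "z \<in> closure f" using incident[OF fF e(1)] fe z by blast
        then show ?thesis using f(1) unfolding K_def by blast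
      next
        case False
        then obtain f' where f': "f' \<in> faces G" "z \<in> f'" using in_some_face by blast
        then have "f' \<notin> N" using z closure_subset[of f'] unfolding U'_def by blast
        then have "p \<in> closure f'" using f'(1) unfolding N_def by blast
        then have "f' \<in> S" using both[OF e(1) f(1) fe f'(1)] incident[OF f'(1) e p(2)] by blast
        then show ?thesis using f'(2) closure_subset[of f'] unfolding K_def by blast
      qed
    qed
    ultimately show ?thesis by blast
  qed
  have cV: "connected (- verts G)"
    using path_connected_complement_countable[of "verts G"] fin_verts
    by (intro path_connected_imp_connected) (auto intro: countable_finite)
  let ?T = "K \<inter> - verts G"
  have "openin (top_of_set (- verts G)) ?T"
  proof (rule openin_subopen[THEN iffD2], intro ballI)
    fix p assume p: "p \<in> ?T"
    then obtain U where U: "open U" "p \<in> U" "U \<inter> - verts G \<subseteq> K" using loc by blast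
    have "openin (top_of_set (- verts G)) (- verts G \<inter> U)" using U(1) by (rule openin_open_Int)
    then show "\<exists>T. openin (top_of_set (- verts G)) T \<and> p \<in> T \<and> T \<subseteq> ?T" using U p by blast
  qed
  moreover have "closedin (top_of_set (- verts G)) ?T"
    using closedin_closed_Int[OF clK, of "- verts G"] by (simp add: Int_commute)
  ultimately have "?T = {} \<or> ?T = - verts G" using cV unfolding connected_clopen by blast
  moreover have "?T \<noteq> {}"
  proof -
    obtain f where f: "f \<in> S" using ne by blast
    then have fF: "f \<in> faces G" using SF by blast
    obtain z where "z \<in> f" using faceD(3)[OF fF] by blast
    then have "z \<in> ?T" using f faceD(4)[OF fF] closure_subset[of f] unfolding K_def support_def by blast
    then show ?thesis by blast
  qed
  ultimately have sub: "- verts G \<subseteq> K" by blast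
  \<comment> \<open>The closures of the faces in \<open>S\<close> now cover the plane up to the
    vertices, so the outer face would belong to \<open>S\<close>.\<close>
  obtain z where z: "z \<in> outer_face G" using faceD(3)[OF outer_is_face(1)] by blast
  then have "z \<in> K" using sub faceD(4)[OF outer_is_face(1)] unfolding support_def by blast
  then obtain f where f: "f \<in> S" "z \<in> closure f" unfolding K_def by blast
  then have "outer_face G \<inter> f \<noteq> {}"
    using open_Int_closure_eq_empty[OF faceD(1)[OF outer_is_face(1)], of f] z by blast
  then have "outer_face G = f" using face_eq[OF outer_is_face(1), of f] f(1) SF by blast
  then show False using f(1) S(1) internalD by blast
qed

text \<open>The filling consists of the faces inside the Jordan curve \<open>J\<close>. An edge on
  \<open>J\<close> has one of its two faces on each side, and an edge off \<open>J\<close> has both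
  faces on the same side.\<close>

lemma fill_cycle:
  assumes vs: "distinct vs" "3 \<le> length vs" "cyc_edges vs \<subseteq> ends2 G"
  shows "\<exists>S\<subseteq>internal_faces G. bd (corners ` S) = cyc_edges vs"
proof -
  define J where "J = pts G (cyc_edges vs)"
  note jd = Jordan[OF vs, folded J_def]
  have sJ: "frontier (inside J) \<subseteq> support G" "frontier (outside J) \<subseteq> support G"
    using jd(7,8) pts_support unfolding J_def by auto
  define S where "S = {f\<in>internal_faces G. f \<subseteq> inside J}"
  have SI: "S \<subseteq> internal_faces G" by (auto simp: S_def)
  have inS: "f \<in> S" if "f \<in> faces G" "f \<subseteq> inside J" for f
  proof -
    have "bounded f" using jd(5) that(2) bounded_subset by blast
    then have "f \<noteq> outer_face G" using outer_is_face(2) by blast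
    then show ?thesis using that by (simp add: S_def internal_faces_def)
  qed
  have SD: "f \<in> faces G \<and> f \<subseteq> inside J" if "f \<in> S" for f
    using that internalD by (simp add: S_def)
  have "d \<in> bd (corners ` S) \<longleftrightarrow> d \<in> cyc_edges vs" for d
  proof (cases "d \<in> ends2 G")
    case False
    then have "d \<notin> cyc_edges vs" using vs(3) by blast
    then show ?thesis unfolding bd_corners[OF SI] mem_Collect_eq no_edge_no_face[OF False] by simp
  next
    case True
    then obtain e where e: "e \<in> edges G" "d = e \<inter> verts G" unfolding ends2_def by blast
    obtain p where p: "p \<in> e" "p \<notin> verts G" using edge_interior_nonempty[OF e(1)] by blast
    let ?A = "{f\<in>faces G. d \<in> face_boundary G f}"
    obtain f1 f2 where f12: "f1 \<noteq> f2" "?A = {f1,f2}" using two_faces[OF e(1)] e(2) by blast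
    have pA: "f \<in> ?A \<longleftrightarrow> p \<in> closure f" if "f \<in> faces G" for f using incident[OF that e(1) p] that e(2) by blast
    have pJ: "p \<in> J \<longleftrightarrow> d \<in> cyc_edges vs" unfolding J_def e(2) by (rule pts_edge_iff[OF e(1) p])
    have S_A: "{f\<in>S. d \<in> face_boundary G f} = {f\<in>?A. f \<subseteq> inside J}"
      by (auto dest: SD intro: inS)
    have iff: "d \<in> bd (corners ` S) \<longleftrightarrow> odd (card {f\<in>?A. f \<subseteq> inside J})"
    proof -
      have "d \<in> bd (corners ` S) \<longleftrightarrow> card d = 2 \<and> odd (card {f\<in>S. d \<in> face_boundary G f})"
        unfolding bd_corners[OF SI] by simp
      then show ?thesis using edge_card2[OF e(1)] unfolding S_A e(2)[symmetric] by simp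
    qed
    have io: "inside J \<inter> outside J = {}" by simp
    show ?thesis
    proof (cases "p \<in> J")
      case True
      have "p \<in> closure (inside J)" "p \<in> closure (outside J)" using True jd(7,8) by (metis DiffD1 frontier_def)+
      then obtain fi fo where fi: "fi \<in> faces G" "p \<in> closure fi" "fi \<inter> inside J \<noteq> {}"
        and fo: "fo \<in> faces G" "p \<in> closure fo" "fo \<inter> outside J \<noteq> {}"
        using closure_face[OF jd(1)] closure_face[OF jd(3)] by metis
      have s: "fi \<subseteq> inside J" "fo \<subseteq> outside J" using face_side[OF fi(1,3) sJ(1)] face_side[OF fo(1,3) sJ(2)] by auto
      have "fi \<in> ?A" "fo \<in> ?A" using pA fi fo by blast+
      moreover have "fi \<noteq> fo" using s io fi(3) by blast
      ultimately have A: "?A = {fi,fo}" unfolding f12(2) by blast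
      have "\<not> fo \<subseteq> inside J" using s(2) io fo(3) by blast
      then have "{f\<in>?A. f \<subseteq> inside J} = {fi}" unfolding A using s(1) by blast
      then show ?thesis using iff pJ True by simp
    next
      case False
      have "{f\<in>?A. f \<subseteq> inside J} = ?A \<or> {f\<in>?A. f \<subseteq> inside J} = {}"
      proof (cases "p \<in> inside J")
        case True
        have "f \<subseteq> inside J" if "f \<in> ?A" for f
        proof -
          have f: "f \<in> faces G" "p \<in> closure f" using that pA[of f] by auto
          then have "f \<inter> inside J \<noteq> {}" using open_Int_closure_eq_empty[OF jd(1), of f] True by blast
          then show ?thesis by (rule face_side[OF f(1) _ sJ(1)])
        qed
        then show ?thesis by blast
      next
        case F2: False
        then have po: "p \<in> outside J" using False inside_Un_outside[of J] by blast
        have "\<not> f \<subseteq> inside J" if "f \<in> ?A" for f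
        proof -
          have f: "f \<in> faces G" "p \<in> closure f" using that pA[of f] by auto
          then have "outside J \<inter> f \<noteq> {}" using open_Int_closure_eq_empty[OF jd(3), of f] po by blast
          then show ?thesis using io by blast
        qed
        then show ?thesis by blast
      qed
      then have "even (card {f\<in>?A. f \<subseteq> inside J})"
      proof (elim disjE)
        assume "{f\<in>?A. f \<subseteq> inside J} = ?A"
        moreover have "card ?A = 2" unfolding f12(2) using f12(1) by simp
        ultimately have "card {f\<in>?A. f \<subseteq> inside J} = 2" by (simp only:)
        then show ?thesis by (simp only: even_numeral)
      next
        assume "{f\<in>?A. f \<subseteq> inside J} = {}"
        then show ?thesis by (simp only: card.empty even_zero)
      qed
      then show ?thesis using iff pJ False by simp
    qed
  qed
  then show ?thesis using SI by blast
qed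

lemma corners_card3: "t \<in> corners ` S \<Longrightarrow> S \<subseteq> internal_faces G \<Longrightarrow> card t = 3"
  using internal_triangle(2) by blast

text \<open>Cycles are split off one at a time, and their fillings are added modulo 2.\<close>

lemma fill_even:
  assumes "finite Z" "Z \<subseteq> ends2 G" "even_set Z"
  shows "\<exists>S\<subseteq>internal_faces G. bd (corners ` S) = Z"
  using assms
proof (induction Z rule: finite_psubset_induct)
  case (psubset Z)
  have c2: "card d = 2" if "d \<in> Z" for d using that psubset.prems(1) ends2_card by blast
  show ?case
  proof (cases "Z = {}")
    case True then show ?thesis by (intro exI[of _ "{}"]) simp
  next
    case False
    obtain vs where vs: "distinct vs" "3 \<le> length vs" "cyc_edges vs \<subseteq> Z"
      using even_set_contains_cycle[OF psubset.hyps c2 psubset.prems(2) False] by blast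
    have cne: "cyc_edges vs \<noteq> {}" using circuit_cyc(1)[OF vs(1,2)] by (simp add: circuit_def)
    have sd: "Z - cyc_edges vs = sym_diff Z (cyc_edges vs)" using vs(3) by blast
    have "even_set (sym_diff Z (cyc_edges vs))"
      by (rule even_set_sym_diff[OF psubset.hyps finite_cyc psubset.prems(2) circuit_even[OF circuit_cyc(1)[OF vs(1,2)]]])
    then have ev: "even_set (Z - cyc_edges vs)" by (subst sd)
    have ps: "Z - cyc_edges vs \<subset> Z" using vs(3) cne by blast
    have "Z - cyc_edges vs \<subseteq> ends2 G" using psubset.prems(1) by blast
    then obtain S1 where S1: "S1 \<subseteq> internal_faces G" "bd (corners ` S1) = Z - cyc_edges vs"
      using psubset.IH[OF ps _ ev] by blast
    obtain S2 where S2: "S2 \<subseteq> internal_faces G" "bd (corners ` S2) = cyc_edges vs"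
      using fill_cycle[OF vs(1,2)] vs(3) psubset.prems(1) by blast
    have f: "finite (corners ` S1)" "finite (corners ` S2)" using S1(1) S2(1) fin_internal finite_subset by blast+
    have "sym_diff (corners ` S1) (corners ` S2) = corners ` sym_diff S1 S2"
    proof -
      have "corners ` (S1 - S2) = corners ` S1 - corners ` S2" "corners ` (S2 - S1) = corners ` S2 - corners ` S1"
        using S1(1) S2(1) by (intro inj_on_image_set_diff[OF inj_corners]; blast)+
      then show ?thesis by (simp only: image_Un)
    qed
    then have "bd (corners ` sym_diff S1 S2) = sym_diff (Z - cyc_edges vs) (cyc_edges vs)"
      using bd_sym_diff[OF f] S1(2) S2(2) by simp
    also have "\<dots> = Z" using vs(3) by blast
    finally have b: "bd (corners ` sym_diff S1 S2) = Z" .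
    have "sym_diff S1 S2 \<subseteq> internal_faces G" using S1(1) S2(1) by blast
    then show ?thesis using b by (intro exI[of _ "sym_diff S1 S2"] conjI)
  qed
qed

lemma disc_triangles: "disc triangles"
proof
  show "finite triangles" unfolding triangles_def using fin_internal by simp
  show "card t = 3" if "t \<in> triangles" for t using that corners_card3 unfolding triangles_def by blast
  show "card {t \<in> triangles. d \<subseteq> t} \<le> 2" if "card d = 2" for d
  proof (cases "d \<in> ends2 G")
    case True
    then obtain e where e: "e \<in> edges G" "d = e \<inter> verts G" unfolding ends2_def by blast
    then show ?thesis unfolding triangles_def using card_corners[OF subset_refl that] internal_count[OF e(1)] by simp
  next
    case False
    then show ?thesis unfolding triangles_def using card_corners[OF subset_refl that] no_edge_no_face[OF False] by simp
  qed
  show "S = {}" if S: "S \<subseteq> triangles" "bd S = {}" for S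
  proof -
    obtain I where "I \<subseteq> internal_faces G" "S = corners ` I" using S(1) unfolding triangles_def by (metis subset_image_iff)
    then show ?thesis using bd_corners_inj S(2) by blast
  qed
  show "\<exists>S\<subseteq>triangles. bd S = Z" if Z: "Z \<subseteq> sides triangles" "even_set Z" for Z
  proof -
    have "finite (ends2 G)" unfolding ends2_def using fin_edges by simp
    moreover have ZE: "Z \<subseteq> ends2 G" using Z(1) sides_triangles by simp
    ultimately have "finite Z" by (rule finite_subset[rotated])
    then obtain S where "S \<subseteq> internal_faces G" "bd (corners ` S) = Z"
      using fill_even[OF _ ZE Z(2)] by blast
    then show ?thesis unfolding triangles_def by blast
  qed
  obtain vs where "distinct vs" "3 \<le> length vs" "face_boundary G (outer_face G) = cyc_edges vs" using outer_cycle by metis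
  then show "circuit (bd triangles)" unfolding bd_triangles using circuit_cyc(1) by simp
qed

lemma adjacent_sides: "adjacent G u v \<longleftrightarrow> {u,v} \<in> sides triangles"
  unfolding sides_triangles adjacent_ends2 ..

lemma Un_bd_triangles: "\<Union>(bd triangles) = boundary_verts G"
proof -
  obtain vs where vs: "distinct vs" "3 \<le> length vs" "face_boundary G (outer_face G) = cyc_edges vs" "boundary_verts G = set vs"
    using outer_cycle by metis
  show ?thesis unfolding bd_triangles vs(3,4) by (rule circuit_cyc(2)[OF vs(1,2)])
qed

lemma disc6_triangles:
  assumes "\<forall>v\<in>internal_verts G. 6 \<le> vdegree G v" shows "disc6 triangles"
proof -
  interpret D: disc triangles by (rule disc_triangles)
  show ?thesis
  proof
    fix v assume v: "v \<in> \<Union>triangles - \<Union>(bd triangles)"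
    then have "v \<in> internal_verts G" unfolding Un_triangles Un_bd_triangles internal_verts_def .
    then have "6 \<le> vdegree G v" using assms by blast
    also have "vdegree G v = deg triangles v" unfolding vdegree_def adjacent_sides by (rule D.deg_eq_neighbours) (use v in blast)
    finally show "6 \<le> deg triangles v" .
  qed
qed

text \<open>Discs are connected, so the infimum is attained and never \<infinity>.\<close>

lemma gdist_tdist:
  assumes "u \<in> verts G" "v \<in> verts G" shows "gdist G u v = enat (tdist triangles u v)"
proof -
  interpret D: disc triangles by (rule disc_triangles)
  have "(u, v) \<in> {(x, y). {x,y} \<in> sides triangles} ^^ tdist triangles u v" using D.tdist_relpow assms Un_triangles by blast
  then show ?thesis unfolding gdist_def adjacent_sides
    by (intro antisym INF_lower INF_greatest) (auto intro: tdist_le_relpow)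
qed

end

theorem theorem1p1:
  fixes T1 T2 :: pgraph and \<phi> :: "complex \<Rightarrow> complex"
  assumes "near_triangulation T1" and "near_triangulation T2"
    and "\<forall>v\<in>internal_verts T1. 6 \<le> vdegree T1 v"
    and "\<forall>v\<in>internal_verts T2. 6 \<le> vdegree T2 v"
    and "bij_betw \<phi> (boundary_verts T1) (boundary_verts T2)"
    and "\<forall>u\<in>boundary_verts T1. \<forall>v\<in>boundary_verts T1. gdist T1 u v = gdist T2 (\<phi> u) (\<phi> v)"
  shows "\<exists>\<psi>. graph_iso T1 T2 \<psi> \<and>
           (\<forall>v\<in>boundary_verts T1. \<psi> v = \<phi> v) \<and>
           face_boundary T2 (outer_face T2) = image \<psi> ` face_boundary T1 (outer_face T1) \<and>
           (\<exists>\<Phi>. bij_betw \<Phi> (internal_faces T1) (internal_faces T2) \<and>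
             (\<forall>f\<in>internal_faces T1. face_boundary T2 (\<Phi> f) = image \<psi> ` face_boundary T1 f))"
proof -
  interpret N1: ntri T1 by unfold_locales fact
  interpret N2: ntri T2 by unfold_locales fact
  let ?F1 = "N1.triangles" and ?F2 = "N2.triangles"
  have D6: "disc6 ?F1" "disc6 ?F2" using N1.disc6_triangles N2.disc6_triangles assms(3,4) by blast+
  interpret D1: disc6 ?F1 by (rule D6(1))
  interpret D2: disc6 ?F2 by (rule D6(2))
  obtain vs where vs: "distinct vs" "3 \<le> length vs" "face_boundary T1 (outer_face T1) = cyc_edges vs" "boundary_verts T1 = set vs"
    using N1.outer_cycle by metis
  obtain us where us: "distinct us" "3 \<le> length us" "face_boundary T2 (outer_face T2) = cyc_edges us" "boundary_verts T2 = set us"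
    using N2.outer_cycle by metis
  have bij: "bij_betw \<phi> (set vs) (set us)" using assms(5) vs(4) us(4) by simp
  have bV: "boundary_verts T1 \<subseteq> verts T1" "boundary_verts T2 \<subseteq> verts T2" by (auto simp: boundary_verts_def)
  have dd: "tdist ?F1 u v = tdist ?F2 (\<phi> u) (\<phi> v)" if "u \<in> set vs" "v \<in> set vs" for u v
  proof -
    have "\<phi> u \<in> set us" "\<phi> v \<in> set us" using bij that by (auto simp: bij_betw_def)
    then have "u \<in> verts T1" "v \<in> verts T1" "\<phi> u \<in> verts T2" "\<phi> v \<in> verts T2" using bV vs(4) us(4) that by auto
    moreover have "gdist T1 u v = gdist T2 (\<phi> u) (\<phi> v)" using assms(6) that vs(4) by simp
    ultimately show ?thesis using N1.gdist_tdist N2.gdist_tdist by simp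
  qed
  have b1: "bd ?F1 = cyc_edges vs" and b2: "bd ?F2 = cyc_edges us" using N1.bd_triangles N2.bd_triangles vs(3) us(3) by simp_all
  \<comment> \<open>The cyclic order is recovered from the distances before the rigidity of discs
    can be used.\<close>
  have cu: "cyc_edges us = cyc_edges (map \<phi> vs)"
    by (rule boundary_cycle_preserved[OF D1.disc_axioms D2.disc_axioms vs(1,2) b1 us(1,2) b2 bij dd])
  have "inj_on \<phi> (set vs)" using bij by (simp add: bij_betw_def)
  then obtain \<psi> where \<psi>: "inj_on \<psi> (\<Union>?F1)" "\<forall>v\<in>set vs. \<psi> v = \<phi> v" "?F2 = image \<psi> ` ?F1"
    using disc6_rigid[OF D6 vs(1) _ vs(2) b1 _ dd] b2 cu by blast
  have inj: "inj_on \<psi> (verts T1)" using \<psi>(1) N1.Un_triangles by simp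
  have im: "\<psi> ` verts T1 = verts T2"
    using N1.Un_triangles N2.Un_triangles \<psi>(3) by (metis image_Union)
  have edge: "{\<psi> u, \<psi> v} \<in> sides ?F2 \<longleftrightarrow> {u,v} \<in> sides ?F1" if uv: "u \<in> verts T1" "v \<in> verts T1" for u v
  proof -
    have m: "\<psi> x \<in> \<psi> ` t \<longleftrightarrow> x \<in> t" if "x \<in> verts T1" "t \<in> ?F1" for x t
      using inj_on_image_mem_iff[OF inj that(1), of t] that(2) N1.Un_triangles by blast
    have "{\<psi> u, \<psi> v} \<in> sides ?F2 \<longleftrightarrow> \<psi> u \<noteq> \<psi> v \<and> (\<exists>t\<in>?F1. \<psi> u \<in> \<psi> ` t \<and> \<psi> v \<in> \<psi> ` t)"
      unfolding \<psi>(3) sides_def by (auto simp: card_2_iff doubleton_eq_iff)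
    also have "\<dots> \<longleftrightarrow> u \<noteq> v \<and> (\<exists>t\<in>?F1. u \<in> t \<and> v \<in> t)"
      using m uv inj_on_eq_iff[OF inj uv] by blast
    also have "\<dots> \<longleftrightarrow> {u,v} \<in> sides ?F1" unfolding sides_def by (auto simp: card_2_iff doubleton_eq_iff)
    finally show ?thesis .
  qed
  have iso: "graph_iso T1 T2 \<psi>"
    unfolding graph_iso_def bij_betw_def N1.adjacent_sides N2.adjacent_sides using inj im edge by blast
  have outer: "face_boundary T2 (outer_face T2) = image \<psi> ` face_boundary T1 (outer_face T1)"
  proof -
    have "map \<phi> vs = map \<psi> vs" using \<psi>(2) by simp
    then show ?thesis unfolding vs(3) us(3) cu by (simp only: cyc_edges_map)
  qed
  \<comment> \<open>An internal face is determined by its corners, so the bijection between the sets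
    of triangles is carried back to faces.\<close>
  define \<Phi> where "\<Phi> f = inv_into (internal_faces T2) N2.corners (\<psi> ` N1.corners f)" for f
  have b1': "bij_betw N1.corners (internal_faces T1) ?F1" and b2': "bij_betw N2.corners (internal_faces T2) ?F2"
    using N1.inj_corners N2.inj_corners by (simp_all add: bij_betw_def N1.triangles_def N2.triangles_def)
  have "inj_on (image \<psi>) ?F1"
    by (rule inj_on_subset[OF inj_on_image_Pow[OF \<psi>(1)]]) blast
  then have "bij_betw (image \<psi>) ?F1 ?F2" using \<psi>(3) by (simp add: bij_betw_def)
  from bij_betw_trans[OF bij_betw_trans[OF b1' this] bij_betw_inv_into[OF b2']]
  have bij\<Phi>: "bij_betw \<Phi> (internal_faces T1) (internal_faces T2)"
    unfolding \<Phi>_def comp_def .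
  have "face_boundary T2 (\<Phi> f) = image \<psi> ` face_boundary T1 f" if f: "f \<in> internal_faces T1" for f
  proof -
    have t1: "N1.corners f \<in> ?F1" using f by (simp add: N1.triangles_def)
    then have "\<psi> ` N1.corners f \<in> N2.corners ` internal_faces T2" using \<psi>(3) N2.triangles_def by auto
    then have t2: "N2.corners (\<Phi> f) = \<psi> ` N1.corners f" unfolding \<Phi>_def by (rule f_inv_into_f)
    have \<Phi>f: "\<Phi> f \<in> internal_faces T2" using bij\<Phi> f by (auto simp: bij_betw_def)
    obtain a b c where abc: "N1.corners f = {a,b,c}" "a \<noteq> b" "b \<noteq> c" "a \<noteq> c"
      using D1.card3[OF t1] by (auto simp: card_3_iff)
    have "a \<in> \<Union>?F1" "b \<in> \<Union>?F1" "c \<in> \<Union>?F1" using t1 abc(1) by blast+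
    then have ne: "\<psi> a \<noteq> \<psi> b" "\<psi> b \<noteq> \<psi> c" "\<psi> a \<noteq> \<psi> c" using abc(2-4) \<psi>(1) by (auto dest: inj_onD)
    have "face_boundary T2 (\<Phi> f) = {d. card d = 2 \<and> d \<subseteq> {\<psi> a, \<psi> b, \<psi> c}}"
      using N2.internal_triangle(1)[OF \<Phi>f] t2 abc(1) by simp
    moreover have "face_boundary T1 f = {d. card d = 2 \<and> d \<subseteq> {a, b, c}}"
      using N1.internal_triangle(1)[OF f] abc(1) by simp
    ultimately show ?thesis unfolding pairs_triangle[OF ne] pairs_triangle[OF abc(2-4)] by simp
  qed
  then show ?thesis using iso \<psi>(2) vs(4) outer bij\<Phi> by blast
qed

end
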